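(* Let $\mathbf{R}$ be a ring, let $n\ge 1$, and let $\prec$ be a rational monomial order on $\mathbf{R}[X_1,\dots,X_n]$. Let $\mathbf{R}_{\prec}\langle X_1,\dots,X_n\rangle$ be the localization of $\mathbf{R}[X_1,\dots,X_n]$ at the multiplicative set of $\prec$-monic polynomials. (1) $\mathbf{R}_{\prec}\langle X_1,\dots,X_n\rangle$ is a Bézout domain if and only if $\mathbf{R}$ is a Bézout domain of Krull dimension $\le 1$. In this case, $\mathbf{R}_{\prec}\langle X_1,\dots,X_n\rangle$ has Krull dimension $\le 1$. (2) $\mathbf{R}_{\prec}\langle X_1,\dots,X_n\rangle$ is a Prüfer domain if and only if $\mathbf{R}$ is a Prüfer domain of Krull dimension $\le 1$. In this case, $\mathbf{R}_{\prec}\langle X_1,\dots,X_n\rangle$ has Krull dimension $\le 1$.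
   Context: All rings are commutative, unitary (and, in a constructive reading, strongly discrete, i.e. equipped with a membership test for finitely generated ideals). A rational monomial order $\prec$ on $\mathbf{R}[X_1,\dots,X_n]$ is a total order on monomials given by a matrix $M\in\mathbb{Z}_{\ge 0}^{n\times n}$ of rank $n$ via: $X^{e}\prec X^{f}$ if and only if the vector $Me$ is smaller than $Mf$ for the lexicographic order on vectors (compare first entries first), where $e,f\in\mathbb{N}^n$ are column vectors. For a nonzero polynomial $f$, $\mathrm{LC}_{\prec}(f)$ is the coefficient of the $\prec$-largest monomial of $f$; $f$ is $\prec$-monic if $\mathrm{LC}_{\prec}(f)=1$. The $\prec$-monic polynomials form a multiplicative set. A Bézout domain is an integral domain in which every finitely generated ideal is principal. A Prüfer domain is an integral domain which is locally a valuation ring (equivalently, arithmetical). *)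

theory Defs
  imports
    "HOL-Algebra.Ideal"
    "HOL-Algebra.Divisibility"
    "HOL-Library.Extended_Nat"
    "Jordan_Normal_Form.DL_Rank"
begin

section \<open>Rational monomial orders\<close>

text \<open>The monomial \<open>X\<^sup>e\<close> in \<open>n\<close> variables is represented by its exponent vector
  \<open>e \<in> carrier_vec n\<close>. The instance order on \<open>vec\<close> is the pointwise one, so the
  lexicographic order is defined separately.\<close>

definition vec_lex_less :: "nat vec \<Rightarrow> nat vec \<Rightarrow> bool" where
  "vec_lex_less v w \<longleftrightarrow>
     dim_vec v = dim_vec w \<and>
     (\<exists>k < dim_vec v. (\<forall>i < k. v $ i = w $ i) \<and> v $ k < w $ k)"

text \<open>The rank of the nonnegative integer matrix \<open>M\<close> is its rank over the rationals.
  Only the values of \<open>prec\<close> on \<open>carrier_vec n\<close> matter.\<close>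

definition rational_monomial_order :: "nat \<Rightarrow> (nat vec \<Rightarrow> nat vec \<Rightarrow> bool) \<Rightarrow> bool" where
  "rational_monomial_order n prec \<longleftrightarrow>
     (\<exists>M :: nat mat. M \<in> carrier_mat n n \<and>
        vec_space.rank n (map_mat rat_of_nat M) = n \<and>
        (\<forall>e \<in> carrier_vec n. \<forall>f \<in> carrier_vec n.
           prec e f \<longleftrightarrow> vec_lex_less (M *\<^sub>v e) (M *\<^sub>v f)))"


section \<open>Polynomials in \<open>n\<close> variables\<close>

text \<open>A polynomial is the function sending an exponent vector to its coefficient;
  outside \<open>carrier_vec n\<close> it takes the value zero.\<close>

definition mpoly_ring :: "('a, 'm) ring_scheme \<Rightarrow> nat \<Rightarrow> (nat vec \<Rightarrow> 'a) ring" where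
  "mpoly_ring R n =
     \<lparr> carrier = {p. (\<forall>e \<in> carrier_vec n. p e \<in> carrier R) \<and>
                    (\<forall>e. e \<notin> carrier_vec n \<longrightarrow> p e = \<zero>\<^bsub>R\<^esub>) \<and>
                    finite {e. p e \<noteq> \<zero>\<^bsub>R\<^esub>}},
       monoid.mult = (\<lambda>p q e. if e \<in> carrier_vec n
                then finsum R (\<lambda>(d, d'). p d \<otimes>\<^bsub>R\<^esub> q d')
                       {(d, d'). d \<in> carrier_vec n \<and> d' \<in> carrier_vec n \<and> d + d' = e}
                else \<zero>\<^bsub>R\<^esub>),
       one = (\<lambda>e. if e = 0\<^sub>v n then \<one>\<^bsub>R\<^esub> else \<zero>\<^bsub>R\<^esub>),
       zero = (\<lambda>e. \<zero>\<^bsub>R\<^esub>),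
       add = (\<lambda>p q e. if e \<in> carrier_vec n then p e \<oplus>\<^bsub>R\<^esub> q e else \<zero>\<^bsub>R\<^esub>) \<rparr>"

definition lead_monom ::
    "('a, 'm) ring_scheme \<Rightarrow> (nat vec \<Rightarrow> nat vec \<Rightarrow> bool) \<Rightarrow> (nat vec \<Rightarrow> 'a) \<Rightarrow> nat vec" where
  "lead_monom R prec p =
     (THE e. p e \<noteq> \<zero>\<^bsub>R\<^esub> \<and> (\<forall>d. p d \<noteq> \<zero>\<^bsub>R\<^esub> \<and> d \<noteq> e \<longrightarrow> prec d e))"

text \<open>The zero polynomial gets leading coefficient zero. It is thus monic exactly over the
  trivial ring, so that the monic polynomials contain the unit in that case too.\<close>

definition lead_coef ::
    "('a, 'm) ring_scheme \<Rightarrow> (nat vec \<Rightarrow> nat vec \<Rightarrow> bool) \<Rightarrow> (nat vec \<Rightarrow> 'a) \<Rightarrow> 'a" where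
  "lead_coef R prec p =
     (if p = (\<lambda>e. \<zero>\<^bsub>R\<^esub>) then \<zero>\<^bsub>R\<^esub> else p (lead_monom R prec p))"

definition monic_mpolys ::
    "('a, 'm) ring_scheme \<Rightarrow> nat \<Rightarrow> (nat vec \<Rightarrow> nat vec \<Rightarrow> bool) \<Rightarrow> (nat vec \<Rightarrow> 'a) set" where
  "monic_mpolys R n prec =
     {p \<in> carrier (mpoly_ring R n). lead_coef R prec p = \<one>\<^bsub>R\<^esub>}"


section \<open>Localization at a multiplicative set\<close>

definition frac_rel :: "('a, 'm) ring_scheme \<Rightarrow> 'a set \<Rightarrow> (('a \<times> 'a) \<times> ('a \<times> 'a)) set" where
  "frac_rel A S =
     {((a, s), (b, t)). a \<in> carrier A \<and> s \<in> S \<and> b \<in> carrier A \<and> t \<in> S \<and>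
        (\<exists>u \<in> S. u \<otimes>\<^bsub>A\<^esub> (a \<otimes>\<^bsub>A\<^esub> t) = u \<otimes>\<^bsub>A\<^esub> (b \<otimes>\<^bsub>A\<^esub> s))}"

definition frac_class :: "('a, 'm) ring_scheme \<Rightarrow> 'a set \<Rightarrow> 'a \<Rightarrow> 'a \<Rightarrow> ('a \<times> 'a) set" where
  "frac_class A S a s = frac_rel A S `` {(a, s)}"

text \<open>The operations are unions over all representatives, in the style of quotients by
  \<open>equiv\<close>; for multiplicative \<open>S\<close> all members of the union coincide.\<close>

definition localization :: "('a, 'm) ring_scheme \<Rightarrow> 'a set \<Rightarrow> ('a \<times> 'a) set ring" where
  "localization A S =
     \<lparr> carrier = (carrier A \<times> S) // frac_rel A S,
       monoid.mult = (\<lambda>x y. \<Union>(a, s) \<in> x. \<Union>(b, t) \<in> y.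
                 frac_class A S (a \<otimes>\<^bsub>A\<^esub> b) (s \<otimes>\<^bsub>A\<^esub> t)),
       one = frac_class A S \<one>\<^bsub>A\<^esub> \<one>\<^bsub>A\<^esub>,
       zero = frac_class A S \<zero>\<^bsub>A\<^esub> \<one>\<^bsub>A\<^esub>,
       add = (\<lambda>x y. \<Union>(a, s) \<in> x. \<Union>(b, t) \<in> y.
                 frac_class A S (a \<otimes>\<^bsub>A\<^esub> t \<oplus>\<^bsub>A\<^esub> b \<otimes>\<^bsub>A\<^esub> s) (s \<otimes>\<^bsub>A\<^esub> t)) \<rparr>"

definition monic_localization ::
    "('a, 'm) ring_scheme \<Rightarrow> nat \<Rightarrow> (nat vec \<Rightarrow> nat vec \<Rightarrow> bool) \<Rightarrow>
       ((nat vec \<Rightarrow> 'a) \<times> (nat vec \<Rightarrow> 'a)) set ring" where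
  "monic_localization R n prec = localization (mpoly_ring R n) (monic_mpolys R n prec)"


section \<open>Krull dimension, Bezout domains and Pruefer domains\<close>

text \<open>With values in \<open>enat\<close> the trivial ring, which has no prime ideals, gets dimension zero.\<close>

definition krull_dim :: "('a, 'm) ring_scheme \<Rightarrow> enat" where
  "krull_dim R =
     Sup {enat k | k. \<exists>P :: nat \<Rightarrow> 'a set.
            (\<forall>i \<le> k. primeideal (P i) R) \<and> (\<forall>i < k. P i \<subset> P (Suc i))}"

locale bezout_domain = domain +
  assumes finitely_generated_principal:
    "\<lbrakk>finite F; F \<subseteq> carrier R\<rbrakk> \<Longrightarrow> principalideal (Idl F) R"

locale valuation_domain = domain +
  assumes divides_total:
    "\<lbrakk>a \<in> carrier R; b \<in> carrier R\<rbrakk> \<Longrightarrow> a divides b \<or> b divides a"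

locale prufer_domain = domain +
  assumes locally_valuation:
    "primeideal P R \<Longrightarrow> valuation_domain (localization R (carrier R - P))"

end

theory Submission
  imports Defs "HOL-Algebra.UnivPoly" "HOL-Algebra.QuotRing"
begin

text \<open>Over a domain, each of the properties Pruefer, Bezout and dimension at most one of a
  localization \<open>S\<^sup>-\<^sup>1 A\<close> amounts to the solvability of equations in \<open>A\<close> up to a factor from \<open>S\<close>.

  If the equations are solvable in \<open>R[X\<^sub>1, \<dots>, X\<^sub>n]\<close> up to a monic factor, comparing leading
  coefficients solves them in \<open>R\<close>; applied to \<open>a\<close> and \<open>1 + b X\<^sub>1\<close> this bounds the dimension of \<open>R\<close>.

  Conversely, they pass from \<open>(B, S)\<close> to \<open>(B[X], T)\<close>, where \<open>T\<close> consists of the polynomials with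
  leading coefficient in \<open>S\<close>: if a prime \<open>Q\<close> of \<open>B[X]\<close> disjoint from \<open>T\<close> contracts to \<open>p \<noteq> 0\<close>,
  then \<open>p\<close> is maximal among the ideals disjoint from \<open>S\<close> and \<open>Q = p[X]\<close>, and contents decide; if it
  contracts to \<open>0\<close>, the Euclidean algorithm over the field of fractions of \<open>B\<close> does. Iterating
  gives the lexicographic order. A rational order with matrix \<open>M\<close> is induced from it by
  \<open>X\<^sup>e \<mapsto> X\<^bsup>M e\<^esup>\<close>, and since \<open>M\<close> generates a lattice of finite index, solutions can be
  multiplied by a monomial and projected to that lattice without losing monicity.\<close>

section \<open>Prime ideals avoiding a multiplicative set\<close>

text \<open>The conditions are equations between elements up to \<open>S\<close>, not statements
  about fractions or ideals, because in that form they concern finitely many elements and pass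
  through surjective homomorphisms without rebuilding a localization. Prime ideals enter by
  contradiction: Zorn's lemma turns the failure of an equation into a prime disjoint from
  \<open>S\<close>. The induction on the number of variables cannot treat the Pruefer condition
  alone: the passage to \<open>T\<close> uses the dimension bound of the previous stage, and that
  bound is itself passed on by means of contents, so both are carried together. The descent to the
  given order rests on a projection that is linear only over the image of the substitution. The
  Pruefer and dimension equations are linear in their unknowns and descend at once. The Bezout
  condition contains the products \<open>u x\<close> and \<open>v y\<close> of unknowns, so its
  descent, and likewise its restriction to coefficients, goes through the gcd
  \<open>u a + v b\<close> and a comparison of leading coefficients.\<close>

lemma (in cring) ideal_by_closure:
  assumes "I \<subseteq> carrier R" "\<zero> \<in> I"
    and "\<And>a b. a \<in> I \<Longrightarrow> b \<in> I \<Longrightarrow> a \<oplus> b \<in> I"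
    and mult: "\<And>a x. a \<in> I \<Longrightarrow> x \<in> carrier R \<Longrightarrow> x \<otimes> a \<in> I"
  shows "ideal I R"
proof (rule idealI)
  show "ring R" by (rule ring_axioms)
  have neg: "\<ominus> a \<in> I" if "a \<in> I" for a
    using mult[OF that, of "\<ominus> \<one>"] that assms(1) by (simp add: l_minus subset_iff)
  show "subgroup I (add_monoid R)"
    by (rule add.subgroupI) (use assms neg in \<open>auto simp: a_inv_def[symmetric]\<close>)
  show "x \<otimes> a \<in> I" if "a \<in> I" "x \<in> carrier R" for a x
    using mult that by blast
  show "a \<otimes> x \<in> I" if "a \<in> I" "x \<in> carrier R" for a x
    using mult[OF that] that assms(1) by (simp add: m_comm subset_iff)
qed

lemma (in cring) add_cgenideal:
  assumes "ideal I R" "a \<in> carrier R"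
  shows "ideal {i \<oplus> x \<otimes> a | i x. i \<in> I \<and> x \<in> carrier R} R"
proof -
  have "{i \<oplus> x \<otimes> a | i x. i \<in> I \<and> x \<in> carrier R} = I <+> PIdl a"
    unfolding cgenideal_def set_add_defs by auto
  then show ?thesis
    using add_ideals[OF assms(1) cgenideal_ideal[OF assms(2)]] by simp
qed

lemma (in cring) add_cgenideal_contains:
  assumes "ideal I R" "a \<in> carrier R"
  shows "I \<subseteq> {i \<oplus> x \<otimes> a | i x. i \<in> I \<and> x \<in> carrier R}"
    and "a \<in> {i \<oplus> x \<otimes> a | i x. i \<in> I \<and> x \<in> carrier R}"
proof
  have e: "i = i \<oplus> \<zero> \<otimes> a" if "i \<in> I" for i
    using ideal.Icarr[OF assms(1) that] assms(2) by simp
  show "i \<in> {i \<oplus> x \<otimes> a | i x. i \<in> I \<and> x \<in> carrier R}" if "i \<in> I" for i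
    using e[OF that] that zero_closed by blast
  have "a = \<zero> \<oplus> \<one> \<otimes> a" using assms by simp
  then show "a \<in> {i \<oplus> x \<otimes> a | i x. i \<in> I \<and> x \<in> carrier R}"
    using additive_subgroup.zero_closed[OF ideal.axioms(1)[OF assms(1)]] one_closed by blast
qed

text \<open>An ideal maximal among those containing \<open>I\<close> and missing \<open>S\<close> is
  prime: for \<open>a\<close> and \<open>b\<close> outside it, both enlarged ideals meet
  \<open>S\<close>, and the product of the two elements found there would lie in the ideal once
  \<open>a \<otimes> b\<close> does.\<close>

lemma (in cring) exists_prime_ideal_disjoint:
  assumes I: "ideal I R" and S: "submonoid S R" and dis: "I \<inter> S = {}"
  shows "\<exists>Q. primeideal Q R \<and> I \<subseteq> Q \<and> Q \<inter> S = {}"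
proof -
  define F where "F = {J. ideal J R \<and> I \<subseteq> J \<and> J \<inter> S = {}}"
  have IF: "I \<in> F" using I dis by (simp add: F_def)
  have "\<exists>Q\<in>F. \<forall>J\<in>F. Q \<subseteq> J \<longrightarrow> J = Q"
  proof (rule subset_Zorn)
    fix C assume C: "subset.chain F C"
    show "\<exists>U\<in>F. \<forall>X\<in>C. X \<subseteq> U"
    proof (cases "C = {}")
      case True
      then show ?thesis using IF by blast
    next
      case False
      have CF: "C \<subseteq> F" and lin: "\<And>X Y. X \<in> C \<Longrightarrow> Y \<in> C \<Longrightarrow> X \<subseteq> Y \<or> Y \<subseteq> X"
        using C unfolding subset.chain_def by blast+
      have id: "ideal X R" if "X \<in> C" for X
        using that CF by (auto simp: F_def)
      have "ideal (\<Union>C) R"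
      proof (rule ideal_by_closure)
        show "\<Union>C \<subseteq> carrier R" using ideal.Icarr[OF id] by blast
        show "\<zero> \<in> \<Union>C"
          using False additive_subgroup.zero_closed[OF ideal.axioms(1)[OF id]] by auto
        show "a \<oplus> b \<in> \<Union>C" if ab: "a \<in> \<Union>C" "b \<in> \<Union>C" for a b
        proof -
          obtain X where X: "X \<in> C" "a \<in> X" "b \<in> X" using ab lin by blast
          then show ?thesis using additive_subgroup.a_closed[OF ideal.axioms(1)[OF id]] by auto
        qed
        show "x \<otimes> a \<in> \<Union>C" if "a \<in> \<Union>C" "x \<in> carrier R" for a x
          using that ideal.I_l_closed[OF id] by auto
      qed
      then have "\<Union>C \<in> F" using CF False unfolding F_def by blast
      then show ?thesis by blast
    qed
  qed
  then obtain Q where QF: "Q \<in> F" and max: "\<And>J. J \<in> F \<Longrightarrow> Q \<subseteq> J \<Longrightarrow> J = Q" by blast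
  interpret Q: ideal Q R using QF by (simp add: F_def)
  have meets: "\<exists>s\<in>S. \<exists>i\<in>Q. \<exists>x\<in>carrier R. s = i \<oplus> x \<otimes> a"
    if a: "a \<in> carrier R" "a \<notin> Q" for a
  proof -
    define J where "J = {i \<oplus> x \<otimes> a | i x. i \<in> Q \<and> x \<in> carrier R}"
    have J: "ideal J R" unfolding J_def by (rule add_cgenideal) (use a Q.is_ideal in auto)
    have "Q \<subseteq> J" "a \<in> J"
      using add_cgenideal_contains[OF Q.is_ideal a(1)] by (simp_all add: J_def)
    then have "J \<inter> S \<noteq> {}"
      using max[of J] J a QF unfolding F_def by blast
    then show ?thesis unfolding J_def by blast
  qed
  have "primeideal Q R"
  proof (rule primeidealI)
    show "ideal Q R" by (rule Q.is_ideal)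
    show "cring R" by (rule is_cring)
    show "carrier R \<noteq> Q"
      using QF submonoid.one_closed[OF S] unfolding F_def by auto
    fix a b assume ab: "a \<in> carrier R" "b \<in> carrier R" "a \<otimes> b \<in> Q"
    show "a \<in> Q \<or> b \<in> Q"
    proof (rule ccontr)
      assume "\<not> (a \<in> Q \<or> b \<in> Q)"
      then obtain s i x t j y where st: "s \<in> S" "i \<in> Q" "x \<in> carrier R" "s = i \<oplus> x \<otimes> a"
        "t \<in> S" "j \<in> Q" "y \<in> carrier R" "t = j \<oplus> y \<otimes> b"
        using meets ab by metis
      note carr = Q.Icarr[OF st(2)] Q.Icarr[OF st(6)] st(3,7) ab(1,2)
      have "s \<otimes> t = i \<otimes> t \<oplus> ((x \<otimes> a) \<otimes> j \<oplus> (x \<otimes> y) \<otimes> (a \<otimes> b))"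
        unfolding st(4,8) using carr by algebra
      moreover have "i \<otimes> t \<in> Q" by (rule Q.I_r_closed) (use st carr in simp_all)
      moreover have "x \<otimes> a \<otimes> j \<in> Q" by (rule Q.I_l_closed) (use st carr in simp_all)
      moreover have "x \<otimes> y \<otimes> (a \<otimes> b) \<in> Q" by (rule Q.I_l_closed) (use ab carr in simp_all)
      ultimately have "s \<otimes> t \<in> Q" using Q.a_closed by simp
      moreover have "s \<otimes> t \<in> S" using st submonoid.m_closed[OF S] by blast
      ultimately show False using QF by (auto simp: F_def)
    qed
  qed
  then show ?thesis using QF by (auto simp: F_def)
qed

section \<open>Elementary forms of the three ring conditions\<close>

text \<open>For a domain \<open>A\<close> these say that the localization of \<open>A\<close> at \<open>S\<close> is, respectively, Pruefer,
  Bezout, and of Krull dimension at most one.\<close>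

definition arithmetical_at :: "('a, 'm) ring_scheme \<Rightarrow> 'a set \<Rightarrow> bool" where
  "arithmetical_at A S \<longleftrightarrow> (\<forall>a \<in> carrier A. \<forall>b \<in> carrier A.
     \<exists>p \<in> carrier A. \<exists>q \<in> carrier A. \<exists>x \<in> carrier A. \<exists>y \<in> carrier A.
       p \<oplus>\<^bsub>A\<^esub> q \<in> S \<and> p \<otimes>\<^bsub>A\<^esub> a = x \<otimes>\<^bsub>A\<^esub> b \<and> q \<otimes>\<^bsub>A\<^esub> b = y \<otimes>\<^bsub>A\<^esub> a)"

text \<open>\<open>x\<close> and \<open>y\<close> are \<open>a\<close> and \<open>b\<close> divided
  by a greatest common divisor, and \<open>u \<otimes> a \<oplus> v \<otimes> b\<close> is that
  divisor up to a factor from \<open>S\<close>. The divisor itself does not occur, so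
  \<open>a = b = \<zero>\<close> is no exception.\<close>

definition bezout_at :: "('a, 'm) ring_scheme \<Rightarrow> 'a set \<Rightarrow> bool" where
  "bezout_at A S \<longleftrightarrow> (\<forall>a \<in> carrier A. \<forall>b \<in> carrier A.
     \<exists>x \<in> carrier A. \<exists>y \<in> carrier A. \<exists>u \<in> carrier A. \<exists>v \<in> carrier A.
       a \<otimes>\<^bsub>A\<^esub> y = b \<otimes>\<^bsub>A\<^esub> x \<and> u \<otimes>\<^bsub>A\<^esub> x \<oplus>\<^bsub>A\<^esub> v \<otimes>\<^bsub>A\<^esub> y \<in> S)"

text \<open>The Coquand-Lombardi criterion: dimension at most one means that for all
  \<open>a\<close>, \<open>b\<close> some product \<open>a^j (b^k (1 - b v) - a u)\<close> vanishes.
  In a domain the power of a nonzero \<open>a\<close> cancels, which leaves this equation with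
  \<open>s\<close> in place of 1.\<close>

definition dim_le_one_at :: "('a, 'm) ring_scheme \<Rightarrow> 'a set \<Rightarrow> bool" where
  "dim_le_one_at A S \<longleftrightarrow> (\<forall>a \<in> carrier A - {\<zero>\<^bsub>A\<^esub>}. \<forall>b \<in> carrier A.
     \<exists>k::nat. \<exists>s \<in> S. \<exists>u \<in> carrier A. \<exists>v \<in> carrier A.
       b [^]\<^bsub>A\<^esub> k \<otimes>\<^bsub>A\<^esub> s = a \<otimes>\<^bsub>A\<^esub> u \<oplus>\<^bsub>A\<^esub> b [^]\<^bsub>A\<^esub> Suc k \<otimes>\<^bsub>A\<^esub> v)"

lemma arithmetical_atE:
  assumes "arithmetical_at A S" "a \<in> carrier A" "b \<in> carrier A"
  obtains p q x y where "p \<in> carrier A" "q \<in> carrier A" "x \<in> carrier A" "y \<in> carrier A"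
    "p \<oplus>\<^bsub>A\<^esub> q \<in> S" "p \<otimes>\<^bsub>A\<^esub> a = x \<otimes>\<^bsub>A\<^esub> b" "q \<otimes>\<^bsub>A\<^esub> b = y \<otimes>\<^bsub>A\<^esub> a"
  using assms(1)[unfolded arithmetical_at_def, rule_format, OF assms(2,3)]
  by (elim bexE conjE) (rule that)

lemma arithmetical_atI:
  assumes "\<And>a b. a \<in> carrier A \<Longrightarrow> b \<in> carrier A \<Longrightarrow>
     \<exists>p q x y. p \<in> carrier A \<and> q \<in> carrier A \<and> x \<in> carrier A \<and> y \<in> carrier A \<and>
       p \<oplus>\<^bsub>A\<^esub> q \<in> S \<and> p \<otimes>\<^bsub>A\<^esub> a = x \<otimes>\<^bsub>A\<^esub> b \<and> q \<otimes>\<^bsub>A\<^esub> b = y \<otimes>\<^bsub>A\<^esub> a"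
  shows "arithmetical_at A S"
  unfolding arithmetical_at_def using assms by simp blast

lemma bezout_atE:
  assumes "bezout_at A S" "a \<in> carrier A" "b \<in> carrier A"
  obtains x y u v where "x \<in> carrier A" "y \<in> carrier A" "u \<in> carrier A" "v \<in> carrier A"
    "a \<otimes>\<^bsub>A\<^esub> y = b \<otimes>\<^bsub>A\<^esub> x" "u \<otimes>\<^bsub>A\<^esub> x \<oplus>\<^bsub>A\<^esub> v \<otimes>\<^bsub>A\<^esub> y \<in> S"
  using assms(1)[unfolded bezout_at_def, rule_format, OF assms(2,3)]
  by (elim bexE conjE) (rule that)

lemma bezout_atI:
  assumes "\<And>a b. a \<in> carrier A \<Longrightarrow> b \<in> carrier A \<Longrightarrow>
     \<exists>x y u v. x \<in> carrier A \<and> y \<in> carrier A \<and> u \<in> carrier A \<and> v \<in> carrier A \<and>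
       a \<otimes>\<^bsub>A\<^esub> y = b \<otimes>\<^bsub>A\<^esub> x \<and> u \<otimes>\<^bsub>A\<^esub> x \<oplus>\<^bsub>A\<^esub> v \<otimes>\<^bsub>A\<^esub> y \<in> S"
  shows "bezout_at A S"
  unfolding bezout_at_def using assms by simp blast

lemma dim_le_one_atE:
  assumes "dim_le_one_at A S" "a \<in> carrier A" "a \<noteq> \<zero>\<^bsub>A\<^esub>" "b \<in> carrier A"
  obtains k s u v where "s \<in> S" "u \<in> carrier A" "v \<in> carrier A"
    "b [^]\<^bsub>A\<^esub> (k::nat) \<otimes>\<^bsub>A\<^esub> s = a \<otimes>\<^bsub>A\<^esub> u \<oplus>\<^bsub>A\<^esub> b [^]\<^bsub>A\<^esub> Suc k \<otimes>\<^bsub>A\<^esub> v"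
proof -
  have "a \<in> carrier A - {\<zero>\<^bsub>A\<^esub>}" using assms by simp
  from assms(1)[unfolded dim_le_one_at_def, rule_format, OF this assms(4)]
  show ?thesis by (elim exE bexE) (rule that)
qed

lemma dim_le_one_atI:
  assumes "\<And>a b. a \<in> carrier A \<Longrightarrow> a \<noteq> \<zero>\<^bsub>A\<^esub> \<Longrightarrow> b \<in> carrier A \<Longrightarrow>
     \<exists>(k::nat) s u v. s \<in> S \<and> u \<in> carrier A \<and> v \<in> carrier A \<and>
       b [^]\<^bsub>A\<^esub> k \<otimes>\<^bsub>A\<^esub> s = a \<otimes>\<^bsub>A\<^esub> u \<oplus>\<^bsub>A\<^esub> b [^]\<^bsub>A\<^esub> Suc k \<otimes>\<^bsub>A\<^esub> v"
  shows "dim_le_one_at A S"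
  unfolding dim_le_one_at_def using assms by simp blast

text \<open>The summands \<open>v \<otimes> y\<close> and \<open>u \<otimes> x\<close> of the
  element of \<open>S\<close> serve as \<open>p\<close> and \<open>q\<close>, since the relation
  exchanges \<open>y \<otimes> a\<close> and \<open>x \<otimes> b\<close>.\<close>

lemma (in cring) bezout_at_imp_arithmetical_at:
  assumes "bezout_at R S"
  shows "arithmetical_at R S"
proof (rule arithmetical_atI)
  fix a b assume ab: "a \<in> carrier R" "b \<in> carrier R"
  obtain x y u v where c: "x \<in> carrier R" "y \<in> carrier R" "u \<in> carrier R" "v \<in> carrier R"
    and e: "a \<otimes> y = b \<otimes> x" "u \<otimes> x \<oplus> v \<otimes> y \<in> S"
    by (rule bezout_atE[OF assms ab])
  have "v \<otimes> y \<otimes> a = v \<otimes> (a \<otimes> y)" using ab c by algebra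
  then have "(v \<otimes> y) \<otimes> a = (v \<otimes> x) \<otimes> b" unfolding e(1) using ab c by algebra
  moreover have "u \<otimes> x \<otimes> b = u \<otimes> (b \<otimes> x)" using ab c by algebra
  then have "(u \<otimes> x) \<otimes> b = (u \<otimes> y) \<otimes> a" unfolding e(1)[symmetric] using ab c by algebra
  moreover have "v \<otimes> y \<oplus> u \<otimes> x \<in> S" using e(2) c by (simp add: a_comm)
  ultimately show "\<exists>p q x y. p \<in> carrier R \<and> q \<in> carrier R \<and> x \<in> carrier R \<and> y \<in> carrier R \<and>
      p \<oplus> q \<in> S \<and> p \<otimes> a = x \<otimes> b \<and> q \<otimes> b = y \<otimes> a"
    by (intro exI[of _ "v \<otimes> y"] exI[of _ "u \<otimes> x"] exI[of _ "v \<otimes> x"] exI[of _ "u \<otimes> y"])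
      (simp add: c)
qed

lemma (in cring) ideal_pair:
  assumes "a \<in> carrier R" "b \<in> carrier R"
  shows "ideal {u \<otimes> a \<oplus> v \<otimes> b | u v. u \<in> carrier R \<and> v \<in> carrier R} R"
proof -
  have "{u \<otimes> a \<oplus> v \<otimes> b | u v. u \<in> carrier R \<and> v \<in> carrier R}
      = {i \<oplus> x \<otimes> b | i x. i \<in> PIdl a \<and> x \<in> carrier R}"
    unfolding cgenideal_def by blast
  then show ?thesis using add_cgenideal[OF cgenideal_ideal] assms by simp
qed

text \<open>Dividing \<open>a\<close> and \<open>b\<close> by a generator of their ideal gives
  \<open>x\<close> and \<open>y\<close>. Conversely a finite generating set is absorbed one element
  at a time, the generator \<open>d\<close> so far and the new \<open>a\<close> being replaced by
  \<open>u \<otimes> a \<oplus> v \<otimes> d\<close>.\<close>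

lemma (in domain) bezout_domain_iff: "bezout_domain R \<longleftrightarrow> bezout_at R {\<one>}"
proof
  assume "bezout_domain R"
  then interpret bezout_domain R .
  show "bezout_at R {\<one>}"
  proof (rule bezout_atI)
    fix a b assume ab: "a \<in> carrier R" "b \<in> carrier R"
    show "\<exists>x y u v. x \<in> carrier R \<and> y \<in> carrier R \<and> u \<in> carrier R \<and> v \<in> carrier R \<and>
        a \<otimes> y = b \<otimes> x \<and> u \<otimes> x \<oplus> v \<otimes> y \<in> {\<one>}"
    proof -
      have "principalideal (Idl {a, b}) R"
        by (rule finitely_generated_principal) (use ab in auto)
      then obtain d where d: "d \<in> carrier R" "Idl {a, b} = PIdl d"
        using principalideal.generate cgenideal_eq_genideal by force
      have "a \<in> PIdl d" "b \<in> PIdl d"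
        using genideal_self[of "{a, b}"] ab d by auto
      then obtain x y where xy: "x \<in> carrier R" "a = x \<otimes> d" "y \<in> carrier R" "b = y \<otimes> d"
        unfolding cgenideal_def by blast
      have "Idl {a, b} \<subseteq> {u \<otimes> a \<oplus> v \<otimes> b | u v. u \<in> carrier R \<and> v \<in> carrier R}"
      proof (rule genideal_minimal[OF ideal_pair[OF ab]])
        have "a = \<one> \<otimes> a \<oplus> \<zero> \<otimes> b" "b = \<zero> \<otimes> a \<oplus> \<one> \<otimes> b" using ab by auto
        then show "{a, b} \<subseteq> {u \<otimes> a \<oplus> v \<otimes> b | u v. u \<in> carrier R \<and> v \<in> carrier R}"
          by blast
      qed
      then obtain u v where uv: "u \<in> carrier R" "v \<in> carrier R" "d = u \<otimes> a \<oplus> v \<otimes> b"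
        using d cgenideal_self by blast
      show ?thesis
      proof (cases "d = \<zero>")
        case True
        then have z: "a = \<zero>" "b = \<zero>" using xy by auto
        show ?thesis
          by (intro exI[of _ \<one>] exI[of _ \<zero>]) (simp add: z)
      next
        case False
        have "d \<otimes> (u \<otimes> x \<oplus> v \<otimes> y) = u \<otimes> (x \<otimes> d) \<oplus> v \<otimes> (y \<otimes> d)"
          using uv(1,2) xy(1,3) d(1) by algebra
        also have "\<dots> = d \<otimes> \<one>" using uv(3) xy d(1) by simp
        finally have "u \<otimes> x \<oplus> v \<otimes> y = \<one>"
          using m_lcancel[OF False d(1)] uv(1,2) xy(1,3) by simp
        moreover have "a \<otimes> y = b \<otimes> x"
          unfolding xy(2,4) using xy(1,3) d(1) by algebra
        ultimately show ?thesis using uv xy by blast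
      qed
    qed
  qed
next
  assume bz: "bezout_at R {\<one>}"
  have "\<exists>d\<in>carrier R. Idl F = Idl {d}" if "finite F" "F \<subseteq> carrier R" for F
    using that
  proof (induction F)
    case empty
    have "Idl {} = Idl {\<zero>}"
      using genideal_minimal[OF zeroideal, of "{}"] genideal_zero
        additive_subgroup.zero_closed[OF ideal.axioms(1)[OF genideal_ideal[of "{}"]]] by auto
    then show ?case by blast
  next
    case (insert a F)
    then obtain d where d: "d \<in> carrier R" "Idl F = Idl {d}" by auto
    have a: "a \<in> carrier R" and F: "F \<subseteq> carrier R" using insert by auto
    obtain x y u v where c: "x \<in> carrier R" "y \<in> carrier R" "u \<in> carrier R" "v \<in> carrier R"
      and e: "a \<otimes> y = d \<otimes> x" "u \<otimes> x \<oplus> v \<otimes> y = \<one>"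
      by (rule bezout_atE[OF bz a d(1)]) auto
    define g where "g = u \<otimes> a \<oplus> v \<otimes> d"
    have g: "g \<in> carrier R" using c a d by (simp add: g_def)
    have "x \<otimes> g = a \<otimes> (u \<otimes> x) \<oplus> v \<otimes> (d \<otimes> x)"
      unfolding g_def using c a d(1) by algebra
    also have "\<dots> = a \<otimes> (u \<otimes> x \<oplus> v \<otimes> y)"
      unfolding e(1)[symmetric] using c a d(1) by algebra
    finally have ax: "a = x \<otimes> g" using e(2) a by simp
    have "y \<otimes> g = u \<otimes> (a \<otimes> y) \<oplus> d \<otimes> (v \<otimes> y)"
      unfolding g_def using c a d(1) by algebra
    also have "\<dots> = d \<otimes> (u \<otimes> x \<oplus> v \<otimes> y)"
      unfolding e(1) using c a d(1) by algebra
    finally have dy: "d = y \<otimes> g" using e(2) d(1) by simp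
    interpret J: ideal "Idl {g}" R using genideal_ideal g by simp
    interpret K: ideal "Idl (insert a F)" R using genideal_ideal a F by simp
    have gJ: "g \<in> Idl {g}" by (rule genideal_self'[OF g])
    have "d \<in> Idl {g}" unfolding dy by (rule J.I_l_closed[OF gJ c(2)])
    then have "Idl F \<subseteq> Idl {g}" using Idl_subset_ideal'[OF d(1) g] d(2) by simp
    then have "F \<subseteq> Idl {g}" using genideal_self[OF F] by blast
    moreover have "a \<in> Idl {g}" using J.I_l_closed[OF gJ c(1)] ax by simp
    ultimately have "Idl (insert a F) \<subseteq> Idl {g}"
      by (intro genideal_minimal J.is_ideal) auto
    moreover have "Idl {g} \<subseteq> Idl (insert a F)"
    proof (intro genideal_minimal K.is_ideal)
      have "d \<in> Idl F" using d genideal_self' by simp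
      then have "d \<in> Idl (insert a F)"
        using subset_Idl_subset[of "insert a F" F] a F by auto
      moreover have "a \<in> Idl (insert a F)" using genideal_self[of "insert a F"] a F by auto
      ultimately have "g \<in> Idl (insert a F)"
        unfolding g_def using c by (auto intro!: K.a_closed K.I_l_closed)
      then show "{g} \<subseteq> Idl (insert a F)" by simp
    qed
    ultimately show ?case using g by blast
  qed
  then show "bezout_domain R"
    by (intro bezout_domain.intro bezout_domain_axioms.intro domain_axioms principalidealI
        genideal_ideal)
qed

section \<open>Krull dimension at most one\<close>

lemma krull_dim_le_one_iff:
  "krull_dim R \<le> 1 \<longleftrightarrow>
     \<not> (\<exists>P Q M. primeideal P R \<and> primeideal Q R \<and> primeideal M R \<and> P \<subset> Q \<and> Q \<subset> M)"
proof
  assume le: "krull_dim R \<le> 1"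
  show "\<not> (\<exists>P Q M. primeideal P R \<and> primeideal Q R \<and> primeideal M R \<and> P \<subset> Q \<and> Q \<subset> M)"
  proof
    assume "\<exists>P Q M. primeideal P R \<and> primeideal Q R \<and> primeideal M R \<and> P \<subset> Q \<and> Q \<subset> M"
    then obtain P Q M where c: "primeideal P R" "primeideal Q R" "primeideal M R" "P \<subset> Q" "Q \<subset> M"
      by blast
    define F where "F = (\<lambda>i::nat. if i = 0 then P else if i = 1 then Q else M)"
    have "(\<forall>i \<le> 2. primeideal (F i) R) \<and> (\<forall>i < 2. F i \<subset> F (Suc i))"
      using c by (auto simp: F_def less_2_cases_iff)
    then have "enat 2 \<le> krull_dim R"
      unfolding krull_dim_def by (intro Sup_upper) blast
    then have "enat 2 \<le> 1" using le by (rule order_trans)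
    then show False by (simp add: one_enat_def)
  qed
next
  assume no: "\<not> (\<exists>P Q M. primeideal P R \<and> primeideal Q R \<and> primeideal M R \<and> P \<subset> Q \<and> Q \<subset> M)"
  show "krull_dim R \<le> 1"
    unfolding krull_dim_def
  proof (rule Sup_least, clarify)
    fix k :: nat and F assume F: "\<forall>i\<le>k. primeideal (F i) R" "\<forall>i<k. F i \<subset> F (Suc i)"
    have "k \<le> 1"
    proof (rule ccontr)
      assume "\<not> k \<le> 1"
      then have "primeideal (F 0) R" "primeideal (F 1) R" "primeideal (F 2) R"
        "F 0 \<subset> F 1" "F 1 \<subset> F 2"
        using F(1) F(2)[rule_format, of 0] F(2)[rule_format, of 1]
        by (auto simp: numeral_2_eq_2)
      then show False using no by blast
    qed
    then show "enat k \<le> 1" by (simp add: one_enat_def)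
  qed
qed

lemma (in primeideal) pow_memD:
  assumes "a \<in> carrier R" "a [^] (k::nat) \<in> I"
  shows "a \<in> I"
  using assms
proof (induction k)
  case 0
  then show ?case using I_notcarr one_imp_carrier by auto
next
  case (Suc k)
  then show ?case using I_prime[of "a [^] k" a] by auto
qed

text \<open>The boundary monoid of \<open>b\<close> relative to \<open>S\<close>: a prime that
  misses it misses \<open>S\<close> and \<open>b\<close>, and adding \<open>b\<close> to that prime
  still gives an ideal that misses \<open>S\<close>.\<close>

lemma (in cring) submonoid_boundary:
  assumes S: "submonoid S R" and b: "b \<in> carrier R"
  shows "submonoid {b [^] k \<otimes> (s \<ominus> b \<otimes> v) | (k::nat) s v. s \<in> S \<and> v \<in> carrier R} R"
    (is "submonoid ?T R")
proof -
  note Sc = submonoid.subset[OF S]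
  show ?thesis
  proof (rule submonoid.intro)
    show "?T \<subseteq> carrier R" using Sc b by auto
    have "\<one> = b [^] (0::nat) \<otimes> (\<one> \<ominus> b \<otimes> \<zero>)" using b by (simp add: minus_eq)
    then show "\<one> \<in> ?T" using submonoid.one_closed[OF S] by blast
    fix x y assume "x \<in> ?T" "y \<in> ?T"
    then obtain k s v l t w where x: "x = b [^] (k::nat) \<otimes> (s \<ominus> b \<otimes> v)" "s \<in> S" "v \<in> carrier R"
      and y: "y = b [^] (l::nat) \<otimes> (t \<ominus> b \<otimes> w)" "t \<in> S" "w \<in> carrier R" by blast
    define B C where "B = b [^] k" and "C = b [^] l"
    have c: "B \<in> carrier R" "C \<in> carrier R" "s \<in> carrier R" "t \<in> carrier R" "v \<in> carrier R" "w \<in> carrier R"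
      using x y Sc b by (auto simp: B_def C_def)
    have "x \<otimes> y = (B \<otimes> C) \<otimes> (s \<otimes> t \<ominus> b \<otimes> (s \<otimes> w \<oplus> v \<otimes> t \<ominus> v \<otimes> b \<otimes> w))"
      unfolding x y B_def[symmetric] C_def[symmetric] using c b by algebra
    also have "B \<otimes> C = b [^] (k + l)" using b by (simp add: B_def C_def nat_pow_mult)
    finally show "x \<otimes> y \<in> ?T"
      using submonoid.m_closed[OF S x(2) y(2)] c b by blast
  qed
qed

text \<open>A nonzero \<open>a\<close> in \<open>p\<close> makes \<open>b^k (s - b v)\<close> a
  multiple of \<open>a\<close>, and the power of \<open>b\<close> can be cancelled modulo
  \<open>p\<close>. So \<open>b\<close> is invertible up to \<open>S\<close> modulo
  \<open>p\<close>; for \<open>p\<close> disjoint from \<open>S\<close> this is maximality among the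
  ideals that miss \<open>S\<close>.\<close>

lemma (in cring) dim_le_one_at_prime:
  assumes D: "dim_le_one_at R S" and S: "submonoid S R" and p: "primeideal p R"
    and nz: "p \<noteq> {\<zero>}" and b: "b \<in> carrier R" "b \<notin> p"
  shows "\<exists>v\<in>carrier R. \<exists>s\<in>S. \<exists>q\<in>p. b \<otimes> v = s \<oplus> q"
proof -
  interpret p: primeideal p R by (rule p)
  obtain a where a: "a \<in> p" "a \<noteq> \<zero>" using nz p.zero_closed by blast
  then have ac: "a \<in> carrier R" by (simp add: p.Icarr)
  obtain k s u v where s: "s \<in> S" and uv: "u \<in> carrier R" "v \<in> carrier R"
    and e: "b [^] (k::nat) \<otimes> s = a \<otimes> u \<oplus> b [^] Suc k \<otimes> v"
    by (rule dim_le_one_atE[OF D ac a(2) b(1)])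
  have sc: "s \<in> carrier R" using s submonoid.subset[OF S] by blast
  define B where "B = b [^] k"
  have B: "B \<in> carrier R" using b by (simp add: B_def)
  have "B \<otimes> (s \<ominus> b \<otimes> v) = B \<otimes> s \<ominus> B \<otimes> b \<otimes> v" using B b(1) sc uv by algebra
  also have "\<dots> = (a \<otimes> u \<oplus> B \<otimes> b \<otimes> v) \<ominus> B \<otimes> b \<otimes> v" using e by (simp add: B_def)
  also have "\<dots> = a \<otimes> u" using B b(1) ac uv by algebra
  finally have "B \<otimes> (s \<ominus> b \<otimes> v) \<in> p" using a uv by (simp add: p.I_r_closed)
  moreover have "B \<notin> p" using p.pow_memD b unfolding B_def by blast
  ultimately have q: "s \<ominus> b \<otimes> v \<in> p" using p.I_prime[OF B, of "s \<ominus> b \<otimes> v"] b(1) sc uv by blast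
  have "b \<otimes> v = s \<oplus> \<ominus> (s \<ominus> b \<otimes> v)" using sc b(1) uv by algebra
  then show ?thesis using s uv q p.a_inv_closed by blast
qed

text \<open>If the equation fails for \<open>a\<close> and \<open>b\<close>, the ideal of
  \<open>a\<close> misses the boundary monoid of \<open>b\<close>. A prime \<open>P\<close> above it
  that still misses the monoid avoids \<open>b\<close>, and \<open>P\<close> together with
  \<open>b\<close> extends to a prime \<open>M\<close> that misses \<open>S\<close>.\<close>

lemma (in cring) not_dim_le_one_primes:
  assumes S: "submonoid S R" and nD: "\<not> dim_le_one_at R S"
  obtains a P M where "a \<in> P" "a \<noteq> \<zero>" "primeideal P R" "primeideal M R" "P \<subset> M"
    "P \<inter> S = {}" "M \<inter> S = {}"
proof -
  obtain a b where "a \<in> carrier R - {\<zero>}" and ab3: "b \<in> carrier R"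
    and none: "\<not> (\<exists>k::nat. \<exists>s\<in>S. \<exists>u\<in>carrier R. \<exists>v\<in>carrier R.
       b [^] k \<otimes> s = a \<otimes> u \<oplus> b [^] Suc k \<otimes> v)"
    using nD unfolding dim_le_one_at_def by (meson ballI)
  then have ab: "a \<in> carrier R" "a \<noteq> \<zero>" "b \<in> carrier R" by auto
  have Sc: "s \<in> carrier R" if "s \<in> S" for s using that submonoid.subset[OF S] by blast
  have dis: "PIdl a \<inter> {b [^] k \<otimes> (s \<ominus> b \<otimes> v) | (k::nat) s v. s \<in> S \<and> v \<in> carrier R} = {}"
  proof (rule ccontr)
    assume "\<not> ?thesis"
    then obtain u k s v where *: "u \<in> carrier R" "v \<in> carrier R" "s \<in> S"
      "u \<otimes> a = b [^] (k::nat) \<otimes> (s \<ominus> b \<otimes> v)"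
      unfolding cgenideal_def by auto
    define B where "B = b [^] k"
    have B: "B \<in> carrier R" using ab by (simp add: B_def)
    have "a \<otimes> u = B \<otimes> (s \<ominus> b \<otimes> v)"
      using *(4) m_comm[OF ab(1) *(1)] by (simp add: B_def)
    then have "a \<otimes> u \<oplus> B \<otimes> b \<otimes> v = B \<otimes> (s \<ominus> b \<otimes> v) \<oplus> B \<otimes> b \<otimes> v"
      by simp
    also have "\<dots> = B \<otimes> s" using B ab *(2) Sc[OF *(3)] by algebra
    finally have "b [^] k \<otimes> s = a \<otimes> u \<oplus> b [^] Suc k \<otimes> v" by (simp add: B_def)
    then show False using none *(1-3) by blast
  qed
  obtain P where P: "primeideal P R" "PIdl a \<subseteq> P"
    and Pd: "P \<inter> {b [^] k \<otimes> (s \<ominus> b \<otimes> v) | (k::nat) s v. s \<in> S \<and> v \<in> carrier R} = {}"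
    using exists_prime_ideal_disjoint[OF cgenideal_ideal[OF ab(1)] submonoid_boundary[OF S ab(3)] dis]
    by blast
  \<comment> \<open>Three specializations are used: \<open>k = 0\<close>, \<open>v = \<zero>\<close>
    gives elements of \<open>S\<close>; \<open>k = 1\<close>, \<open>s = \<one>\<close>,
    \<open>v = \<zero>\<close> gives \<open>b\<close>; and \<open>k = 0\<close> gives elements of
    \<open>S\<close> modulo \<open>b\<close>.\<close>
  have TP: "b [^] (k::nat) \<otimes> (s \<ominus> b \<otimes> v) \<notin> P" if "s \<in> S" "v \<in> carrier R" for k s v
    using Pd that by blast
  interpret P: primeideal P R by (rule P(1))
  have PS: "P \<inter> S = {}"
  proof (rule equals0I)
    fix s assume s: "s \<in> P \<inter> S"
    have "b [^] (0::nat) \<otimes> (s \<ominus> b \<otimes> \<zero>) = s" using ab s Sc by (simp add: minus_eq)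
    then show False using TP[of s \<zero> 0] s by simp
  qed
  have bP: "b \<notin> P"
  proof
    assume "b \<in> P"
    have e: "b [^] (1::nat) \<otimes> (\<one> \<ominus> b \<otimes> \<zero>) = b" using ab by (simp add: minus_eq)
    show False
      using TP[OF submonoid.one_closed[OF S] zero_closed, of 1] \<open>b \<in> P\<close> unfolding e by simp
  qed
  define J where "J = {i \<oplus> x \<otimes> b | i x. i \<in> P \<and> x \<in> carrier R}"
  have J: "ideal J R" unfolding J_def by (rule add_cgenideal[OF P.is_ideal ab(3)])
  have "J \<inter> S = {}"
  proof (rule ccontr)
    assume "\<not> ?thesis"
    then obtain i x where ix: "i \<in> P" "x \<in> carrier R" "i \<oplus> x \<otimes> b \<in> S" unfolding J_def by auto
    have ic: "i \<in> carrier R" using ix P.Icarr by blast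
    have "(i \<oplus> x \<otimes> b) \<ominus> b \<otimes> x = i" using ic ix(2) ab(3) by algebra
    then have "i = b [^] (0::nat) \<otimes> ((i \<oplus> x \<otimes> b) \<ominus> b \<otimes> x)" using ic by simp
    then have "i \<notin> P" using TP[OF ix(3,2), of 0] by simp
    then show False using ix(1) by simp
  qed
  then obtain M where M: "primeideal M R" "J \<subseteq> M" "M \<inter> S = {}"
    using exists_prime_ideal_disjoint[OF J S] by blast
  have "P \<subset> M"
    using add_cgenideal_contains[OF P.is_ideal ab(3)] M bP unfolding J_def by blast
  moreover have "a \<in> P" using P(2) cgenideal_self[OF ab(1)] by blast
  ultimately show thesis using that ab(2) P(1) M(1,3) PS by blast
qed

text \<open>In a chain of three the middle prime is nonzero, hence maximal by the equation.
  Conversely the primes \<open>P\<close> and \<open>M\<close> found from a failure extend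
  \<open>{\<zero>}\<close>, which is prime in a domain, to a chain of three.\<close>

lemma (in domain) krull_dim_le_one_iff_dim_le_one_at:
  "krull_dim R \<le> 1 \<longleftrightarrow> dim_le_one_at R {\<one>}"
proof
  assume D: "dim_le_one_at R {\<one>}"
  show "krull_dim R \<le> 1"
    unfolding krull_dim_le_one_iff
  proof (rule notI, elim exE conjE)
    fix P Q M assume P: "primeideal P R" and Q: "primeideal Q R" and M: "primeideal M R"
      and PQ: "P \<subset> Q" and QM: "Q \<subset> M"
    interpret P: primeideal P R by (rule P)
    interpret Q: primeideal Q R by (rule Q)
    interpret M: primeideal M R by (rule M)
    obtain b where b: "b \<in> M" "b \<notin> Q" using QM by blast
    have bc: "b \<in> carrier R" using b by (simp add: M.Icarr)
    have "Q \<noteq> {\<zero>}" using PQ P.zero_closed by blast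
    then obtain v q where vq: "v \<in> carrier R" "q \<in> Q" "b \<otimes> v = \<one> \<oplus> q"
      using dim_le_one_at_prime[OF D _ Q _ bc b(2)] by (auto simp: submonoid_def)
    have "q \<in> carrier R" using vq Q.Icarr by blast
    then have "\<one> = b \<otimes> v \<oplus> \<ominus> q" unfolding vq(3) by algebra
    moreover have "b \<otimes> v \<in> M" by (rule M.I_r_closed[OF b(1) vq(1)])
    moreover have "\<ominus> q \<in> M" by (rule M.a_inv_closed) (use vq(2) QM in blast)
    ultimately have "\<one> \<in> M" using M.a_closed by simp
    then show False using M.one_imp_carrier M.I_notcarr by blast
  qed
next
  assume le: "krull_dim R \<le> 1"
  show "dim_le_one_at R {\<one>}"
  proof (rule ccontr)
    assume nD: "\<not> dim_le_one_at R {\<one>}"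
    have one: "submonoid {\<one>} R" by (auto simp: submonoid_def)
    obtain a P M where *: "a \<in> P" "a \<noteq> \<zero>" "primeideal P R" "primeideal M R" "P \<subset> M"
      by (rule not_dim_le_one_primes[OF one nD])
    interpret P: primeideal P R by (rule *(3))
    have "{\<zero>} \<subset> P" using *(1,2) P.zero_closed by blast
    then show False
      using le zeroprimeideal *(3-5) unfolding krull_dim_le_one_iff by blast
  qed
qed

section \<open>Localizations\<close>

lemma UN_pair_const:
  assumes "p \<in> X" "q \<in> Y"
    and "\<And>a s b t. (a, s) \<in> X \<Longrightarrow> (b, t) \<in> Y \<Longrightarrow> f a s b t = c"
  shows "(\<Union>(a, s)\<in>X. \<Union>(b, t)\<in>Y. f a s b t) = c"
proof -
  have *: "(\<Union>y\<in>Y. f (fst x) (snd x) (fst y) (snd y)) = c" if "x \<in> X" for x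
    by (rule UN_constant_eq[OF assms(2)]) (use assms(3)[of "fst x" "snd x"] that in simp)
  show ?thesis
    unfolding split_beta by (rule UN_constant_eq[OF assms(1)]) (simp add: *)
qed

locale cring_localization = cring R for R (structure) +
  fixes S
  assumes S: "submonoid S R"
begin

abbreviation frac where "frac a s \<equiv> frac_class R S a s"
abbreviation L where "L \<equiv> localization R S"

lemma S_carrier [simp]: "s \<in> S \<Longrightarrow> s \<in> carrier R"
  using submonoid.subset[OF S] by blast

lemma S_one [simp]: "\<one> \<in> S" by (rule submonoid.one_closed[OF S])

lemma S_mult [simp]: "s \<in> S \<Longrightarrow> t \<in> S \<Longrightarrow> s \<otimes> t \<in> S" by (rule submonoid.m_closed[OF S])

lemma S_pow [simp]: "s \<in> S \<Longrightarrow> s [^] (k::nat) \<in> S" by (induction k) auto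

lemma frac_rel_iff:
  "((a, s), (b, t)) \<in> frac_rel R S \<longleftrightarrow> a \<in> carrier R \<and> s \<in> S \<and> b \<in> carrier R \<and> t \<in> S \<and>
     (\<exists>u\<in>S. u \<otimes> (a \<otimes> t) = u \<otimes> (b \<otimes> s))"
  by (simp add: frac_rel_def)

lemma equiv_frac_rel: "equiv (carrier R \<times> S) (frac_rel R S)"
proof (rule equivI)
  show "frac_rel R S \<subseteq> (carrier R \<times> S) \<times> (carrier R \<times> S)" by (auto simp: frac_rel_def)
  show "refl_on (carrier R \<times> S) (frac_rel R S)"
    by (rule refl_onI) (use S_one in \<open>auto simp: frac_rel_def\<close>)
  show "sym (frac_rel R S)"
    by (rule symI) (auto simp: frac_rel_def, metis)
  show "trans (frac_rel R S)"
  proof (rule transI, clarify)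
    fix a s b t c r assume "((a, s), (b, t)) \<in> frac_rel R S" "((b, t), (c, r)) \<in> frac_rel R S"
    then obtain u v where *: "a \<in> carrier R" "s \<in> S" "b \<in> carrier R" "t \<in> S" "c \<in> carrier R" "r \<in> S"
      "u \<in> S" "v \<in> S" and e: "u \<otimes> (a \<otimes> t) = u \<otimes> (b \<otimes> s)" "v \<otimes> (b \<otimes> r) = v \<otimes> (c \<otimes> t)"
      unfolding frac_rel_iff by blast
    note k = *(1,3,5) *(2,4,6-8)[THEN S_carrier]
    \<comment> \<open>The middle denominator \<open>t\<close> joins the multiplier because it cannot
      be cancelled in a general ring.\<close>
    have "u \<otimes> v \<otimes> t \<otimes> (a \<otimes> r) = (u \<otimes> (a \<otimes> t)) \<otimes> (v \<otimes> r)"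
      using k by algebra
    also have "\<dots> = (u \<otimes> s) \<otimes> (v \<otimes> (b \<otimes> r))"
      unfolding e(1) using k by algebra
    also have "\<dots> = u \<otimes> v \<otimes> t \<otimes> (c \<otimes> s)"
      unfolding e(2) using k by algebra
    finally show "((a, s), (c, r)) \<in> frac_rel R S"
      unfolding frac_rel_iff using * by (auto intro!: bexI[of _ "u \<otimes> v \<otimes> t"])
  qed
qed

lemma frac_eq_iff:
  assumes "a \<in> carrier R" "s \<in> S" "b \<in> carrier R" "t \<in> S"
  shows "frac a s = frac b t \<longleftrightarrow> (\<exists>u\<in>S. u \<otimes> (a \<otimes> t) = u \<otimes> (b \<otimes> s))"
  unfolding frac_class_def
  by (subst eq_equiv_class_iff[OF equiv_frac_rel]) (use assms in \<open>auto simp: frac_rel_iff\<close>)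

lemma frac_eqI:
  assumes "a \<in> carrier R" "s \<in> S" "b \<in> carrier R" "t \<in> S" "a \<otimes> t = b \<otimes> s"
  shows "frac a s = frac b t"
  unfolding frac_eq_iff[OF assms(1-4)] using assms(5) by (intro bexI[of _ \<one>]) simp_all

lemma frac_carrier [simp]: "a \<in> carrier R \<Longrightarrow> s \<in> S \<Longrightarrow> frac a s \<in> carrier L"
  by (auto simp: localization_def frac_class_def intro!: quotientI)

lemma carrierE:
  assumes "x \<in> carrier L"
  obtains a s where "a \<in> carrier R" "s \<in> S" "x = frac a s"
  using assms by (auto simp: localization_def frac_class_def elim!: quotientE)

lemma frac_memD:
  assumes "(a', s') \<in> frac a s"
  shows "a' \<in> carrier R" "s' \<in> S" "\<exists>u\<in>S. u \<otimes> (a \<otimes> s') = u \<otimes> (a' \<otimes> s)"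
  using assms by (auto simp: frac_class_def frac_rel_def)

lemma frac_self: "a \<in> carrier R \<Longrightarrow> s \<in> S \<Longrightarrow> (a, s) \<in> frac a s"
  using S_one by (auto simp: frac_class_def frac_rel_def)

lemma frac_mult [simp]:
  assumes c: "a \<in> carrier R" "s \<in> S" "b \<in> carrier R" "t \<in> S"
  shows "frac a s \<otimes>\<^bsub>L\<^esub> frac b t = frac (a \<otimes> b) (s \<otimes> t)"
proof -
  have "frac (a' \<otimes> b') (s' \<otimes> t') = frac (a \<otimes> b) (s \<otimes> t)"
    if m: "(a', s') \<in> frac a s" "(b', t') \<in> frac b t" for a' s' b' t'
  proof -
    note m' = frac_memD[OF m(1)] frac_memD[OF m(2)]
    obtain u v where u: "u \<in> S" "v \<in> S" and
      e: "u \<otimes> (a \<otimes> s') = u \<otimes> (a' \<otimes> s)" "v \<otimes> (b \<otimes> t') = v \<otimes> (b' \<otimes> t)"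
      using m' by blast
    note k = c(1,3) c(2,4)[THEN S_carrier] m'(1,4) m'(2,5)[THEN S_carrier] u[THEN S_carrier]
    have "u \<otimes> v \<otimes> ((a \<otimes> b) \<otimes> (s' \<otimes> t')) = (u \<otimes> (a \<otimes> s')) \<otimes> (v \<otimes> (b \<otimes> t'))"
      using k by algebra
    also have "\<dots> = u \<otimes> v \<otimes> ((a' \<otimes> b') \<otimes> (s \<otimes> t))" unfolding e using k by algebra
    finally have "\<exists>w\<in>S. w \<otimes> ((a \<otimes> b) \<otimes> (s' \<otimes> t')) = w \<otimes> ((a' \<otimes> b') \<otimes> (s \<otimes> t))"
      using S_mult[OF u] by (rule bexI)
    then show ?thesis
      by (subst eq_commute, subst frac_eq_iff) (use c m' in auto)
  qed
  then show ?thesis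
    unfolding localization_def
    by (simp, intro UN_pair_const[OF frac_self[OF c(1,2)] frac_self[OF c(3,4)]])
qed

lemma frac_add [simp]:
  assumes c: "a \<in> carrier R" "s \<in> S" "b \<in> carrier R" "t \<in> S"
  shows "frac a s \<oplus>\<^bsub>L\<^esub> frac b t = frac (a \<otimes> t \<oplus> b \<otimes> s) (s \<otimes> t)"
proof -
  have "frac (a' \<otimes> t' \<oplus> b' \<otimes> s') (s' \<otimes> t') = frac (a \<otimes> t \<oplus> b \<otimes> s) (s \<otimes> t)"
    if m: "(a', s') \<in> frac a s" "(b', t') \<in> frac b t" for a' s' b' t'
  proof -
    note m' = frac_memD[OF m(1)] frac_memD[OF m(2)]
    obtain u v where u: "u \<in> S" "v \<in> S" and
      e: "u \<otimes> (a \<otimes> s') = u \<otimes> (a' \<otimes> s)" "v \<otimes> (b \<otimes> t') = v \<otimes> (b' \<otimes> t)"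
      using m' by blast
    note k = c(1,3) c(2,4)[THEN S_carrier] m'(1,4) m'(2,5)[THEN S_carrier] u[THEN S_carrier]
    have "u \<otimes> v \<otimes> ((a \<otimes> t \<oplus> b \<otimes> s) \<otimes> (s' \<otimes> t'))
        = (u \<otimes> (a \<otimes> s')) \<otimes> (v \<otimes> t \<otimes> t') \<oplus> (v \<otimes> (b \<otimes> t')) \<otimes> (u \<otimes> s \<otimes> s')"
      using k by algebra
    also have "\<dots> = u \<otimes> v \<otimes> ((a' \<otimes> t' \<oplus> b' \<otimes> s') \<otimes> (s \<otimes> t))" unfolding e using k by algebra
    finally have "\<exists>w\<in>S. w \<otimes> ((a \<otimes> t \<oplus> b \<otimes> s) \<otimes> (s' \<otimes> t')) = w \<otimes> ((a' \<otimes> t' \<oplus> b' \<otimes> s') \<otimes> (s \<otimes> t))"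
      using S_mult[OF u] by (rule bexI)
    then show ?thesis
      by (subst eq_commute, subst frac_eq_iff) (use c m' in auto)
  qed
  then show ?thesis
    unfolding localization_def
    by (simp, intro UN_pair_const[OF frac_self[OF c(1,2)] frac_self[OF c(3,4)]])
qed

lemma L_one: "\<one>\<^bsub>L\<^esub> = frac \<one> \<one>" by (simp add: localization_def)

lemma L_zero: "\<zero>\<^bsub>L\<^esub> = frac \<zero> \<one>" by (simp add: localization_def)

lemma cring_L: "cring L"
proof (rule cringI)
  show "abelian_group L"
  proof (rule abelian_groupI)
    fix x y z assume "x \<in> carrier L" "y \<in> carrier L" "z \<in> carrier L"
    then obtain a s b t c r where *: "a \<in> carrier R" "s \<in> S" "x = frac a s"
      "b \<in> carrier R" "t \<in> S" "y = frac b t" "c \<in> carrier R" "r \<in> S" "z = frac c r"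
      by (elim carrierE)
    note k = *(1,4,7) *(2,5,8)[THEN S_carrier]
    show "x \<oplus>\<^bsub>L\<^esub> y \<oplus>\<^bsub>L\<^esub> z = x \<oplus>\<^bsub>L\<^esub> (y \<oplus>\<^bsub>L\<^esub> z)"
    proof -
      have "(a \<otimes> t \<oplus> b \<otimes> s) \<otimes> r \<oplus> c \<otimes> (s \<otimes> t) = a \<otimes> (t \<otimes> r) \<oplus> (b \<otimes> r \<oplus> c \<otimes> t) \<otimes> s"
        using k by algebra
      then show ?thesis using * by (simp add: m_assoc)
    qed
  next
    fix x y assume "x \<in> carrier L" "y \<in> carrier L"
    then obtain a s b t where *: "a \<in> carrier R" "s \<in> S" "x = frac a s"
      "b \<in> carrier R" "t \<in> S" "y = frac b t"
      by (elim carrierE)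
    show "x \<oplus>\<^bsub>L\<^esub> y \<in> carrier L" using * by simp
    show "x \<oplus>\<^bsub>L\<^esub> y = y \<oplus>\<^bsub>L\<^esub> x" using * by (simp add: a_comm m_comm)
  next
    show "\<zero>\<^bsub>L\<^esub> \<in> carrier L" by (simp add: L_zero)
  next
    fix x assume "x \<in> carrier L"
    then obtain a s where *: "a \<in> carrier R" "s \<in> S" "x = frac a s" by (elim carrierE)
    show "\<zero>\<^bsub>L\<^esub> \<oplus>\<^bsub>L\<^esub> x = x" using * by (simp add: L_zero)
    have "frac (\<ominus> a) s \<oplus>\<^bsub>L\<^esub> x = \<zero>\<^bsub>L\<^esub>"
      unfolding L_zero using * by (simp, intro frac_eqI) (auto simp: l_minus l_neg)
    then show "\<exists>y\<in>carrier L. y \<oplus>\<^bsub>L\<^esub> x = \<zero>\<^bsub>L\<^esub>"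
      using * by (intro bexI[of _ "frac (\<ominus> a) s"]) auto
  qed
  show "comm_monoid L"
  proof (rule comm_monoidI)
    fix x y z assume "x \<in> carrier L" "y \<in> carrier L" "z \<in> carrier L"
    then obtain a s b t c r where *: "a \<in> carrier R" "s \<in> S" "x = frac a s"
      "b \<in> carrier R" "t \<in> S" "y = frac b t" "c \<in> carrier R" "r \<in> S" "z = frac c r"
      by (elim carrierE)
    show "x \<otimes>\<^bsub>L\<^esub> y \<otimes>\<^bsub>L\<^esub> z = x \<otimes>\<^bsub>L\<^esub> (y \<otimes>\<^bsub>L\<^esub> z)" using * by (simp add: m_assoc)
  next
    fix x y assume "x \<in> carrier L" "y \<in> carrier L"
    then obtain a s b t where *: "a \<in> carrier R" "s \<in> S" "x = frac a s"
      "b \<in> carrier R" "t \<in> S" "y = frac b t"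
      by (elim carrierE)
    show "x \<otimes>\<^bsub>L\<^esub> y \<in> carrier L" using * by simp
    show "x \<otimes>\<^bsub>L\<^esub> y = y \<otimes>\<^bsub>L\<^esub> x" using * by (simp add: m_comm)
  next
    show "\<one>\<^bsub>L\<^esub> \<in> carrier L" by (simp add: L_one)
    fix x assume "x \<in> carrier L"
    then show "\<one>\<^bsub>L\<^esub> \<otimes>\<^bsub>L\<^esub> x = x" by (elim carrierE) (simp add: L_one)
  qed
  fix x y z assume "x \<in> carrier L" "y \<in> carrier L" "z \<in> carrier L"
  then obtain a s b t c r where *: "a \<in> carrier R" "s \<in> S" "x = frac a s"
    "b \<in> carrier R" "t \<in> S" "y = frac b t" "c \<in> carrier R" "r \<in> S" "z = frac c r"
    by (elim carrierE)
  note k = *(1,4,7) *(2,5,8)[THEN S_carrier]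
  have "((a \<otimes> t \<oplus> b \<otimes> s) \<otimes> c) \<otimes> ((s \<otimes> r) \<otimes> (t \<otimes> r))
      = (a \<otimes> c \<otimes> (t \<otimes> r) \<oplus> b \<otimes> c \<otimes> (s \<otimes> r)) \<otimes> (s \<otimes> t \<otimes> r)"
    using k by algebra
  then have "frac ((a \<otimes> t \<oplus> b \<otimes> s) \<otimes> c) (s \<otimes> t \<otimes> r)
      = frac (a \<otimes> c \<otimes> (t \<otimes> r) \<oplus> b \<otimes> c \<otimes> (s \<otimes> r)) ((s \<otimes> r) \<otimes> (t \<otimes> r))"
    by (intro frac_eqI) (use * in auto)
  then show "(x \<oplus>\<^bsub>L\<^esub> y) \<otimes>\<^bsub>L\<^esub> z = x \<otimes>\<^bsub>L\<^esub> z \<oplus>\<^bsub>L\<^esub> y \<otimes>\<^bsub>L\<^esub> z" using * by simp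
qed

lemma frac_pow:
  assumes "a \<in> carrier R" "s \<in> S"
  shows "frac a s [^]\<^bsub>L\<^esub> (k::nat) = frac (a [^] k) (s [^] k)"
proof -
  interpret L: cring L by (rule cring_L)
  show ?thesis using assms by (induction k) (simp_all add: L_one)
qed

end

locale domain_localization = cring_localization + domain +
  assumes S_nonzero: "\<zero> \<notin> S"
begin

lemma frac_eq_domain:
  assumes "a \<in> carrier R" "s \<in> S" "b \<in> carrier R" "t \<in> S"
  shows "frac a s = frac b t \<longleftrightarrow> a \<otimes> t = b \<otimes> s"
proof
  assume "frac a s = frac b t"
  then obtain u where u: "u \<in> S" "u \<otimes> (a \<otimes> t) = u \<otimes> (b \<otimes> s)" using frac_eq_iff[OF assms] by blast
  have "u \<noteq> \<zero>" using u S_nonzero by blast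
  then show "a \<otimes> t = b \<otimes> s" using m_lcancel[of u "a \<otimes> t" "b \<otimes> s"] u assms by simp
qed (rule frac_eqI[OF assms])

lemma domain_L: "domain L"
proof -
  interpret L: cring L by (rule cring_L)
  have z: "frac a s = \<zero>\<^bsub>L\<^esub> \<longleftrightarrow> a = \<zero>" if "a \<in> carrier R" "s \<in> S" for a s
    unfolding L_zero using that by (subst frac_eq_domain) auto
  show ?thesis
  proof (unfold_locales)
    show "\<one>\<^bsub>L\<^esub> \<noteq> \<zero>\<^bsub>L\<^esub>" unfolding L_one using z[of \<one> \<one>] by simp
    fix x y assume "x \<otimes>\<^bsub>L\<^esub> y = \<zero>\<^bsub>L\<^esub>" "x \<in> carrier L" "y \<in> carrier L"
    then show "x = \<zero>\<^bsub>L\<^esub> \<or> y = \<zero>\<^bsub>L\<^esub>"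
      by (elim carrierE) (simp add: z integral_iff)
  qed
qed

text \<open>For \<open>a\<close> and \<open>b\<close> of \<open>R\<close> the four denominators of a
  solution in the localization are multiplied out. For fractions \<open>a / s\<close> and
  \<open>b / t\<close> the equation is solved for \<open>a \<otimes> t\<close> and
  \<open>b \<otimes> s\<close>, which have the same quotient, and the solution is divided by
  \<open>p \<oplus> q\<close>.\<close>

lemma arithmetical_at_L: "arithmetical_at L {\<one>\<^bsub>L\<^esub>} \<longleftrightarrow> arithmetical_at R S"
proof
  assume ar: "arithmetical_at L {\<one>\<^bsub>L\<^esub>}"
  show "arithmetical_at R S"
  proof (rule arithmetical_atI)
    fix a b assume ab: "a \<in> carrier R" "b \<in> carrier R"
    obtain p q x y where *: "p \<in> carrier L" "q \<in> carrier L" "x \<in> carrier L" "y \<in> carrier L"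
      and e: "p \<oplus>\<^bsub>L\<^esub> q \<in> {\<one>\<^bsub>L\<^esub>}" "p \<otimes>\<^bsub>L\<^esub> frac a \<one> = x \<otimes>\<^bsub>L\<^esub> frac b \<one>"
        "q \<otimes>\<^bsub>L\<^esub> frac b \<one> = y \<otimes>\<^bsub>L\<^esub> frac a \<one>"
      by (rule arithmetical_atE[OF ar, of "frac a \<one>" "frac b \<one>"]) (use ab in auto)
    obtain p' s q' t where p: "p' \<in> carrier R" "s \<in> S" "p = frac p' s"
      "q' \<in> carrier R" "t \<in> S" "q = frac q' t" using *(1,2) by (elim carrierE)
    obtain x' r y' w where x: "x' \<in> carrier R" "r \<in> S" "x = frac x' r"
      "y' \<in> carrier R" "w \<in> S" "y = frac y' w" using *(3,4) by (elim carrierE)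
    note k = ab p(1,4) x(1,4) p(2,5)[THEN S_carrier] x(2,5)[THEN S_carrier]
    have e1: "p' \<otimes> t \<oplus> q' \<otimes> s = s \<otimes> t"
      using e(1) p x ab by (simp add: L_one frac_eq_domain)
    have e2: "p' \<otimes> a \<otimes> r = x' \<otimes> b \<otimes> s" using e(2) p x ab by (simp add: frac_eq_domain)
    have e3: "q' \<otimes> b \<otimes> w = y' \<otimes> a \<otimes> t" using e(3) p x ab by (simp add: frac_eq_domain)
    have "p' \<otimes> t \<otimes> r \<otimes> w \<oplus> q' \<otimes> s \<otimes> r \<otimes> w = (p' \<otimes> t \<oplus> q' \<otimes> s) \<otimes> (r \<otimes> w)" using k by algebra
    then have "p' \<otimes> t \<otimes> r \<otimes> w \<oplus> q' \<otimes> s \<otimes> r \<otimes> w \<in> S" unfolding e1 using p x by simp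
    moreover have "p' \<otimes> t \<otimes> r \<otimes> w \<otimes> a = (p' \<otimes> a \<otimes> r) \<otimes> (t \<otimes> w)" using k by algebra
    then have "p' \<otimes> t \<otimes> r \<otimes> w \<otimes> a = (x' \<otimes> s \<otimes> t \<otimes> w) \<otimes> b" unfolding e2 using k by algebra
    moreover have "q' \<otimes> s \<otimes> r \<otimes> w \<otimes> b = (q' \<otimes> b \<otimes> w) \<otimes> (s \<otimes> r)" using k by algebra
    then have "q' \<otimes> s \<otimes> r \<otimes> w \<otimes> b = (y' \<otimes> t \<otimes> s \<otimes> r) \<otimes> a" unfolding e3 using k by algebra
    ultimately show "\<exists>p q x y. p \<in> carrier R \<and> q \<in> carrier R \<and> x \<in> carrier R \<and> y \<in> carrier R \<and>
        p \<oplus> q \<in> S \<and> p \<otimes> a = x \<otimes> b \<and> q \<otimes> b = y \<otimes> a"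
      by (intro exI[of _ "p' \<otimes> t \<otimes> r \<otimes> w"] exI[of _ "q' \<otimes> s \<otimes> r \<otimes> w"]
          exI[of _ "x' \<otimes> s \<otimes> t \<otimes> w"] exI[of _ "y' \<otimes> t \<otimes> s \<otimes> r"]) (use k in simp)
  qed
next
  assume ar: "arithmetical_at R S"
  show "arithmetical_at L {\<one>\<^bsub>L\<^esub>}"
  proof (rule arithmetical_atI)
    fix x y assume "x \<in> carrier L" "y \<in> carrier L"
    then obtain a s b t where *: "a \<in> carrier R" "s \<in> S" "x = frac a s"
      "b \<in> carrier R" "t \<in> S" "y = frac b t"
      by (elim carrierE)
    obtain p q f g where c: "p \<in> carrier R" "q \<in> carrier R" "f \<in> carrier R" "g \<in> carrier R"
      and e: "p \<oplus> q \<in> S" "p \<otimes> (a \<otimes> t) = f \<otimes> (b \<otimes> s)" "q \<otimes> (b \<otimes> s) = g \<otimes> (a \<otimes> t)"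
      by (rule arithmetical_atE[OF ar, of "a \<otimes> t" "b \<otimes> s"]) (use * in auto)
    define r where "r = p \<oplus> q"
    have r: "r \<in> S" using e by (simp add: r_def)
    note k = c *(1,4) *(2,5)[THEN S_carrier] S_carrier[OF r]
    have "p \<otimes> r \<oplus> q \<otimes> r = r \<otimes> r" using c by (simp add: r_def l_distr[symmetric])
    then have "frac p r \<oplus>\<^bsub>L\<^esub> frac q r = \<one>\<^bsub>L\<^esub>"
      unfolding L_one using c r by (simp add: frac_eq_domain)
    moreover have "frac p r \<otimes>\<^bsub>L\<^esub> x = frac f r \<otimes>\<^bsub>L\<^esub> y"
    proof -
      have "p \<otimes> a \<otimes> (r \<otimes> t) = (p \<otimes> (a \<otimes> t)) \<otimes> r" using k by algebra
      also have "\<dots> = f \<otimes> b \<otimes> (r \<otimes> s)" unfolding e(2) using k by algebra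
      finally show ?thesis using * r c by (simp add: frac_eq_domain)
    qed
    moreover have "frac q r \<otimes>\<^bsub>L\<^esub> y = frac g r \<otimes>\<^bsub>L\<^esub> x"
    proof -
      have "q \<otimes> b \<otimes> (r \<otimes> s) = (q \<otimes> (b \<otimes> s)) \<otimes> r" using k by algebra
      also have "\<dots> = g \<otimes> a \<otimes> (r \<otimes> t)" unfolding e(3) using k by algebra
      finally show ?thesis using * r c by (simp add: frac_eq_domain)
    qed
    ultimately show "\<exists>p q f g. p \<in> carrier L \<and> q \<in> carrier L \<and> f \<in> carrier L \<and> g \<in> carrier L \<and>
        p \<oplus>\<^bsub>L\<^esub> q \<in> {\<one>\<^bsub>L\<^esub>} \<and> p \<otimes>\<^bsub>L\<^esub> x = f \<otimes>\<^bsub>L\<^esub> y \<and> q \<otimes>\<^bsub>L\<^esub> y = g \<otimes>\<^bsub>L\<^esub> x"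
      by (intro exI[of _ "frac p r"] exI[of _ "frac q r"] exI[of _ "frac f r"] exI[of _ "frac g r"])
        (simp del: frac_mult frac_add add: c r)
  qed
qed

lemma bezout_at_L: "bezout_at L {\<one>\<^bsub>L\<^esub>} \<longleftrightarrow> bezout_at R S"
proof
  assume bz: "bezout_at L {\<one>\<^bsub>L\<^esub>}"
  show "bezout_at R S"
  proof (rule bezout_atI)
    fix a b assume ab: "a \<in> carrier R" "b \<in> carrier R"
    obtain x y u v where *: "x \<in> carrier L" "y \<in> carrier L" "u \<in> carrier L" "v \<in> carrier L"
      and e: "frac a \<one> \<otimes>\<^bsub>L\<^esub> y = frac b \<one> \<otimes>\<^bsub>L\<^esub> x" "u \<otimes>\<^bsub>L\<^esub> x \<oplus>\<^bsub>L\<^esub> v \<otimes>\<^bsub>L\<^esub> y \<in> {\<one>\<^bsub>L\<^esub>}"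
      by (rule bezout_atE[OF bz, of "frac a \<one>" "frac b \<one>"]) (use ab in auto)
    obtain x' s y' t where x: "x' \<in> carrier R" "s \<in> S" "x = frac x' s"
      "y' \<in> carrier R" "t \<in> S" "y = frac y' t" using *(1,2) by (elim carrierE)
    obtain u' r v' w where u: "u' \<in> carrier R" "r \<in> S" "u = frac u' r"
      "v' \<in> carrier R" "w \<in> S" "v = frac v' w" using *(3,4) by (elim carrierE)
    note k = ab x(1,4) u(1,4) x(2,5)[THEN S_carrier] u(2,5)[THEN S_carrier]
    have e1: "a \<otimes> y' \<otimes> s = b \<otimes> x' \<otimes> t" using e(1) x u ab by (simp add: frac_eq_domain)
    have e2: "u' \<otimes> x' \<otimes> (w \<otimes> t) \<oplus> v' \<otimes> y' \<otimes> (r \<otimes> s) = r \<otimes> s \<otimes> (w \<otimes> t)"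
      using e(2) x u ab by (simp add: L_one frac_eq_domain)
    have "a \<otimes> (y' \<otimes> s) = b \<otimes> (x' \<otimes> t)" using e1 k by (simp add: m_assoc)
    moreover have "(u' \<otimes> w) \<otimes> (x' \<otimes> t) \<oplus> (v' \<otimes> r) \<otimes> (y' \<otimes> s)
        = u' \<otimes> x' \<otimes> (w \<otimes> t) \<oplus> v' \<otimes> y' \<otimes> (r \<otimes> s)" using k by algebra
    then have "(u' \<otimes> w) \<otimes> (x' \<otimes> t) \<oplus> (v' \<otimes> r) \<otimes> (y' \<otimes> s) \<in> S"
      unfolding e2 using x u by simp
    ultimately show "\<exists>x y u v. x \<in> carrier R \<and> y \<in> carrier R \<and> u \<in> carrier R \<and> v \<in> carrier R \<and>
        a \<otimes> y = b \<otimes> x \<and> u \<otimes> x \<oplus> v \<otimes> y \<in> S"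
      by (intro exI[of _ "x' \<otimes> t"] exI[of _ "y' \<otimes> s"] exI[of _ "u' \<otimes> w"] exI[of _ "v' \<otimes> r"])
        (use k in simp)
  qed
next
  assume bz: "bezout_at R S"
  show "bezout_at L {\<one>\<^bsub>L\<^esub>}"
  proof (rule bezout_atI)
    fix a' b' assume "a' \<in> carrier L" "b' \<in> carrier L"
    then obtain a s b t where *: "a \<in> carrier R" "s \<in> S" "a' = frac a s"
      "b \<in> carrier R" "t \<in> S" "b' = frac b t"
      by (elim carrierE)
    obtain x y u v where c: "x \<in> carrier R" "y \<in> carrier R" "u \<in> carrier R" "v \<in> carrier R"
      and e: "a \<otimes> t \<otimes> y = b \<otimes> s \<otimes> x" "u \<otimes> x \<oplus> v \<otimes> y \<in> S"
      by (rule bezout_atE[OF bz, of "a \<otimes> t" "b \<otimes> s"]) (use * in auto)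
    define r where "r = u \<otimes> x \<oplus> v \<otimes> y"
    have r: "r \<in> S" using e by (simp add: r_def)
    note k = c *(1,4) *(2,5)[THEN S_carrier] S_carrier[OF r]
    have "a \<otimes> y \<otimes> t = a \<otimes> t \<otimes> y" using k by algebra
    also have "\<dots> = b \<otimes> x \<otimes> s" unfolding e(1) using k by algebra
    finally have "a' \<otimes>\<^bsub>L\<^esub> frac y \<one> = b' \<otimes>\<^bsub>L\<^esub> frac x \<one>"
      using * c by (simp add: frac_eq_domain)
    moreover have "u \<otimes> x \<otimes> r \<oplus> v \<otimes> y \<otimes> r = r \<otimes> r"
      using c S_carrier[OF r] by (simp add: r_def l_distr[symmetric])
    then have "frac u r \<otimes>\<^bsub>L\<^esub> frac x \<one> \<oplus>\<^bsub>L\<^esub> frac v r \<otimes>\<^bsub>L\<^esub> frac y \<one> = \<one>\<^bsub>L\<^esub>"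
      unfolding L_one using c r by (simp add: frac_eq_domain)
    ultimately show "\<exists>x y u v. x \<in> carrier L \<and> y \<in> carrier L \<and> u \<in> carrier L \<and> v \<in> carrier L \<and>
        a' \<otimes>\<^bsub>L\<^esub> y = b' \<otimes>\<^bsub>L\<^esub> x \<and> u \<otimes>\<^bsub>L\<^esub> x \<oplus>\<^bsub>L\<^esub> v \<otimes>\<^bsub>L\<^esub> y \<in> {\<one>\<^bsub>L\<^esub>}"
      by (intro exI[of _ "frac x \<one>"] exI[of _ "frac y \<one>"] exI[of _ "frac u r"] exI[of _ "frac v r"])
        (simp del: frac_mult frac_add add: c r)
  qed
qed

lemma dim_le_one_at_L:
  assumes D: "dim_le_one_at R S"
  shows "dim_le_one_at L {\<one>\<^bsub>L\<^esub>}"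
proof (rule dim_le_one_atI)
  interpret L: cring L by (rule cring_L)
  fix a' b' assume "a' \<in> carrier L" "a' \<noteq> \<zero>\<^bsub>L\<^esub>" "b' \<in> carrier L"
  then obtain a s b t where *: "a \<in> carrier R" "s \<in> S" "a' = frac a s"
    "b \<in> carrier R" "t \<in> S" "b' = frac b t" and nz: "a' \<noteq> \<zero>\<^bsub>L\<^esub>"
    by (elim carrierE)
  have a0: "a \<noteq> \<zero>"
  proof
    assume "a = \<zero>"
    then have "a' = \<zero>\<^bsub>L\<^esub>" unfolding *(3) L_zero using * by (simp add: frac_eq_domain)
    then show False using nz by simp
  qed
  obtain k r u v where r: "r \<in> S" and c: "u \<in> carrier R" "v \<in> carrier R"
    and e: "b [^] (k::nat) \<otimes> r = a \<otimes> u \<oplus> b [^] Suc k \<otimes> v"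
    by (rule dim_le_one_atE[OF D *(1) a0 *(4)])
  define B T where "B = b [^] k" and "T = t [^] k"
  have BT: "B \<in> carrier R" "T \<in> S" using * by (auto simp: B_def T_def)
  note kk = c *(1,4) *(2,5)[THEN S_carrier] S_carrier[OF r] BT(1) S_carrier[OF BT(2)]
  have e': "B \<otimes> r = a \<otimes> u \<oplus> B \<otimes> b \<otimes> v" using e by (simp add: B_def)
  \<comment> \<open>The cofactors in the localization are \<open>s u / (r T)\<close> and
    \<open>v t / r\<close>: with them every summand gets the denominator \<open>r T\<close> after
    cancelling \<open>s\<close> and \<open>t\<close>.\<close>
  have "(a \<otimes> (s \<otimes> u) \<otimes> (T \<otimes> t \<otimes> r) \<oplus> B \<otimes> b \<otimes> (v \<otimes> t) \<otimes> (s \<otimes> (r \<otimes> T))) \<otimes> T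
      = (s \<otimes> t \<otimes> T \<otimes> T \<otimes> r) \<otimes> (a \<otimes> u \<oplus> B \<otimes> b \<otimes> v)" using kk by algebra
  also have "\<dots> = B \<otimes> (s \<otimes> (r \<otimes> T) \<otimes> (T \<otimes> t \<otimes> r))" unfolding e'[symmetric] using kk by algebra
  finally have "frac (a \<otimes> (s \<otimes> u) \<otimes> (T \<otimes> t \<otimes> r) \<oplus> B \<otimes> b \<otimes> (v \<otimes> t) \<otimes> (s \<otimes> (r \<otimes> T)))
      (s \<otimes> (r \<otimes> T) \<otimes> (T \<otimes> t \<otimes> r)) = frac B T"
    by (intro frac_eqI) (use * r BT c in auto)
  then have "b' [^]\<^bsub>L\<^esub> k \<otimes>\<^bsub>L\<^esub> \<one>\<^bsub>L\<^esub>
      = a' \<otimes>\<^bsub>L\<^esub> frac (s \<otimes> u) (r \<otimes> T) \<oplus>\<^bsub>L\<^esub> b' [^]\<^bsub>L\<^esub> Suc k \<otimes>\<^bsub>L\<^esub> frac (v \<otimes> t) r"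
    using * r BT c by (simp add: frac_pow B_def[symmetric] T_def[symmetric])
  then show "\<exists>(k::nat) s u v. s \<in> {\<one>\<^bsub>L\<^esub>} \<and> u \<in> carrier L \<and> v \<in> carrier L \<and>
      b' [^]\<^bsub>L\<^esub> k \<otimes>\<^bsub>L\<^esub> s = a' \<otimes>\<^bsub>L\<^esub> u \<oplus>\<^bsub>L\<^esub> b' [^]\<^bsub>L\<^esub> Suc k \<otimes>\<^bsub>L\<^esub> v"
    using * r BT c by (intro exI[of _ k] exI[of _ "\<one>\<^bsub>L\<^esub>"] exI[of _ "frac (s \<otimes> u) (r \<otimes> T)"]
        exI[of _ "frac (v \<otimes> t) r"] conjI) simp_all
qed

end

section \<open>Conductors and valuation rings at the primes\<close>

lemma (in primeideal) domain_localization_compl: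
  assumes "domain R"
  shows "domain_localization R (carrier R - I)"
proof -
  interpret D: domain R by (rule assms)
  show ?thesis
  proof
    show "\<one> \<in> carrier R - I" using one_imp_carrier I_notcarr by auto
    show "\<zero> \<notin> carrier R - I" using zero_closed by simp
    show "x \<otimes> y \<in> carrier R - I" if "x \<in> carrier R - I" "y \<in> carrier R - I" for x y
      using that I_prime[of x y] by auto
  qed auto
qed

lemma (in cring) conductor_ideal:
  assumes "a \<in> carrier R" "b \<in> carrier R"
  shows "ideal {p \<in> carrier R. \<exists>x\<in>carrier R. p \<otimes> a = x \<otimes> b} R"
proof (rule ideal_by_closure)
  let ?I = "{p \<in> carrier R. \<exists>x\<in>carrier R. p \<otimes> a = x \<otimes> b}"
  show "?I \<subseteq> carrier R" by blast
  have "\<zero> \<otimes> a = \<zero> \<otimes> b" using assms by simp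
  then show "\<zero> \<in> ?I" by blast
  fix p q assume "p \<in> ?I" "q \<in> ?I"
  then obtain x y where *: "p \<in> carrier R" "q \<in> carrier R" "x \<in> carrier R" "y \<in> carrier R"
    and e: "p \<otimes> a = x \<otimes> b" "q \<otimes> a = y \<otimes> b" by blast
  have "(p \<oplus> q) \<otimes> a = (x \<oplus> y) \<otimes> b" using * assms e by (simp add: l_distr)
  then show "p \<oplus> q \<in> ?I" using * by (auto intro!: bexI[of _ "x \<oplus> y"])
next
  let ?I = "{p \<in> carrier R. \<exists>x\<in>carrier R. p \<otimes> a = x \<otimes> b}"
  fix p r assume "p \<in> ?I" and r: "r \<in> carrier R"
  then obtain x where *: "p \<in> carrier R" "x \<in> carrier R" and e: "p \<otimes> a = x \<otimes> b" by blast
  have "r \<otimes> p \<otimes> a = r \<otimes> x \<otimes> b" using * assms r e by (simp add: m_assoc)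
  then show "r \<otimes> p \<in> ?I" using * r by (auto intro!: bexI[of _ "r \<otimes> x"])
qed

text \<open>Unsolvability says that the sum of the two conductors \<open>(b) : (a)\<close> and
  \<open>(a) : (b)\<close> misses \<open>S\<close>. A prime above that sum contains every possible
  \<open>p\<close> and \<open>q\<close>, which confines the failure to a single
  localization.\<close>

lemma (in cring) not_arithmetical_prime:
  assumes S: "submonoid S R" and ab: "a \<in> carrier R" "b \<in> carrier R"
    and no: "\<not> (\<exists>p q x y. p \<in> carrier R \<and> q \<in> carrier R \<and> x \<in> carrier R \<and> y \<in> carrier R \<and>
       p \<oplus> q \<in> S \<and> p \<otimes> a = x \<otimes> b \<and> q \<otimes> b = y \<otimes> a)"
  obtains Q where "primeideal Q R" "Q \<inter> S = {}"
    "\<And>p x. p \<in> carrier R \<Longrightarrow> x \<in> carrier R \<Longrightarrow> p \<otimes> a = x \<otimes> b \<Longrightarrow> p \<in> Q"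
    "\<And>q y. q \<in> carrier R \<Longrightarrow> y \<in> carrier R \<Longrightarrow> q \<otimes> b = y \<otimes> a \<Longrightarrow> q \<in> Q"
proof -
  define I where "I = {p \<in> carrier R. \<exists>x\<in>carrier R. p \<otimes> a = x \<otimes> b}"
  define J where "J = {q \<in> carrier R. \<exists>y\<in>carrier R. q \<otimes> b = y \<otimes> a}"
  have I: "ideal I R" and J: "ideal J R"
    unfolding I_def J_def using conductor_ideal ab by simp_all
  have add: "p \<oplus> q \<in> set_add R I J" if "p \<in> I" "q \<in> J" for p q
    unfolding set_add_defs using that by auto
  have "set_add R I J \<inter> S = {}"
  proof (rule equals0I)
    fix s assume "s \<in> set_add R I J \<inter> S"
    then obtain p q where "s = p \<oplus> q" "p \<in> I" "q \<in> J" "s \<in> S" unfolding set_add_defs by auto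
    then show False using no unfolding I_def J_def by auto
  qed
  then obtain Q where Q: "primeideal Q R" "set_add R I J \<subseteq> Q" "Q \<inter> S = {}"
    using exists_prime_ideal_disjoint[OF add_ideals[OF I J] S] by auto
  have z: "\<zero> \<in> I" "\<zero> \<in> J"
    by (rule additive_subgroup.zero_closed[OF ideal.axioms(1)[OF I]]
        additive_subgroup.zero_closed[OF ideal.axioms(1)[OF J]])+
  show thesis
  proof (rule that[OF Q(1,3)])
    fix p x assume "p \<in> carrier R" "x \<in> carrier R" "p \<otimes> a = x \<otimes> b"
    then have "p \<in> I" by (auto simp: I_def)
    then show "p \<in> Q" using add[OF _ z(2), of p] Q(2) \<open>p \<in> carrier R\<close> by auto
  next
    fix p x assume "p \<in> carrier R" "x \<in> carrier R" "p \<otimes> b = x \<otimes> a"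
    then have "p \<in> J" by (auto simp: J_def)
    then show "p \<in> Q" using add[OF z(1), of p] Q(2) \<open>p \<in> carrier R\<close> by auto
  qed
qed

text \<open>A failure gives a prime \<open>P\<close> containing both conductors, and locally at such
  a \<open>P\<close> neither of \<open>a\<close> and \<open>b\<close> divides the other. Conversely
  \<open>p \<oplus> q = \<one>\<close> leaves \<open>p\<close> or \<open>q\<close> outside
  \<open>P\<close>, where it becomes a denominator.\<close>

lemma (in domain) prufer_domain_iff: "prufer_domain R \<longleftrightarrow> arithmetical_at R {\<one>}"
proof
  assume "prufer_domain R"
  then interpret prufer_domain R .
  show "arithmetical_at R {\<one>}"
  proof (rule arithmetical_atI, rule ccontr)
    fix a b assume ab: "a \<in> carrier R" "b \<in> carrier R"
    assume no: "\<not> (\<exists>p q x y. p \<in> carrier R \<and> q \<in> carrier R \<and> x \<in> carrier R \<and> y \<in> carrier R \<and>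
       p \<oplus> q \<in> {\<one>} \<and> p \<otimes> a = x \<otimes> b \<and> q \<otimes> b = y \<otimes> a)"
    obtain P where P: "primeideal P R"
      and J: "\<And>p x. p \<in> carrier R \<Longrightarrow> x \<in> carrier R \<Longrightarrow> p \<otimes> a = x \<otimes> b \<Longrightarrow> p \<in> P"
        "\<And>q y. q \<in> carrier R \<Longrightarrow> y \<in> carrier R \<Longrightarrow> q \<otimes> b = y \<otimes> a \<Longrightarrow> q \<in> P"
      by (rule not_arithmetical_prime[OF _ ab no]) (auto simp: submonoid_def)
    interpret P: primeideal P R by (rule P)
    interpret D: domain_localization R "carrier R - P"
      by (rule P.domain_localization_compl[OF domain_axioms])
    interpret V: valuation_domain D.L by (rule locally_valuation[OF P])
    have "D.frac a \<one> divides\<^bsub>D.L\<^esub> D.frac b \<one> \<or> D.frac b \<one> divides\<^bsub>D.L\<^esub> D.frac a \<one>"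
      by (rule V.divides_total) (use ab D.S_one in \<open>auto intro!: D.frac_carrier\<close>)
    then show False
    proof
      assume "D.frac a \<one> divides\<^bsub>D.L\<^esub> D.frac b \<one>"
      then obtain c where c: "c \<in> carrier D.L" "D.frac b \<one> = D.frac a \<one> \<otimes>\<^bsub>D.L\<^esub> c" unfolding factor_def by blast
      obtain f s where f: "f \<in> carrier R" "s \<in> carrier R - P" "c = D.frac f s" using c(1) by (elim D.carrierE)
      have "b \<otimes> s = a \<otimes> f" using c(2) f ab D.S_one by (simp add: D.frac_eq_domain)
      then have "s \<otimes> b = f \<otimes> a" using f ab by (simp add: m_comm)
      then have "s \<in> P" by (rule J(2)[rotated 2]) (use f in simp_all)
      then show False using f(2) by simp
    next
      assume "D.frac b \<one> divides\<^bsub>D.L\<^esub> D.frac a \<one>"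
      then obtain c where c: "c \<in> carrier D.L" "D.frac a \<one> = D.frac b \<one> \<otimes>\<^bsub>D.L\<^esub> c" unfolding factor_def by blast
      obtain f s where f: "f \<in> carrier R" "s \<in> carrier R - P" "c = D.frac f s" using c(1) by (elim D.carrierE)
      have "a \<otimes> s = b \<otimes> f" using c(2) f ab D.S_one by (simp add: D.frac_eq_domain)
      then have "s \<otimes> a = f \<otimes> b" using f ab by (simp add: m_comm)
      then have "s \<in> P" by (rule J(1)[rotated 2]) (use f in simp_all)
      then show False using f(2) by simp
    qed
  qed
next
  assume ar: "arithmetical_at R {\<one>}"
  show "prufer_domain R"
  proof (intro prufer_domain.intro prufer_domain_axioms.intro domain_axioms)
    fix P assume P: "primeideal P R"
    interpret P: primeideal P R by (rule P(1))
    interpret D: domain_localization R "carrier R - P"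
      by (rule P.domain_localization_compl[OF domain_axioms])
    show "valuation_domain D.L"
    proof (intro valuation_domain.intro valuation_domain_axioms.intro D.domain_L)
      fix x y assume "x \<in> carrier D.L" "y \<in> carrier D.L"
      then obtain a s b t where *: "a \<in> carrier R" "s \<in> carrier R - P" "x = D.frac a s"
        "b \<in> carrier R" "t \<in> carrier R - P" "y = D.frac b t"
        by (elim D.carrierE)
      obtain p q f g where c: "p \<in> carrier R" "q \<in> carrier R" "f \<in> carrier R" "g \<in> carrier R"
        and e: "p \<oplus> q \<in> {\<one>}" "p \<otimes> (a \<otimes> t) = f \<otimes> (b \<otimes> s)" "q \<otimes> (b \<otimes> s) = g \<otimes> (a \<otimes> t)"
        by (rule arithmetical_atE[OF ar, of "a \<otimes> t" "b \<otimes> s"]) (use * in auto)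
      note k = c *(1,4) *(2,5)[THEN D.S_carrier]
      have "p \<notin> P \<or> q \<notin> P"
      proof (rule ccontr)
        assume "\<not> (p \<notin> P \<or> q \<notin> P)"
        then have "p \<oplus> q \<in> P" by (simp add: P.a_closed)
        then have "\<one> \<in> P" using e(1) by simp
        then show False using P.one_imp_carrier P.I_notcarr by blast
      qed
      then show "x divides\<^bsub>D.L\<^esub> y \<or> y divides\<^bsub>D.L\<^esub> x"
      proof
        assume p: "p \<notin> P"
        have "a \<otimes> (t \<otimes> p) = p \<otimes> (a \<otimes> t)" using k by algebra
        also have "\<dots> = b \<otimes> f \<otimes> s" unfolding e(2) using k by algebra
        finally have "x = y \<otimes>\<^bsub>D.L\<^esub> D.frac f p"
          using * c p D.S_mult[of t p] by (simp add: D.frac_eq_domain)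
        then show ?thesis using D.frac_carrier[of f p] c p unfolding factor_def by blast
      next
        assume q: "q \<notin> P"
        have "b \<otimes> (s \<otimes> q) = q \<otimes> (b \<otimes> s)" using k by algebra
        also have "\<dots> = a \<otimes> g \<otimes> t" unfolding e(3) using k by algebra
        finally have "y = x \<otimes>\<^bsub>D.L\<^esub> D.frac g q"
          using * c q D.S_mult[of s q] by (simp add: D.frac_eq_domain)
        then show ?thesis using D.frac_carrier[of g q] c q unfolding factor_def by blast
      qed
    qed
  qed
qed

section \<open>Univariate polynomials over a domain with a multiplicative set\<close>

text \<open>Locally at \<open>p\<close> divisibility is total, so some member \<open>c\<close> of
  the set divides all of them; \<open>s\<close> is the common denominator. Taking \<open>c\<close>
  from the set itself is what later makes \<open>s\<close> a coefficient of a quotient.\<close>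

lemma (in cring) arithmetical_at_prime_content:
  assumes ar: "arithmetical_at R S" and p: "primeideal p R" "p \<inter> S = {}"
    and C: "finite C" "C \<noteq> {}" "C \<subseteq> carrier R"
  shows "\<exists>c\<in>C. \<exists>s\<in>carrier R - p. \<forall>a\<in>C. \<exists>y\<in>carrier R. s \<otimes> a = y \<otimes> c"
  using C
proof (induction C rule: finite_ne_induct)
  case (singleton a)
  interpret p: primeideal p R by (rule p)
  have "\<one> \<in> carrier R - p" using p.one_imp_carrier p.I_notcarr by auto
  then show ?case by blast
next
  case (insert a C)
  interpret p: primeideal p R by (rule p)
  have a: "a \<in> carrier R" using insert by simp
  obtain c s where c: "c \<in> C" and s: "s \<in> carrier R" "s \<notin> p"
    and y: "\<And>a. a \<in> C \<Longrightarrow> \<exists>y\<in>carrier R. s \<otimes> a = y \<otimes> c"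
    using insert by auto
  have cc: "c \<in> carrier R" using c insert by auto
  obtain p1 q1 x y1 where k: "p1 \<in> carrier R" "q1 \<in> carrier R" "x \<in> carrier R" "y1 \<in> carrier R"
    and e: "p1 \<oplus> q1 \<in> S" "p1 \<otimes> a = x \<otimes> c" "q1 \<otimes> c = y1 \<otimes> a"
    by (rule arithmetical_atE[OF ar a cc])
  \<comment> \<open>Since \<open>p1 \<oplus> q1\<close> lies in \<open>S\<close>, one of them is a
    local unit: for \<open>p1\<close> the old \<open>c\<close> divides \<open>a\<close>, for
    \<open>q1\<close> the new \<open>a\<close> divides \<open>c\<close> and takes its place.\<close>
  have "p1 \<notin> p \<or> q1 \<notin> p" using p.a_closed[of p1 q1] e(1) p(2) by blast
  then show ?case
  proof
    assume p1: "p1 \<notin> p"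
    have "s \<otimes> p1 \<in> carrier R - p" using p1 s k p.I_prime by auto
    moreover have "\<exists>y\<in>carrier R. s \<otimes> p1 \<otimes> b = y \<otimes> c" if b: "b \<in> insert a C" for b
    proof (cases "b = a")
      case True
      have "s \<otimes> p1 \<otimes> a = s \<otimes> x \<otimes> c" using e(2) s k a cc by (simp add: m_assoc)
      then show ?thesis using True s k by (intro bexI[of _ "s \<otimes> x"]) auto
    next
      case False
      then obtain y where y: "y \<in> carrier R" "s \<otimes> b = y \<otimes> c" using b y by auto
      have bc: "b \<in> carrier R" using b insert by auto
      have "s \<otimes> p1 \<otimes> b = p1 \<otimes> (s \<otimes> b)" using s k bc by algebra
      also have "\<dots> = p1 \<otimes> y \<otimes> c" unfolding y(2) using y(1) k cc by algebra
      finally show ?thesis using y k by (intro bexI[of _ "p1 \<otimes> y"]) auto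
    qed
    ultimately show ?thesis using c by blast
  next
    assume q1: "q1 \<notin> p"
    have "s \<otimes> q1 \<in> carrier R - p" using q1 s k p.I_prime by auto
    moreover have "\<exists>y\<in>carrier R. s \<otimes> q1 \<otimes> b = y \<otimes> a" if b: "b \<in> insert a C" for b
    proof (cases "b = a")
      case True
      then show ?thesis using s k by (intro bexI[of _ "s \<otimes> q1"]) auto
    next
      case False
      then obtain y where y: "y \<in> carrier R" "s \<otimes> b = y \<otimes> c" using b y by auto
      have bc: "b \<in> carrier R" using b insert by auto
      have "s \<otimes> q1 \<otimes> b = q1 \<otimes> (s \<otimes> b)" using s k bc by algebra
      also have "\<dots> = y \<otimes> (q1 \<otimes> c)" unfolding y(2) using y(1) k cc by algebra
      also have "\<dots> = y \<otimes> y1 \<otimes> a" unfolding e(3) using y(1) k a by algebra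
      finally show ?thesis using y k by (intro bexI[of _ "y \<otimes> y1"]) auto
    qed
    ultimately show ?thesis by blast
  qed
qed

text \<open>The global counterpart, with one denominator \<open>s\<close> from \<open>S\<close>:
  \<open>c\<close> is a greatest common divisor of the set up to \<open>S\<close>. The last clause
  expresses through primes that the quotients \<open>Y a\<close> generate an ideal that meets
  \<open>S\<close>.\<close>

lemma (in cring) bezout_at_content:
  assumes bz: "bezout_at R S" and S: "submonoid S R"
    and C: "finite C" "C \<noteq> {}" "C \<subseteq> carrier R"
  shows "\<exists>c\<in>carrier R. \<exists>s\<in>S. \<exists>Y. (\<forall>a\<in>C. Y a \<in> carrier R \<and> s \<otimes> a = Y a \<otimes> c) \<and>
     (\<forall>p. primeideal p R \<and> p \<inter> S = {} \<longrightarrow> (\<exists>a\<in>C. Y a \<notin> p))"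
  using C
proof (induction C rule: finite_ne_induct)
  case (singleton a)
  have "\<one> \<notin> p" if "primeideal p R" for p
    using ideal.one_imp_carrier[of p R] primeideal.axioms(1)[OF that]
      primeideal.I_notcarr[OF that] by blast
  then show ?case using singleton submonoid.one_closed[OF S]
    by (intro bexI[of _ a] bexI[of _ \<one>] exI[of _ "\<lambda>_. \<one>"]) auto
next
  case (insert a C)
  have a: "a \<in> carrier R" using insert by simp
  have "C \<subseteq> carrier R" using insert by simp
  from insert.IH[OF this] obtain c s Y where c: "c \<in> carrier R" and s: "s \<in> S"
    and Y_all: "\<forall>a\<in>C. Y a \<in> carrier R \<and> s \<otimes> a = Y a \<otimes> c"
    and Yp: "\<forall>p. primeideal p R \<and> p \<inter> S = {} \<longrightarrow> (\<exists>a\<in>C. Y a \<notin> p)"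
    by (elim bexE exE conjE) (rule that)
  have Y: "Y a \<in> carrier R \<and> s \<otimes> a = Y a \<otimes> c" if "a \<in> C" for a
    using Y_all that by blast
  have sc: "s \<in> carrier R" using s submonoid.subset[OF S] by blast
  obtain x y u v where k: "x \<in> carrier R" "y \<in> carrier R" "u \<in> carrier R" "v \<in> carrier R"
    and e: "a \<otimes> y = c \<otimes> x" "u \<otimes> x \<oplus> v \<otimes> y \<in> S"
    by (rule bezout_atE[OF bz a c])
  \<comment> \<open>\<open>d\<close> is a greatest common divisor of the new element and the old
    \<open>c\<close>, with \<open>r \<otimes> a = x \<otimes> d\<close> and
    \<open>r \<otimes> c = y \<otimes> d\<close>, so the quotient of an old element is multiplied by
    \<open>y\<close>.\<close>
  define r d where "r = u \<otimes> x \<oplus> v \<otimes> y" and "d = u \<otimes> a \<oplus> v \<otimes> c"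
  have r: "r \<in> S" "r \<in> carrier R" and d: "d \<in> carrier R" using e k a c by (auto simp: r_def d_def)
  have "x \<otimes> d = a \<otimes> (u \<otimes> x) \<oplus> v \<otimes> (c \<otimes> x)" unfolding d_def using k a c by algebra
  also have "\<dots> = r \<otimes> a" unfolding e(1)[symmetric] r_def using k a c by algebra
  finally have xa: "r \<otimes> a = x \<otimes> d" ..
  have "y \<otimes> d = u \<otimes> (a \<otimes> y) \<oplus> v \<otimes> (y \<otimes> c)" unfolding d_def using k a c by algebra
  also have "\<dots> = r \<otimes> c" unfolding e(1) r_def using k a c by algebra
  finally have yc: "r \<otimes> c = y \<otimes> d" ..
  define Z where "Z = (\<lambda>b. if b = a then s \<otimes> x else Y b \<otimes> y)"
  have "s \<otimes> r \<in> S" using s r submonoid.m_closed[OF S] by blast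
  moreover have "Z b \<in> carrier R \<and> s \<otimes> r \<otimes> b = Z b \<otimes> d" if b: "b \<in> insert a C" for b
  proof (cases "b = a")
    case True
    then show ?thesis unfolding Z_def using sc r k a d xa by (simp add: m_assoc)
  next
    case False
    then have Yb: "Y b \<in> carrier R" "s \<otimes> b = Y b \<otimes> c" using b Y by auto
    have bc: "b \<in> carrier R" using b insert by auto
    have "s \<otimes> r \<otimes> b = r \<otimes> (s \<otimes> b)" using sc r bc by algebra
    also have "\<dots> = Y b \<otimes> (r \<otimes> c)" unfolding Yb(2) using Yb(1) r c by algebra
    also have "\<dots> = Y b \<otimes> y \<otimes> d" unfolding yc using Yb(1) k d by algebra
    finally show ?thesis unfolding Z_def using False Yb k by simp
  qed
  \<comment> \<open>If all new quotients lay in \<open>p\<close>, then \<open>x\<close> would, and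
    \<open>y\<close> as well because some old quotient is outside \<open>p\<close>; then
    \<open>r = u \<otimes> x \<oplus> v \<otimes> y\<close> would lie in \<open>p\<close>.\<close>
  moreover have "\<exists>b\<in>insert a C. Z b \<notin> p" if p: "primeideal p R" "p \<inter> S = {}" for p
  proof (rule ccontr)
    assume no: "\<not> ?thesis"
    interpret p: primeideal p R by (rule p)
    have "s \<otimes> x \<in> p" using no by (auto simp: Z_def)
    then have x: "x \<in> p" using p.I_prime[of s x] sc k s p(2) by auto
    obtain b where b: "b \<in> C" "Y b \<notin> p" using Yp p by blast
    then have "b \<noteq> a" using insert by auto
    then have "Y b \<otimes> y \<in> p" using no b by (auto simp: Z_def)
    then have y: "y \<in> p" using p.I_prime[of "Y b" y] Y b k by auto
    have "r \<in> p" unfolding r_def using x y k by (simp add: p.a_closed p.I_l_closed)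
    then show False using r p by blast
  qed
  ultimately show ?case using d by (intro bexI[of _ d] bexI[of _ "s \<otimes> r"] exI[of _ Z]) auto
qed

section \<open>Leading coefficients in a multiplicative set, contraction of primes\<close>

locale domain_at = domain R for R (structure) +
  fixes S
  assumes S: "submonoid S R" and zero_notin_S: "\<zero> \<notin> S"
begin

abbreviation P where "P \<equiv> UP R"
abbreviation cnst where "cnst a \<equiv> monom P a 0"

sublocale U: UP_domain R "UP R" by unfold_locales auto

definition "lead_in_S = {f \<in> carrier P. coeff P f (deg R f) \<in> S}"

lemma S_carr: "s \<in> S \<Longrightarrow> s \<in> carrier R" using submonoid.subset[OF S] by blast

lemma cnst_mult: "a \<in> carrier R \<Longrightarrow> b \<in> carrier R \<Longrightarrow> cnst (a \<otimes> b) = cnst a \<otimes>\<^bsub>P\<^esub> cnst b"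
  using U.monom_mult[of a b 0 0] by simp

lemma coeff_cnst_mult [simp]:
  "a \<in> carrier R \<Longrightarrow> f \<in> carrier P \<Longrightarrow> coeff P (cnst a \<otimes>\<^bsub>P\<^esub> f) n = a \<otimes> coeff P f n"
  using U.coeff_monom_mult[of a f 0 n] by simp

lemma cnst_eq_zero_iff: "a \<in> carrier R \<Longrightarrow> cnst a = \<zero>\<^bsub>P\<^esub> \<longleftrightarrow> a = \<zero>"
  by (metis U.coeff_monom U.coeff_zero U.monom_zero)

lemma lead_in_SI:
  assumes "f \<in> carrier P" "coeff P f n \<in> S" "\<And>m. n < m \<Longrightarrow> coeff P f m = \<zero>"
  shows "f \<in> lead_in_S"
proof -
  have "deg R f = n"
    by (intro antisym U.deg_aboveI U.deg_belowI) (use assms zero_notin_S in auto)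
  then show ?thesis using assms by (simp add: lead_in_S_def)
qed

lemma zero_notin_lead: "\<zero>\<^bsub>P\<^esub> \<notin> lead_in_S"
  using zero_notin_S by (simp add: lead_in_S_def)

lemma coeff_mult_deg:
  assumes "f \<in> carrier P" "g \<in> carrier P"
  shows "coeff P (f \<otimes>\<^bsub>P\<^esub> g) (deg R f + deg R g) = coeff P f (deg R f) \<otimes> coeff P g (deg R g)"
proof -
  have "coeff P (f \<otimes>\<^bsub>P\<^esub> g) (deg R f + deg R g)
      = (\<Oplus>i\<in>{..deg R f + deg R g}. coeff P f i \<otimes> coeff P g (deg R f + deg R g - i))"
    using assms by simp
  also have "\<dots> = (\<Oplus>i\<in>{..deg R f + deg R g}.
      if deg R f = i then coeff P f i \<otimes> coeff P g (deg R f + deg R g - i) else \<zero>)"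
  proof (intro finsum_cong)
    fix i
    have "coeff P f i = \<zero> \<or> coeff P g (deg R f + deg R g - i) = \<zero>" if "deg R f \<noteq> i"
    proof (cases "deg R f < i")
      case True
      then show ?thesis using U.deg_aboveD assms by blast
    next
      case False
      then have "deg R g < deg R f + deg R g - i" using that by simp
      then show ?thesis using U.deg_aboveD assms by blast
    qed
    then show "i \<in> {..deg R f + deg R g} =simp=> coeff P f i \<otimes> coeff P g (deg R f + deg R g - i) =
        (if deg R f = i then coeff P f i \<otimes> coeff P g (deg R f + deg R g - i) else \<zero>)"
      using assms by (auto simp: simp_implies_def)
  qed (use assms in auto)
  also have "\<dots> = coeff P f (deg R f) \<otimes> coeff P g (deg R g)"
    using finsum_singleton[of "deg R f" "{..deg R f + deg R g}"
        "\<lambda>i. coeff P f i \<otimes> coeff P g (deg R f + deg R g - i)"] assms by simp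
  finally show ?thesis .
qed

lemma submonoid_lead: "submonoid lead_in_S P"
proof (rule submonoid.intro)
  show "lead_in_S \<subseteq> carrier P" by (auto simp: lead_in_S_def)
  show "\<one>\<^bsub>P\<^esub> \<in> lead_in_S"
    using submonoid.one_closed[OF S] by (simp add: lead_in_S_def)
  fix f g assume fg: "f \<in> lead_in_S" "g \<in> lead_in_S"
  then have c: "f \<in> carrier P" "g \<in> carrier P" by (auto simp: lead_in_S_def)
  have nz: "f \<noteq> \<zero>\<^bsub>P\<^esub>" "g \<noteq> \<zero>\<^bsub>P\<^esub>" using fg zero_notin_lead by auto
  have "coeff P (f \<otimes>\<^bsub>P\<^esub> g) (deg R (f \<otimes>\<^bsub>P\<^esub> g)) \<in> S"
    unfolding U.deg_mult[OF nz c] coeff_mult_deg[OF c]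
    using fg submonoid.m_closed[OF S] by (simp add: lead_in_S_def)
  then show "f \<otimes>\<^bsub>P\<^esub> g \<in> lead_in_S" using c by (simp add: lead_in_S_def)
qed

lemma ideal_cnst_mult:
  assumes "ideal Q P" "cnst a \<in> Q" "a \<in> carrier R"
  shows "monom P a n \<in> Q"
proof -
  have "monom P a n = monom P \<one> n \<otimes>\<^bsub>P\<^esub> cnst a"
    using U.monom_mult[of \<one> a n 0] assms by simp
  then show ?thesis using ideal.I_l_closed[OF assms(1,2)] by simp
qed

text \<open>Induction on a bound beyond which the coefficients vanish rather than on the degree: the
  zero polynomial becomes the base case, and removing the term at \<open>n\<close> is a step even if
  its coefficient is zero.\<close>

lemma mem_ideal_if_coeffs:
  assumes Q: "ideal Q P" and f: "f \<in> carrier P" and c: "\<And>k. cnst (coeff P f k) \<in> Q"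
  shows "f \<in> Q"
proof -
  interpret Q: ideal Q P by (rule Q)
  have "f \<in> Q" if "f \<in> carrier P" "\<forall>m\<ge>n. coeff P f m = \<zero>" "\<forall>k. cnst (coeff P f k) \<in> Q" for n f
    using that
  proof (induction n arbitrary: f)
    case 0
    then have "f = \<zero>\<^bsub>P\<^esub>" by (intro U.up_eqI) auto
    then show ?case using Q.zero_closed by simp
  next
    case (Suc n)
    define h where "h = monom P (coeff P f n) n"
    have h: "h \<in> Q" "h \<in> carrier P"
      using ideal_cnst_mult[OF Q] Suc.prems by (auto simp: h_def)
    define g where "g = f \<ominus>\<^bsub>P\<^esub> h"
    have g: "g \<in> carrier P" using Suc h by (simp add: g_def)
    have cg: "coeff P g m = (if m = n then \<zero> else coeff P f m)" for m
    proof -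
      have "coeff P f m \<ominus> coeff P f m = \<zero>" using Suc.prems(1) by (simp add: minus_eq r_neg)
      then show ?thesis using Suc.prems(1) h(2) by (auto simp: g_def h_def minus_eq)
    qed
    have "g \<in> Q"
    proof (rule Suc.IH[OF g])
      show "\<forall>m\<ge>n. coeff P g m = \<zero>" using cg Suc.prems(2) by auto
      show "\<forall>k. cnst (coeff P g k) \<in> Q" using cg Suc.prems(3) Q.zero_closed by auto
    qed
    then have "g \<oplus>\<^bsub>P\<^esub> h \<in> Q" using h by (simp add: Q.a_closed)
    moreover have "g \<oplus>\<^bsub>P\<^esub> h = f" unfolding g_def using Suc.prems(1) h(2) by algebra
    ultimately show ?case by simp
  qed
  moreover have "\<forall>m\<ge>Suc (deg R f). coeff P f m = \<zero>" using U.deg_aboveD f by auto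
  ultimately show ?thesis using f c by blast
qed

definition "contraction Q = {a \<in> carrier R. cnst a \<in> Q}"

lemma contractionD: "a \<in> contraction Q \<Longrightarrow> a \<in> carrier R" "a \<in> contraction Q \<Longrightarrow> cnst a \<in> Q"
  by (auto simp: contraction_def)

lemma contraction_prime:
  assumes "primeideal Q P"
  shows "primeideal (contraction Q) R"
proof -
  interpret Q: primeideal Q P by (rule assms)
  have one: "\<one>\<^bsub>P\<^esub> \<notin> Q" using Q.one_imp_carrier Q.I_notcarr by blast
  show ?thesis
  proof (rule primeidealI)
    show "cring R" by (rule is_cring)
    show "ideal (contraction Q) R"
    proof (rule ideal_by_closure)
      show "contraction Q \<subseteq> carrier R" by (auto simp: contraction_def)
      show "\<zero> \<in> contraction Q" using Q.zero_closed by (simp add: contraction_def)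
      show "a \<oplus> b \<in> contraction Q" if "a \<in> contraction Q" "b \<in> contraction Q" for a b
        using that Q.a_closed by (simp add: contraction_def)
      show "x \<otimes> a \<in> contraction Q" if "a \<in> contraction Q" "x \<in> carrier R" for a x
        using that Q.I_l_closed by (simp add: contraction_def cnst_mult)
    qed
    show "carrier R \<noteq> contraction Q"
      using one U.monom_one one_closed contractionD(2)[of \<one> Q] by auto
    show "a \<in> contraction Q \<or> b \<in> contraction Q"
      if "a \<in> carrier R" "b \<in> carrier R" "a \<otimes> b \<in> contraction Q" for a b
      using that Q.I_prime[of "cnst a" "cnst b"] by (simp add: contraction_def cnst_mult)
  qed
qed

lemma contraction_disjoint:
  assumes "Q \<inter> lead_in_S = {}"
  shows "contraction Q \<inter> S = {}"
proof (rule equals0I)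
  fix s assume "s \<in> contraction Q \<inter> S"
  then have "cnst s \<in> Q" "cnst s \<in> lead_in_S"
    using S_carr by (auto simp: contraction_def lead_in_S_def)
  then show False using assms by blast
qed

text \<open>Under the dimension hypothesis a nonzero prime \<open>p\<close> disjoint from \<open>S\<close> is maximal among
  the ideals disjoint from \<open>S\<close>, so a polynomial with a coefficient outside \<open>p\<close> can be given,
  modulo \<open>p[X]\<close>, a leading coefficient in \<open>S\<close>.\<close>

lemma coeffs_in_prime:
  assumes D: "dim_le_one_at R S" and p: "primeideal p R" and nz: "p \<noteq> {\<zero>}"
    and Q: "ideal Q P" "Q \<inter> lead_in_S = {}" and pQ: "\<And>a. a \<in> p \<Longrightarrow> cnst a \<in> Q"
    and f: "f \<in> Q"
  shows "coeff P f k \<in> p"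
proof -
  interpret Q: ideal Q P by (rule Q)
  interpret p: primeideal p R by (rule p)
  have "\<forall>k. coeff P f k \<in> p" if "f \<in> Q" "\<forall>m\<ge>n. coeff P f m = \<zero>" for n f
    using that
  proof (induction n arbitrary: f)
    case 0
    then show ?case using p.zero_closed by simp
  next
    case (Suc n)
    have f: "f \<in> carrier P" using Suc.prems Q.Icarr by blast
    define b where "b = coeff P f n"
    have b: "b \<in> carrier R" using f by (simp add: b_def)
    show ?case
    proof (cases "b \<in> p")
      case True
      define h where "h = monom P b n"
      have h: "h \<in> Q" "h \<in> carrier P"
        using ideal_cnst_mult[OF Q(1) pQ[OF True] b] b by (auto simp: h_def)
      define g where "g = f \<ominus>\<^bsub>P\<^esub> h"
      have cg: "coeff P g m = (if m = n then \<zero> else coeff P f m)" for m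
      proof -
        have "coeff P f m \<ominus> coeff P f m = \<zero>" using f by (simp add: minus_eq r_neg)
        then show ?thesis using f h(2) b by (auto simp: g_def h_def b_def minus_eq)
      qed
      have "g \<in> Q" unfolding g_def a_minus_def
        by (rule Q.a_closed[OF Suc.prems(1) Q.a_inv_closed[OF h(1)]])
      then have "\<forall>k. coeff P g k \<in> p"
        by (rule Suc.IH) (use cg Suc.prems(2) in auto)
      then show ?thesis using cg True b_def by metis
    next
      case False
      obtain v s q where v: "v \<in> carrier R" and s: "s \<in> S" and q: "q \<in> p" and e: "b \<otimes> v = s \<oplus> q"
        using dim_le_one_at_prime[OF D S p nz b False] by blast
      have qc: "q \<in> carrier R" using q p.Icarr by blast
      have sc: "s \<in> carrier R" using s S_carr by blast
      \<comment> \<open>At \<open>n\<close> the coefficient of \<open>h\<close> is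
        \<open>v b - q = s\<close>, and above \<open>n\<close> it vanishes, so \<open>h\<close>
        would be a member of \<open>Q\<close> with leading coefficient in \<open>S\<close>.\<close>
      define h where "h = cnst v \<otimes>\<^bsub>P\<^esub> f \<ominus>\<^bsub>P\<^esub> monom P q n"
      have hc: "h \<in> carrier P" using v f qc by (simp add: h_def)
      have "cnst v \<otimes>\<^bsub>P\<^esub> f \<in> Q" by (rule Q.I_l_closed) (use Suc.prems v in auto)
      moreover have "monom P q n \<in> Q" by (rule ideal_cnst_mult[OF Q(1) pQ[OF q] qc])
      ultimately have "h \<in> Q" unfolding h_def a_minus_def by (rule Q.a_closed[OF _ Q.a_inv_closed])
      moreover have "h \<in> lead_in_S"
      proof (rule lead_in_SI[OF hc])
        have "coeff P h n = v \<otimes> b \<ominus> q" using v f qc by (simp add: h_def b_def del: U.coeff_mult)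
        also have "\<dots> = b \<otimes> v \<ominus> q" using v b by (simp add: m_comm)
        also have "\<dots> = s" unfolding e using sc qc by algebra
        finally show "coeff P h n \<in> S" using s by simp
        show "coeff P h m = \<zero>" if "n < m" for m
          using that Suc.prems(2) v f qc by (simp add: h_def minus_eq del: U.coeff_mult)
      qed
      ultimately show ?thesis using Q(2) by blast
    qed
  qed
  moreover have "\<forall>m\<ge>Suc (deg R f). coeff P f m = \<zero>" using U.deg_aboveD f Q.Icarr by auto
  ultimately show ?thesis using f by blast
qed

text \<open>The witnesses \<open>f'\<close> and \<open>g'\<close> are \<open>f\<close> and \<open>g\<close> divided by their greatest common divisor over
  the field of fractions; \<open>t\<close> clears the denominators of the resulting Bezout relation.\<close>

definition euclid :: "(nat \<Rightarrow> 'a) \<Rightarrow> (nat \<Rightarrow> 'a) \<Rightarrow> bool" where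
  "euclid f g \<longleftrightarrow> (\<exists>f' g' u v t. f' \<in> carrier P \<and> g' \<in> carrier P \<and> u \<in> carrier P \<and> v \<in> carrier P \<and>
     t \<in> carrier R \<and> t \<noteq> \<zero> \<and> f \<otimes>\<^bsub>P\<^esub> g' = g \<otimes>\<^bsub>P\<^esub> f' \<and> u \<otimes>\<^bsub>P\<^esub> f' \<oplus>\<^bsub>P\<^esub> v \<otimes>\<^bsub>P\<^esub> g' = cnst t)"

lemma euclid_sym:
  assumes "euclid f g"
  shows "euclid g f"
proof -
  obtain f' g' u v t where k: "f' \<in> carrier P" "g' \<in> carrier P" "u \<in> carrier P" "v \<in> carrier P"
     "t \<in> carrier R" "t \<noteq> \<zero>" and e: "f \<otimes>\<^bsub>P\<^esub> g' = g \<otimes>\<^bsub>P\<^esub> f'" "u \<otimes>\<^bsub>P\<^esub> f' \<oplus>\<^bsub>P\<^esub> v \<otimes>\<^bsub>P\<^esub> g' = cnst t"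
    using assms unfolding euclid_def by (elim exE conjE)
  have "v \<otimes>\<^bsub>P\<^esub> g' \<oplus>\<^bsub>P\<^esub> u \<otimes>\<^bsub>P\<^esub> f' = cnst t" using e(2) k by (simp add: U.P.a_comm)
  then show ?thesis unfolding euclid_def
    using k e(1) by (intro exI[of _ g'] exI[of _ f'] exI[of _ v] exI[of _ u] exI[of _ t]) simp
qed

text \<open>A relation for \<open>r\<close> and \<open>g\<close> becomes one for \<open>f\<close>
  and \<open>g\<close> through \<open>b f = q g + r\<close>: the quotients transform by the matrix
  of the division step, and \<open>t\<close> picks up the factor \<open>b\<close>.\<close>

lemma euclid_step:
  assumes E: "euclid r g" and c: "f \<in> carrier P" "g \<in> carrier P" "q \<in> carrier P" "r \<in> carrier P"
    and b: "b \<in> carrier R" "b \<noteq> \<zero>" and fr: "cnst b \<otimes>\<^bsub>P\<^esub> f = q \<otimes>\<^bsub>P\<^esub> g \<oplus>\<^bsub>P\<^esub> r"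
  shows "euclid f g"
proof -
  obtain r' g' u v t where k: "r' \<in> carrier P" "g' \<in> carrier P" "u \<in> carrier P" "v \<in> carrier P"
    and t: "t \<in> carrier R" "t \<noteq> \<zero>"
    and e: "r \<otimes>\<^bsub>P\<^esub> g' = g \<otimes>\<^bsub>P\<^esub> r'" "u \<otimes>\<^bsub>P\<^esub> r' \<oplus>\<^bsub>P\<^esub> v \<otimes>\<^bsub>P\<^esub> g' = cnst t"
    using E unfolding euclid_def by (elim exE conjE)
  define B where "B = cnst b"
  have B: "B \<in> carrier P" using b by (simp add: B_def)
  define f' g'' where "f' = r' \<oplus>\<^bsub>P\<^esub> q \<otimes>\<^bsub>P\<^esub> g'" and "g'' = B \<otimes>\<^bsub>P\<^esub> g'"
  have "f \<otimes>\<^bsub>P\<^esub> g'' = (B \<otimes>\<^bsub>P\<^esub> f) \<otimes>\<^bsub>P\<^esub> g'" unfolding g''_def using B c k by algebra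
  also have "\<dots> = q \<otimes>\<^bsub>P\<^esub> g \<otimes>\<^bsub>P\<^esub> g' \<oplus>\<^bsub>P\<^esub> r \<otimes>\<^bsub>P\<^esub> g'" unfolding B_def fr using c k by algebra
  also have "\<dots> = g \<otimes>\<^bsub>P\<^esub> f'" unfolding e(1) f'_def using c k by algebra
  finally have 1: "f \<otimes>\<^bsub>P\<^esub> g'' = g \<otimes>\<^bsub>P\<^esub> f'" .
  have "(u \<otimes>\<^bsub>P\<^esub> B) \<otimes>\<^bsub>P\<^esub> f' \<oplus>\<^bsub>P\<^esub> (v \<ominus>\<^bsub>P\<^esub> u \<otimes>\<^bsub>P\<^esub> q) \<otimes>\<^bsub>P\<^esub> g''
      = B \<otimes>\<^bsub>P\<^esub> (u \<otimes>\<^bsub>P\<^esub> r' \<oplus>\<^bsub>P\<^esub> v \<otimes>\<^bsub>P\<^esub> g')"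
    unfolding f'_def g''_def using B c k by algebra
  also have "\<dots> = cnst (b \<otimes> t)" unfolding e(2) B_def using b t by (simp add: cnst_mult)
  finally have 2: "(u \<otimes>\<^bsub>P\<^esub> B) \<otimes>\<^bsub>P\<^esub> f' \<oplus>\<^bsub>P\<^esub> (v \<ominus>\<^bsub>P\<^esub> u \<otimes>\<^bsub>P\<^esub> q) \<otimes>\<^bsub>P\<^esub> g'' = cnst (b \<otimes> t)" .
  have 3: "b \<otimes> t \<in> carrier R" "b \<otimes> t \<noteq> \<zero>" using b t by (auto simp: integral_iff)
  have 4: "f' \<in> carrier P" "g'' \<in> carrier P" "u \<otimes>\<^bsub>P\<^esub> B \<in> carrier P"
    "v \<ominus>\<^bsub>P\<^esub> u \<otimes>\<^bsub>P\<^esub> q \<in> carrier P" using B c k by (auto simp: f'_def g''_def)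
  show ?thesis unfolding euclid_def
    by (intro exI[of _ f'] exI[of _ g''] exI[of _ "u \<otimes>\<^bsub>P\<^esub> B"] exI[of _ "v \<ominus>\<^bsub>P\<^esub> u \<otimes>\<^bsub>P\<^esub> q"]
        exI[of _ "b \<otimes> t"] conjI) (fact 1 2 3 4)+
qed

lemma euclid_zero:
  assumes "g \<in> carrier P"
  shows "euclid \<zero>\<^bsub>P\<^esub> g"
  unfolding euclid_def
  by (intro exI[of _ "\<zero>\<^bsub>P\<^esub>"] exI[of _ "\<one>\<^bsub>P\<^esub>"] exI[of _ \<one>]) (use assms in simp)

text \<open>One step of pseudo-division: cross-multiplying with the coefficients \<open>a\<close>
  and \<open>b\<close> at the bounds cancels the term at \<open>i\<close> without inverting
  \<open>b\<close>.\<close>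

lemma euclid_reduce:
  assumes f: "f \<in> carrier P" "\<forall>m\<ge>Suc i. coeff P f m = \<zero>"
    and g: "g \<in> carrier P" "\<forall>m\<ge>Suc j. coeff P g m = \<zero>" and ji: "j \<le> i"
    and gj: "coeff P g j \<noteq> \<zero>"
    and IH: "\<And>r. r \<in> carrier P \<Longrightarrow> \<forall>m\<ge>i. coeff P r m = \<zero> \<Longrightarrow> euclid r g"
  shows "euclid f g"
proof -
  define a b where "a = coeff P f i" and "b = coeff P g j"
  have ab: "a \<in> carrier R" "b \<in> carrier R" using f g by (auto simp: a_def b_def)
  define q where "q = monom P a (i - j)"
  have q: "q \<in> carrier P" using ab by (simp add: q_def)
  define r where "r = cnst b \<otimes>\<^bsub>P\<^esub> f \<ominus>\<^bsub>P\<^esub> q \<otimes>\<^bsub>P\<^esub> g"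
  have r: "r \<in> carrier P" using q f g ab by (simp add: r_def)
  have "coeff P r m = \<zero>" if m: "m \<ge> i" for m
  proof -
    have "coeff P (q \<otimes>\<^bsub>P\<^esub> g) m = a \<otimes> coeff P g (m - (i - j))"
      using U.coeff_monom_mult[of a g "i - j" "m - (i - j)"] ab g m ji by (simp add: q_def)
    then have e: "coeff P r m = b \<otimes> coeff P f m \<ominus> a \<otimes> coeff P g (m - (i - j))"
      using q f g ab by (simp add: r_def del: U.coeff_mult)
    show ?thesis
    proof (cases "m = i")
      case True
      then have "coeff P r m = b \<otimes> a \<ominus> a \<otimes> b" using e ji by (simp add: a_def b_def)
      also have "\<dots> = \<zero>" using ab by algebra
      finally show ?thesis .
    next
      case False
      then have "coeff P f m = \<zero>" "coeff P g (m - (i - j)) = \<zero>" using m f g ji by auto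
      then show ?thesis using e ab by (simp add: minus_eq)
    qed
  qed
  then have E: "euclid r g" using IH r by blast
  have "cnst b \<in> carrier P" using ab by simp
  then have "cnst b \<otimes>\<^bsub>P\<^esub> f = q \<otimes>\<^bsub>P\<^esub> g \<oplus>\<^bsub>P\<^esub> r" unfolding r_def using q f(1) g(1) by algebra
  then show ?thesis using euclid_step[OF E f(1) g(1) q r ab(2)] gj by (simp add: b_def)
qed

text \<open>Induction on the sum of two bounds for the degrees: a vanishing coefficient at a bound
  lowers that bound directly, otherwise the polynomial with the larger bound is reduced by the
  other.\<close>

lemma euclid:
  assumes "f \<in> carrier P" "g \<in> carrier P"
  shows "euclid f g"
proof -
  have "euclid f g" if "f \<in> carrier P" "g \<in> carrier P" "\<forall>m\<ge>i. coeff P f m = \<zero>"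
    "\<forall>m\<ge>j. coeff P g m = \<zero>" for i j f g
    using that
  proof (induction "i + j" arbitrary: i j f g rule: less_induct)
    case less
    note fg = less.prems
    show ?case
    proof (cases i)
      case 0
      then have "f = \<zero>\<^bsub>P\<^esub>" using fg by (intro U.up_eqI) auto
      then show ?thesis using euclid_zero fg by simp
    next
      case i: (Suc i')
      show ?thesis
      proof (cases j)
        case 0
        then have "g = \<zero>\<^bsub>P\<^esub>" using fg by (intro U.up_eqI) auto
        then show ?thesis using euclid_zero[THEN euclid_sym] fg by simp
      next
        case j: (Suc j')
        consider "coeff P f i' = \<zero>" | "coeff P g j' = \<zero>"
          | "coeff P g j' \<noteq> \<zero>" "j' \<le> i'" | "coeff P f i' \<noteq> \<zero>" "i' \<le> j'" by linarith
        then show ?thesis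
        proof cases
          case 1
          then have "\<forall>m\<ge>i'. coeff P f m = \<zero>" using fg(3) i by (metis Suc_leI le_neq_implies_less)
          then show ?thesis using less.hyps[of i' j f g] fg i by simp
        next
          case 2
          then have "\<forall>m\<ge>j'. coeff P g m = \<zero>" using fg(4) j by (metis Suc_leI le_neq_implies_less)
          then show ?thesis using less.hyps[of i j' f g] fg j by simp
        next
          case 3
          show ?thesis
          proof (rule euclid_reduce)
            show "euclid r g" if "r \<in> carrier P" "\<forall>m\<ge>i'. coeff P r m = \<zero>" for r
              using less.hyps[of i' j r g] that fg i by simp
          qed (use fg i j 3 in auto)
        next
          case 4
          have "euclid g f"
          proof (rule euclid_reduce)
            show "euclid r f" if "r \<in> carrier P" "\<forall>m\<ge>j'. coeff P r m = \<zero>" for r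
              using less.hyps[of i j' f r] that fg j by (simp add: euclid_sym)
          qed (use fg i j 4 in auto)
          then show ?thesis by (rule euclid_sym)
        qed
      qed
    qed
  qed
  then show ?thesis using assms U.deg_aboveD
    by (metis Suc_le_lessD)
qed

end

section \<open>Division by contents and the passage to one more variable\<close>

context domain_at
begin

text \<open>The quotients of the coefficients by \<open>c\<close> form a polynomial: beyond the
  degree of \<open>f\<close> they are annihilated by \<open>c\<close> and hence zero.\<close>

lemma poly_quotient:
  assumes c: "c \<in> carrier R" "c \<noteq> \<zero>" and s: "s \<in> carrier R" and f: "f \<in> carrier P"
    and q: "\<And>k. \<exists>y\<in>carrier R. s \<otimes> coeff P f k = y \<otimes> c"
  obtains f1 where "f1 \<in> carrier P" "cnst s \<otimes>\<^bsub>P\<^esub> f = cnst c \<otimes>\<^bsub>P\<^esub> f1"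
    "\<And>k. s \<otimes> coeff P f k = coeff P f1 k \<otimes> c"
proof -
  obtain f1 where f1: "\<And>k. f1 k \<in> carrier R" "\<And>k. s \<otimes> coeff P f k = f1 k \<otimes> c"
    using q by metis
  have "f1 k = \<zero>" if "deg R f < k" for k
  proof -
    have "f1 k \<otimes> c = \<zero>" using f1(2)[of k] U.deg_aboveD[OF that f] s by simp
    then show ?thesis using integral_iff[OF f1(1) c(1)] c(2) by simp
  qed
  then have "f1 \<in> up R" using f1(1) by (intro mem_upI) auto
  then have c1: "f1 \<in> carrier P" and c2: "coeff P f1 k = f1 k" for k by (simp_all add: UP_def)
  have "cnst s \<otimes>\<^bsub>P\<^esub> f = cnst c \<otimes>\<^bsub>P\<^esub> f1"
  proof (rule U.up_eqI)
    show "coeff P (cnst s \<otimes>\<^bsub>P\<^esub> f) k = coeff P (cnst c \<otimes>\<^bsub>P\<^esub> f1) k" for k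
      using s f c c1 f1(2)[of k] f1(1)[of k] by (simp add: c2 m_comm del: U.coeff_mult)
  qed (use s f c c1 in auto)
  then show thesis using that[OF c1] f1(2) by (simp add: c2)
qed

text \<open>Indexed up to the degree, the set is finite and contains the coefficient at 0 even of
  the zero polynomial, as the content lemmas ask for a nonempty set.\<close>

definition "coef_set f = coeff P f ` {..deg R f}"

lemma finite_coef_set: "finite (coef_set f)" and coef_set_nonempty: "coef_set f \<noteq> {}"
  by (auto simp: coef_set_def)

lemma coef_set_carrier: "f \<in> carrier P \<Longrightarrow> coef_set f \<subseteq> carrier R"
  by (auto simp: coef_set_def)

lemma coeff_cases: "f \<in> carrier P \<Longrightarrow> coeff P f k \<in> coef_set f \<or> coeff P f k = \<zero>"
  using U.deg_aboveD[of f k] by (force simp: coef_set_def)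

lemma mult_quotients_eq:
  assumes "f \<in> carrier P" "g \<in> carrier P" "f1 \<in> carrier P" "g1 \<in> carrier P"
    and "s \<in> carrier R" "c \<in> carrier R" "c \<noteq> \<zero>"
    and "cnst s \<otimes>\<^bsub>P\<^esub> f = cnst c \<otimes>\<^bsub>P\<^esub> f1" "cnst s \<otimes>\<^bsub>P\<^esub> g = cnst c \<otimes>\<^bsub>P\<^esub> g1"
    and h: "h \<in> carrier P" "k \<in> carrier P" and eq: "h \<otimes>\<^bsub>P\<^esub> g = k \<otimes>\<^bsub>P\<^esub> f"
  shows "h \<otimes>\<^bsub>P\<^esub> g1 = k \<otimes>\<^bsub>P\<^esub> f1"
proof -
  define s' c' where "s' = cnst s" and "c' = cnst c"
  have sc: "s' \<in> carrier P" "c' \<in> carrier P" and c0: "c' \<noteq> \<zero>\<^bsub>P\<^esub>"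
    using assms(5-7) by (auto simp: s'_def c'_def cnst_eq_zero_iff)
  note e = assms(8,9)[folded s'_def c'_def]
  have "c' \<otimes>\<^bsub>P\<^esub> (h \<otimes>\<^bsub>P\<^esub> g1) = h \<otimes>\<^bsub>P\<^esub> (c' \<otimes>\<^bsub>P\<^esub> g1)" using sc assms(1-4) h by algebra
  also have "\<dots> = s' \<otimes>\<^bsub>P\<^esub> (h \<otimes>\<^bsub>P\<^esub> g)" unfolding e(2)[symmetric] using sc assms(1-4) h by algebra
  also have "\<dots> = k \<otimes>\<^bsub>P\<^esub> (s' \<otimes>\<^bsub>P\<^esub> f)" unfolding eq using sc assms(1-4) h by algebra
  also have "\<dots> = c' \<otimes>\<^bsub>P\<^esub> (k \<otimes>\<^bsub>P\<^esub> f1)" unfolding e(1) using sc assms(1-4) h by algebra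
  finally show ?thesis
    by (subst (asm) domain.m_lcancel[OF U.UP_domain c0 sc(2)]) (use assms h in auto)
qed

text \<open>Here \<open>f1\<close> and \<open>g1\<close> are the quotients by the local content
  \<open>c\<close> at \<open>p\<close>. Because \<open>c\<close> is itself a coefficient of
  \<open>f\<close> or \<open>g\<close>, one of the quotients has \<open>s\<close> as a coefficient,
  and \<open>s\<close> is outside \<open>p\<close>.\<close>

lemma prime_content:
  assumes ar: "arithmetical_at R S" and p: "primeideal p R" "p \<inter> S = {}"
    and f: "f \<in> carrier P" and g: "g \<in> carrier P" and nz: "f \<noteq> \<zero>\<^bsub>P\<^esub> \<or> g \<noteq> \<zero>\<^bsub>P\<^esub>"
  obtains s c f1 g1 where "s \<in> carrier R" "s \<notin> p" "c \<in> carrier R" "c \<noteq> \<zero>"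
    "f1 \<in> carrier P" "g1 \<in> carrier P"
    "cnst s \<otimes>\<^bsub>P\<^esub> f = cnst c \<otimes>\<^bsub>P\<^esub> f1" "cnst s \<otimes>\<^bsub>P\<^esub> g = cnst c \<otimes>\<^bsub>P\<^esub> g1"
    "\<exists>k. coeff P f1 k \<notin> p \<or> coeff P g1 k \<notin> p"
proof -
  interpret p: primeideal p R by (rule p)
  have "finite (coef_set f \<union> coef_set g)" "coef_set f \<union> coef_set g \<noteq> {}"
    "coef_set f \<union> coef_set g \<subseteq> carrier R"
    using finite_coef_set coef_set_nonempty coef_set_carrier f g by auto
  from arithmetical_at_prime_content[OF ar p this]
  obtain c s where c: "c \<in> coef_set f \<union> coef_set g" and s: "s \<in> carrier R" "s \<notin> p"
    and y: "\<forall>a\<in>coef_set f \<union> coef_set g. \<exists>y\<in>carrier R. s \<otimes> a = y \<otimes> c" by blast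
  have cc: "c \<in> carrier R" using c coef_set_carrier f g by blast
  have s0: "s \<noteq> \<zero>" using s p.zero_closed by blast
  have q: "\<exists>y\<in>carrier R. s \<otimes> coeff P h k = y \<otimes> c" if "h = f \<or> h = g" for h k
  proof -
    have h: "h \<in> carrier P" using that f g by blast
    have "coeff P h k \<in> coef_set f \<union> coef_set g \<or> coeff P h k = \<zero>"
      using coeff_cases[OF h, of k] that by auto
    then show ?thesis
    proof
      assume "coeff P h k = \<zero>"
      then show ?thesis using s cc by (intro bexI[of _ \<zero>]) auto
    qed (use y in blast)
  qed
  have c0: "c \<noteq> \<zero>"
  proof
    assume c: "c = \<zero>"
    have "coeff P h k = \<zero>" if "h = f \<or> h = g" for h k
    proof -
      have "coeff P h k \<in> carrier R" using that f g by auto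
      moreover have "s \<otimes> coeff P h k = \<zero>" using q[OF that, of k] c by auto
      ultimately show ?thesis using s0 s integral_iff by simp
    qed
    then have "f = \<zero>\<^bsub>P\<^esub>" "g = \<zero>\<^bsub>P\<^esub>" using f g by (auto intro: U.up_eqI)
    then show False using nz by blast
  qed
  obtain f1 where f1: "f1 \<in> carrier P" "cnst s \<otimes>\<^bsub>P\<^esub> f = cnst c \<otimes>\<^bsub>P\<^esub> f1"
    "\<And>k. s \<otimes> coeff P f k = coeff P f1 k \<otimes> c"
    by (rule poly_quotient[OF cc c0 s(1) f q]) auto
  obtain g1 where g1: "g1 \<in> carrier P" "cnst s \<otimes>\<^bsub>P\<^esub> g = cnst c \<otimes>\<^bsub>P\<^esub> g1"
    "\<And>k. s \<otimes> coeff P g k = coeff P g1 k \<otimes> c"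
    by (rule poly_quotient[OF cc c0 s(1) g q]) auto
  have "\<exists>k. coeff P f1 k = s \<or> coeff P g1 k = s"
  proof -
    obtain k where "c = coeff P f k \<or> c = coeff P g k" using c by (auto simp: coef_set_def)
    then have "s \<otimes> c = coeff P f1 k \<otimes> c \<or> s \<otimes> c = coeff P g1 k \<otimes> c"
      using f1(3)[of k] g1(3)[of k] by auto
    then show ?thesis using m_rcancel[OF c0 cc] s f1(1) g1(1) by force
  qed
  then have "\<exists>k. coeff P f1 k \<notin> p \<or> coeff P g1 k \<notin> p" using s(2) by blast
  then show thesis using that[OF s cc c0 f1(1) g1(1) f1(2) g1(2)] by blast
qed

text \<open>A failure yields a prime \<open>Q\<close> that contains every polynomial
  \<open>h\<close> with \<open>h f\<close> in \<open>(g)\<close> or \<open>h g\<close> in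
  \<open>(f)\<close>. Two such polynomials are produced that cannot lie together in
  \<open>Q\<close>: the quotients by the gcd over the field of fractions if \<open>Q\<close>
  contracts to zero, those by the local content otherwise.\<close>

theorem arithmetical_at_lead:
  assumes ar: "arithmetical_at R S" and D: "dim_le_one_at R S"
  shows "arithmetical_at P lead_in_S"
proof (rule arithmetical_atI, rule ccontr)
  fix f g assume f: "f \<in> carrier P" and g: "g \<in> carrier P"
  assume "\<not> (\<exists>p q x y. p \<in> carrier P \<and> q \<in> carrier P \<and> x \<in> carrier P \<and> y \<in> carrier P \<and>
      p \<oplus>\<^bsub>P\<^esub> q \<in> lead_in_S \<and> p \<otimes>\<^bsub>P\<^esub> f = x \<otimes>\<^bsub>P\<^esub> g \<and> q \<otimes>\<^bsub>P\<^esub> g = y \<otimes>\<^bsub>P\<^esub> f)"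
  then obtain Q where Q: "primeideal Q P" "Q \<inter> lead_in_S = {}"
    and Q1: "\<And>p x. p \<in> carrier P \<Longrightarrow> x \<in> carrier P \<Longrightarrow> p \<otimes>\<^bsub>P\<^esub> f = x \<otimes>\<^bsub>P\<^esub> g \<Longrightarrow> p \<in> Q"
    and Q2: "\<And>p x. p \<in> carrier P \<Longrightarrow> x \<in> carrier P \<Longrightarrow> p \<otimes>\<^bsub>P\<^esub> g = x \<otimes>\<^bsub>P\<^esub> f \<Longrightarrow> p \<in> Q"
    using cring.not_arithmetical_prime[OF U.UP_cring submonoid_lead f g] by blast
  interpret Q: primeideal Q P by (rule Q(1))
  show False
  proof (cases "contraction Q = {\<zero>}")
    case True
    obtain f' g' u v t where k: "f' \<in> carrier P" "g' \<in> carrier P" "u \<in> carrier P" "v \<in> carrier P"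
      and t: "t \<in> carrier R" "t \<noteq> \<zero>"
      and e: "f \<otimes>\<^bsub>P\<^esub> g' = g \<otimes>\<^bsub>P\<^esub> f'" "u \<otimes>\<^bsub>P\<^esub> f' \<oplus>\<^bsub>P\<^esub> v \<otimes>\<^bsub>P\<^esub> g' = cnst t"
      using euclid[OF f g] unfolding euclid_def by (elim exE conjE)
    have e': "g' \<otimes>\<^bsub>P\<^esub> f = f' \<otimes>\<^bsub>P\<^esub> g" using e(1) f g k by (simp add: U.P.m_comm)
    have "f' \<in> Q" by (rule Q2[OF k(1,2) e'[symmetric]])
    moreover have "g' \<in> Q" by (rule Q1[OF k(2,1) e'])
    ultimately have "u \<otimes>\<^bsub>P\<^esub> f' \<oplus>\<^bsub>P\<^esub> v \<otimes>\<^bsub>P\<^esub> g' \<in> Q"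
      using k by (intro Q.a_closed Q.I_l_closed)
    then have "t \<in> contraction Q" using e(2) t by (simp add: contraction_def)
    then show False using True t by blast
  next
    case False
    note pr = contraction_prime[OF Q(1)] contraction_disjoint[OF Q(2)]
    show False
    \<comment> \<open>A local content exists only if one of the polynomials is nonzero; for
      \<open>f = g = 0\<close> every polynomial is in the conductor, so \<open>Q\<close> would
      contain one.\<close>
    proof (cases "f = \<zero>\<^bsub>P\<^esub> \<and> g = \<zero>\<^bsub>P\<^esub>")
      case True
      then have "\<one>\<^bsub>P\<^esub> \<in> Q" using Q1[of "\<one>\<^bsub>P\<^esub>" "\<zero>\<^bsub>P\<^esub>"] by simp
      then show False using Q.one_imp_carrier Q.I_notcarr by blast
    next
      case nz: False
      obtain s c f1 g1 where s: "s \<in> carrier R" "s \<notin> contraction Q" and c: "c \<in> carrier R" "c \<noteq> \<zero>"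
        and k: "f1 \<in> carrier P" "g1 \<in> carrier P"
        and e: "cnst s \<otimes>\<^bsub>P\<^esub> f = cnst c \<otimes>\<^bsub>P\<^esub> f1" "cnst s \<otimes>\<^bsub>P\<^esub> g = cnst c \<otimes>\<^bsub>P\<^esub> g1"
        and ex: "\<exists>k. coeff P f1 k \<notin> contraction Q \<or> coeff P g1 k \<notin> contraction Q"
        by (rule prime_content[OF ar pr f g]) (use nz in blast)
      have "f \<otimes>\<^bsub>P\<^esub> g1 = g \<otimes>\<^bsub>P\<^esub> f1"
        by (rule mult_quotients_eq[OF f g k s(1) c e f g]) (use f g in \<open>simp add: U.P.m_comm\<close>)
      then have e': "g1 \<otimes>\<^bsub>P\<^esub> f = f1 \<otimes>\<^bsub>P\<^esub> g" using f g k by (simp add: U.P.m_comm)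
      have "f1 \<in> Q" by (rule Q2[OF k(1,2) e'[symmetric]])
      moreover have "g1 \<in> Q" by (rule Q1[OF k(2,1) e'])
      ultimately show False
        using ex coeffs_in_prime[OF D pr(1) False Q.is_ideal Q(2) contractionD(2)] by blast
    qed
  qed
qed

text \<open>A failure yields nonzero primes \<open>Q1 \<subset> Q2\<close> that miss
  \<open>lead_in_S\<close>. If \<open>Q1\<close> has a nonzero contraction, the elements of
  \<open>Q2\<close> have their coefficients in it and lie in \<open>Q1\<close>. Otherwise
  \<open>Q2\<close> is shown to contract to nonzero, and a polynomial of least degree in
  \<open>Q1\<close>, divided by its content at that contraction, gives the contradiction.\<close>

theorem dim_le_one_at_lead:
  assumes ar: "arithmetical_at R S" and D: "dim_le_one_at R S"
  shows "dim_le_one_at P lead_in_S"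
proof (rule ccontr)
  assume nD: "\<not> dim_le_one_at P lead_in_S"
  obtain a Q1 Q2 where a: "a \<in> Q1" "a \<noteq> \<zero>\<^bsub>P\<^esub>" and Q: "primeideal Q1 P" "primeideal Q2 P"
    and Q12: "Q1 \<subset> Q2" and dis: "Q1 \<inter> lead_in_S = {}" "Q2 \<inter> lead_in_S = {}"
    by (rule cring.not_dim_le_one_primes[OF U.UP_cring submonoid_lead nD])
  interpret Q1: primeideal Q1 P by (rule Q)
  interpret Q2: primeideal Q2 P by (rule Q)
  note p1 = contraction_prime[OF Q(1)] contraction_disjoint[OF dis(1)]
  note p2 = contraction_prime[OF Q(2)] contraction_disjoint[OF dis(2)]
  obtain g where g: "g \<in> Q2" "g \<notin> Q1" using Q12 by blast
  have gc: "g \<in> carrier P" using g Q2.Icarr by blast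
  show False
  proof (cases "contraction Q1 = {\<zero>}")
    case False
    have "cnst a \<in> Q2" if "a \<in> contraction Q1" for a using contractionD(2)[OF that] Q12 by blast
    \<comment> \<open>The lemma is applied to the larger ideal \<open>Q2\<close> with the
      contraction of the smaller one.\<close>
    then have "coeff P g k \<in> contraction Q1" for k
      by (rule coeffs_in_prime[OF D p1(1) False Q2.is_ideal dis(2) _ g(1)])
    then have "g \<in> Q1"
      by (intro mem_ideal_if_coeffs[OF Q1.is_ideal gc] contractionD(2))
    then show False using g by blast
  next
    case True
    define f where "f = (ARG_MIN (deg R) f. f \<in> Q1 \<and> f \<noteq> \<zero>\<^bsub>P\<^esub>)"
    have f: "f \<in> Q1" "f \<noteq> \<zero>\<^bsub>P\<^esub>" and fmin: "\<And>h. h \<in> Q1 \<Longrightarrow> h \<noteq> \<zero>\<^bsub>P\<^esub> \<Longrightarrow> deg R f \<le> deg R h"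
      using arg_min_nat_lemma[of "\<lambda>f. f \<in> Q1 \<and> f \<noteq> \<zero>\<^bsub>P\<^esub>" a "deg R"] a
      unfolding f_def by auto
    have fc: "f \<in> carrier P" using f Q1.Icarr by blast
    have cQ1: "cnst c \<notin> Q1" if "c \<in> carrier R" "c \<noteq> \<zero>" for c
      using True that by (auto simp: contraction_def)
    obtain f' g' u v t where k: "f' \<in> carrier P" "g' \<in> carrier P" "u \<in> carrier P" "v \<in> carrier P"
      and t: "t \<in> carrier R" "t \<noteq> \<zero>"
      and e: "f \<otimes>\<^bsub>P\<^esub> g' = g \<otimes>\<^bsub>P\<^esub> f'" "u \<otimes>\<^bsub>P\<^esub> f' \<oplus>\<^bsub>P\<^esub> v \<otimes>\<^bsub>P\<^esub> g' = cnst t"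
      using euclid[OF fc gc] unfolding euclid_def by (elim exE conjE)
    have "g \<otimes>\<^bsub>P\<^esub> f' \<in> Q1" using Q1.I_r_closed[OF f(1) k(2)] e(1) by simp
    then have f'Q: "f' \<in> Q1" using Q1.I_prime[OF gc k(1)] g by blast
    \<comment> \<open>\<open>d\<close> is a gcd of \<open>f\<close> and \<open>g\<close> up to the
      constant \<open>t\<close>. As \<open>f'\<close> is in \<open>Q1\<close>, its degree is at
      least that of \<open>f\<close>, which forces \<open>d\<close> to be a constant; it is nonzero
      and lies in \<open>Q2\<close>.\<close>
    define d where "d = u \<otimes>\<^bsub>P\<^esub> f \<oplus>\<^bsub>P\<^esub> v \<otimes>\<^bsub>P\<^esub> g"
    have dc: "d \<in> carrier P" using k fc gc by (simp add: d_def)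
    have "u \<otimes>\<^bsub>P\<^esub> f \<in> Q2" "v \<otimes>\<^bsub>P\<^esub> g \<in> Q2"
      using f(1) g(1) Q12 k by (auto intro: Q2.I_l_closed)
    then have dQ: "d \<in> Q2" unfolding d_def by (rule Q2.a_closed)
    have "d \<otimes>\<^bsub>P\<^esub> f' = f \<otimes>\<^bsub>P\<^esub> (u \<otimes>\<^bsub>P\<^esub> f') \<oplus>\<^bsub>P\<^esub> v \<otimes>\<^bsub>P\<^esub> (g \<otimes>\<^bsub>P\<^esub> f')"
      unfolding d_def using k fc gc by algebra
    also have "\<dots> = f \<otimes>\<^bsub>P\<^esub> (u \<otimes>\<^bsub>P\<^esub> f' \<oplus>\<^bsub>P\<^esub> v \<otimes>\<^bsub>P\<^esub> g')"
      unfolding e(1)[symmetric] using k fc gc by algebra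
    finally have df: "d \<otimes>\<^bsub>P\<^esub> f' = f \<otimes>\<^bsub>P\<^esub> cnst t" unfolding e(2) .
    have tnz: "cnst t \<noteq> \<zero>\<^bsub>P\<^esub>" "cnst t \<in> carrier P" using t by (auto simp: cnst_eq_zero_iff)
    have "f \<otimes>\<^bsub>P\<^esub> cnst t \<noteq> \<zero>\<^bsub>P\<^esub>"
      using domain.integral_iff[OF U.UP_domain fc tnz(2)] f(2) tnz by blast
    then have nz: "d \<noteq> \<zero>\<^bsub>P\<^esub>" "f' \<noteq> \<zero>\<^bsub>P\<^esub>"
      using df k dc by auto
    have "deg R d + deg R f' = deg R f"
      using arg_cong[OF df, of "deg R"] U.deg_mult[OF nz dc k(1)] U.deg_mult[OF f(2) tnz(1) fc tnz(2)] t
      by simp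
    then have "deg R d = 0" using fmin[OF f'Q nz(2)] by simp
    then have d0: "d = cnst (coeff P d 0)" by (rule U.deg_zero_impl_monom[OF dc])
    then have "coeff P d 0 \<in> contraction Q2" using dQ dc by (simp add: contraction_def)
    moreover have "coeff P d 0 \<noteq> \<zero>" using d0 nz(1) by (metis U.monom_zero)
    ultimately have p2nz: "contraction Q2 \<noteq> {\<zero>}" by blast
    \<comment> \<open>With \<open>f\<close> in both places the lemma divides a single polynomial by
      its content. The quotients stay in \<open>Q1\<close>, since the nonzero constant
      \<open>c\<close> is not in \<open>Q1\<close>, yet one of them has a coefficient outside the
      contraction of \<open>Q2\<close>.\<close>
    obtain s c f1 g1 where s: "s \<in> carrier R" "s \<notin> contraction Q2" and c: "c \<in> carrier R" "c \<noteq> \<zero>"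
      and k1: "f1 \<in> carrier P" "g1 \<in> carrier P"
      and e1: "cnst s \<otimes>\<^bsub>P\<^esub> f = cnst c \<otimes>\<^bsub>P\<^esub> f1" "cnst s \<otimes>\<^bsub>P\<^esub> f = cnst c \<otimes>\<^bsub>P\<^esub> g1"
      and ex: "\<exists>k. coeff P f1 k \<notin> contraction Q2 \<or> coeff P g1 k \<notin> contraction Q2"
      by (rule prime_content[OF ar p2 fc fc]) (use f in blast)
    have mem: "h \<in> Q1" if "h \<in> carrier P" "cnst s \<otimes>\<^bsub>P\<^esub> f = cnst c \<otimes>\<^bsub>P\<^esub> h" for h
    proof -
      have "cnst s \<otimes>\<^bsub>P\<^esub> f \<in> Q1" using Q1.I_l_closed[OF f(1)] s by simp
      then have "cnst c \<otimes>\<^bsub>P\<^esub> h \<in> Q1" using that by simp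
      then show ?thesis
        using Q1.I_prime[OF U.monom_closed[OF c(1)] that(1)] cQ1[OF c] by blast
    qed
    have "f1 \<in> Q2" "g1 \<in> Q2" using mem k1 e1 Q12 by blast+
    then show False
      using ex coeffs_in_prime[OF D p2(1) p2nz Q2.is_ideal dis(2) contractionD(2)] by blast
  qed
qed

text \<open>The gcd over the field of fractions gives \<open>f'\<close> and \<open>g'\<close>, and
  dividing them by their content gives \<open>f1\<close> and \<open>g1\<close> with the same
  proportion. The ideal of \<open>f1\<close> and \<open>g1\<close> contains a nonzero constant and
  has trivial content up to \<open>S\<close>, so no prime that misses \<open>lead_in_S\<close>
  contains it.\<close>

theorem bezout_at_lead:
  assumes bz: "bezout_at R S" and D: "dim_le_one_at R S"
  shows "bezout_at P lead_in_S"
proof (rule bezout_atI)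
  fix f g assume f: "f \<in> carrier P" and g: "g \<in> carrier P"
  obtain f' g' u v t where k: "f' \<in> carrier P" "g' \<in> carrier P" "u \<in> carrier P" "v \<in> carrier P"
    and t: "t \<in> carrier R" "t \<noteq> \<zero>"
    and e: "f \<otimes>\<^bsub>P\<^esub> g' = g \<otimes>\<^bsub>P\<^esub> f'" "u \<otimes>\<^bsub>P\<^esub> f' \<oplus>\<^bsub>P\<^esub> v \<otimes>\<^bsub>P\<^esub> g' = cnst t"
    using euclid[OF f g] unfolding euclid_def by (elim exE conjE)
  have "finite (coef_set f' \<union> coef_set g')" "coef_set f' \<union> coef_set g' \<noteq> {}"
    "coef_set f' \<union> coef_set g' \<subseteq> carrier R"
    using finite_coef_set coef_set_nonempty coef_set_carrier k by auto
  from bezout_at_content[OF bz S this]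
  obtain c s Y where cc: "c \<in> carrier R" and sS: "s \<in> S"
    and Y: "\<forall>a\<in>coef_set f' \<union> coef_set g'. Y a \<in> carrier R \<and> s \<otimes> a = Y a \<otimes> c"
    and Yp: "\<forall>p. primeideal p R \<and> p \<inter> S = {} \<longrightarrow> (\<exists>a\<in>coef_set f' \<union> coef_set g'. Y a \<notin> p)"
    by (elim bexE exE conjE) (rule that)
  have s: "s \<in> carrier R" "s \<noteq> \<zero>" using sS S_carr zero_notin_S by auto
  have q: "\<exists>y\<in>carrier R. s \<otimes> coeff P h k = y \<otimes> c" if "h = f' \<or> h = g'" for h k
  proof -
    have h: "h \<in> carrier P" using that k by blast
    have "coeff P h k \<in> coef_set f' \<union> coef_set g' \<or> coeff P h k = \<zero>"
      using coeff_cases[OF h, of k] that by auto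
    then show ?thesis
    proof
      assume "coeff P h k = \<zero>"
      then show ?thesis using s cc by (intro bexI[of _ \<zero>]) auto
    qed (use Y in blast)
  qed
  have tnz: "cnst t \<noteq> \<zero>\<^bsub>P\<^esub>" "cnst t \<in> carrier P" using t by (auto simp: cnst_eq_zero_iff)
  have c0: "c \<noteq> \<zero>"
  proof
    assume c: "c = \<zero>"
    have "coeff P h k = \<zero>" if "h = f' \<or> h = g'" for h k
    proof -
      have "coeff P h k \<in> carrier R" using that k by auto
      moreover have "s \<otimes> coeff P h k = \<zero>" using q[OF that, of k] c by auto
      ultimately show ?thesis using s integral_iff by simp
    qed
    then have "f' = \<zero>\<^bsub>P\<^esub>" "g' = \<zero>\<^bsub>P\<^esub>" using k by (auto intro: U.up_eqI)
    then show False using e(2) k tnz by simp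
  qed
  obtain f1 where f1: "f1 \<in> carrier P" "cnst s \<otimes>\<^bsub>P\<^esub> f' = cnst c \<otimes>\<^bsub>P\<^esub> f1"
    "\<And>k. s \<otimes> coeff P f' k = coeff P f1 k \<otimes> c"
    by (rule poly_quotient[OF cc c0 s(1) k(1) q]) auto
  obtain g1 where g1: "g1 \<in> carrier P" "cnst s \<otimes>\<^bsub>P\<^esub> g' = cnst c \<otimes>\<^bsub>P\<^esub> g1"
    "\<And>k. s \<otimes> coeff P g' k = coeff P g1 k \<otimes> c"
    by (rule poly_quotient[OF cc c0 s(1) k(2) q]) auto
  have fg1: "f \<otimes>\<^bsub>P\<^esub> g1 = g \<otimes>\<^bsub>P\<^esub> f1"
    by (rule mult_quotients_eq[OF k(1,2) f1(1) g1(1) s(1) cc c0 f1(2) g1(2) f g e(1)])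
  \<comment> \<open>Up to the factor \<open>c\<close> the combination \<open>w\<close> is the
    constant \<open>s t\<close>; cancelling \<open>c\<close> coefficientwise shows that
    \<open>w\<close> is a nonzero constant, so a prime above \<open>f1\<close> and \<open>g1\<close>
    contracts to nonzero.\<close>
  define w where "w = u \<otimes>\<^bsub>P\<^esub> f1 \<oplus>\<^bsub>P\<^esub> v \<otimes>\<^bsub>P\<^esub> g1"
  have wc: "w \<in> carrier P" using k f1 g1 by (simp add: w_def)
  have "cnst c \<in> carrier P" "cnst s \<in> carrier P" using cc s by auto
  note kk = k f1(1) g1(1) this
  have "cnst c \<otimes>\<^bsub>P\<^esub> w = u \<otimes>\<^bsub>P\<^esub> (cnst c \<otimes>\<^bsub>P\<^esub> f1) \<oplus>\<^bsub>P\<^esub> v \<otimes>\<^bsub>P\<^esub> (cnst c \<otimes>\<^bsub>P\<^esub> g1)"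
    unfolding w_def using kk by algebra
  also have "\<dots> = cnst s \<otimes>\<^bsub>P\<^esub> (u \<otimes>\<^bsub>P\<^esub> f' \<oplus>\<^bsub>P\<^esub> v \<otimes>\<^bsub>P\<^esub> g')"
    unfolding f1(2)[symmetric] g1(2)[symmetric] using kk by algebra
  also have "\<dots> = cnst (s \<otimes> t)" unfolding e(2) using s t by (simp add: cnst_mult)
  finally have cw: "cnst c \<otimes>\<^bsub>P\<^esub> w = cnst (s \<otimes> t)" .
  have cw': "c \<otimes> coeff P w m = (if m = 0 then s \<otimes> t else \<zero>)" for m
    using arg_cong[OF cw, of "\<lambda>h. coeff P h m"] cc wc s t by (simp del: U.coeff_mult)
  have "coeff P w m = \<zero>" if "m \<noteq> 0" for m
    using cw'[of m] that integral_iff[OF cc U.coeff_closed[OF wc]] c0 by simp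
  then have w0: "w = cnst (coeff P w 0)"
    using wc by (intro U.up_eqI) auto
  have "s \<otimes> t \<noteq> \<zero>" using s t integral_iff[OF s(1) t(1)] by simp
  then have w0nz: "coeff P w 0 \<noteq> \<zero>"
    using cw'[of 0] cc by auto
  define I where "I = {x \<otimes>\<^bsub>P\<^esub> f1 \<oplus>\<^bsub>P\<^esub> y \<otimes>\<^bsub>P\<^esub> g1 | x y. x \<in> carrier P \<and> y \<in> carrier P}"
  have I: "ideal I P" unfolding I_def by (rule cring.ideal_pair[OF U.UP_cring f1(1) g1(1)])
  have "I \<inter> lead_in_S \<noteq> {}"
  proof
    assume "I \<inter> lead_in_S = {}"
    then obtain Q where Q: "primeideal Q P" "I \<subseteq> Q" "Q \<inter> lead_in_S = {}"
      using cring.exists_prime_ideal_disjoint[OF U.UP_cring I submonoid_lead] by blast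
    interpret Q: primeideal Q P by (rule Q(1))
    note pr = contraction_prime[OF Q(1)] contraction_disjoint[OF Q(3)]
    have "w \<in> Q" using Q(2) k unfolding I_def w_def by blast
    then have "coeff P w 0 \<in> contraction Q" using w0 wc by (simp add: contraction_def)
    then have nz: "contraction Q \<noteq> {\<zero>}" using w0nz by blast
    have "\<one>\<^bsub>P\<^esub> \<otimes>\<^bsub>P\<^esub> f1 \<oplus>\<^bsub>P\<^esub> \<zero>\<^bsub>P\<^esub> \<otimes>\<^bsub>P\<^esub> g1 \<in> Q" "\<zero>\<^bsub>P\<^esub> \<otimes>\<^bsub>P\<^esub> f1 \<oplus>\<^bsub>P\<^esub> \<one>\<^bsub>P\<^esub> \<otimes>\<^bsub>P\<^esub> g1 \<in> Q"
      using Q(2) U.UP_one_closed U.UP_zero_closed unfolding I_def by blast+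
    then have "f1 \<in> Q" "g1 \<in> Q" using f1(1) g1(1) by simp_all
    then have in_p: "coeff P f1 m \<in> contraction Q" "coeff P g1 m \<in> contraction Q" for m
      using coeffs_in_prime[OF D pr(1) nz Q.is_ideal Q(3) contractionD(2)] by blast+
    obtain a where a: "a \<in> coef_set f' \<union> coef_set g'" "Y a \<notin> contraction Q" using Yp pr by blast
    then obtain m where m: "a = coeff P f' m \<or> a = coeff P g' m" by (auto simp: coef_set_def)
    have "Y a \<in> carrier R" "s \<otimes> a = Y a \<otimes> c" using Y a by auto
    then have "Y a \<otimes> c = coeff P f1 m \<otimes> c \<or> Y a \<otimes> c = coeff P g1 m \<otimes> c"
      using m f1(3)[of m] g1(3)[of m] by auto
    then have "Y a = coeff P f1 m \<or> Y a = coeff P g1 m"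
      using m_rcancel[OF c0 cc \<open>Y a \<in> carrier R\<close> U.coeff_closed[OF f1(1)]]
        m_rcancel[OF c0 cc \<open>Y a \<in> carrier R\<close> U.coeff_closed[OF g1(1)]] by blast
    then show False using in_p a(2) by auto
  qed
  then obtain x y where "x \<in> carrier P" "y \<in> carrier P" "x \<otimes>\<^bsub>P\<^esub> f1 \<oplus>\<^bsub>P\<^esub> y \<otimes>\<^bsub>P\<^esub> g1 \<in> lead_in_S"
    unfolding I_def by blast
  then show "\<exists>x y u v. x \<in> carrier P \<and> y \<in> carrier P \<and> u \<in> carrier P \<and> v \<in> carrier P \<and>
      f \<otimes>\<^bsub>P\<^esub> y = g \<otimes>\<^bsub>P\<^esub> x \<and> u \<otimes>\<^bsub>P\<^esub> x \<oplus>\<^bsub>P\<^esub> v \<otimes>\<^bsub>P\<^esub> y \<in> lead_in_S"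
    using fg1 f1(1) g1(1) by (intro exI[of _ f1] exI[of _ g1] exI[of _ x] exI[of _ y]) simp
qed

end

section \<open>Polynomials in several variables as iterated univariate polynomials\<close>

definition splits :: "nat \<Rightarrow> nat vec \<Rightarrow> (nat vec \<times> nat vec) set" where
  "splits n e = {(d, d'). d \<in> carrier_vec n \<and> d' \<in> carrier_vec n \<and> d + d' = e}"

lemma finite_vecs_le: "finite {d \<in> carrier_vec n. \<forall>i<n. d $ i \<le> (N::nat)}"
proof (rule finite_subset)
  let ?L = "{xs. set xs \<subseteq> {..N} \<and> length xs = n}"
  show "{d \<in> carrier_vec n. \<forall>i<n. d $ i \<le> N} \<subseteq> vec_of_list ` ?L"
  proof
    fix d assume d: "d \<in> {d \<in> carrier_vec n. \<forall>i<n. d $ i \<le> N}"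
    then have "list_of_vec d \<in> ?L"
      by (auto simp: in_set_conv_nth list_of_vec_index)
    moreover have "d = vec_of_list (list_of_vec d)" by (simp add: vec_list)
    ultimately show "d \<in> vec_of_list ` ?L" by blast
  qed
  show "finite (vec_of_list ` ?L)" by (intro finite_imageI finite_lists_length_eq) auto
qed

lemma finite_splits [simp]: "finite (splits n e)"
proof (cases "e \<in> carrier_vec n")
  case True
  define N where "N = Max (insert 0 ((\<lambda>i. e $ i) ` {..<n}))"
  have N: "e $ i \<le> N" if "i < n" for i using that unfolding N_def by (intro Max_ge) auto
  let ?V = "{d \<in> carrier_vec n. \<forall>i<n. d $ i \<le> N}"
  have "splits n e \<subseteq> ?V \<times> ?V"
  proof (clarsimp simp: splits_def)
    fix a b :: "nat vec" assume ab: "a \<in> carrier_vec n" "b \<in> carrier_vec n" "e = a + b"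
    have "a $ i + b $ i \<le> N" if "i < n" for i using N[OF that] ab that by simp
    then show "(\<forall>i<n. a $ i \<le> N) \<and> (\<forall>i<n. b $ i \<le> N)" by (meson add_leD1 add_leD2)
  qed
  then show ?thesis using finite_vecs_le finite_subset by blast
next
  case False
  then have "splits n e = {}" unfolding splits_def by auto
  then show ?thesis by simp
qed

lemma carrier_vec_SucE:
  assumes "e \<in> carrier_vec (Suc n)"
  obtains k d where "d \<in> carrier_vec n" "e = vCons k d"
  using assms by (cases e) auto

lemma vCons_add: "dim_vec v = dim_vec w \<Longrightarrow> vCons a v + vCons b w = vCons (a + b) (v + w)"
  by (rule eq_vecI) (auto simp: vec_index_vCons)

definition vtail :: "nat vec \<Rightarrow> nat vec" where
  "vtail v = vec (dim_vec v - 1) (\<lambda>i. v $ Suc i)"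

lemma vtail_vCons [simp]: "vtail (vCons a v) = v"
  by (rule eq_vecI) (auto simp: vtail_def)

lemma splits_vCons:
  assumes "d \<in> carrier_vec n"
  shows "splits (Suc n) (vCons k d) =
    (\<Union>i\<in>{..k}. (\<lambda>(x, y). (vCons i x, vCons (k - i) y)) ` splits n d)"
proof (intro equalityI subsetI)
  fix z assume "z \<in> splits (Suc n) (vCons k d)"
  then obtain a b where *: "z = (a, b)" "a \<in> carrier_vec (Suc n)" "b \<in> carrier_vec (Suc n)"
    "a + b = vCons k d"
    by (auto simp: splits_def)
  obtain i x where a: "x \<in> carrier_vec n" "a = vCons i x" by (rule carrier_vec_SucE[OF *(2)])
  obtain j y where b: "y \<in> carrier_vec n" "b = vCons j y" by (rule carrier_vec_SucE[OF *(3)])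
  have "dim_vec x = dim_vec y" using a b by simp
  then have "i + j = k" "x + y = d" using *(4) a b by (auto simp: vCons_add)
  then have "i \<in> {..k}" "z = (vCons i x, vCons (k - i) y)" "(x, y) \<in> splits n d"
    using *(1) a b by (auto simp: splits_def)
  then show "z \<in> (\<Union>i\<in>{..k}. (\<lambda>(x, y). (vCons i x, vCons (k - i) y)) ` splits n d)"
    by force
next
  fix z assume "z \<in> (\<Union>i\<in>{..k}. (\<lambda>(x, y). (vCons i x, vCons (k - i) y)) ` splits n d)"
  then obtain i x y where "i \<le> k" "(x, y) \<in> splits n d" "z = (vCons i x, vCons (k - i) y)"
    by auto
  then show "z \<in> splits (Suc n) (vCons k d)"
    by (auto simp: splits_def vCons_add)
qed

section \<open>The polynomial ring and the adjunction of one variable\<close>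

context cring
begin

abbreviation MP where "MP n \<equiv> mpoly_ring R n"

lemma mpoly_carrierI:
  assumes "\<And>e. e \<in> carrier_vec n \<Longrightarrow> p e \<in> carrier R" "\<And>e. e \<notin> carrier_vec n \<Longrightarrow> p e = \<zero>"
    and "finite {e. p e \<noteq> \<zero>}"
  shows "p \<in> carrier (MP n)"
  using assms by (simp add: mpoly_ring_def)

lemma mpoly_coeff: "p \<in> carrier (MP n) \<Longrightarrow> p e \<in> carrier R"
  by (cases "e \<in> carrier_vec n") (auto simp: mpoly_ring_def)

lemma mpoly_outside: "p \<in> carrier (MP n) \<Longrightarrow> e \<notin> carrier_vec n \<Longrightarrow> p e = \<zero>"
  by (simp add: mpoly_ring_def)

lemma mpoly_finite: "p \<in> carrier (MP n) \<Longrightarrow> finite {e. p e \<noteq> \<zero>}"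
  by (simp add: mpoly_ring_def)

lemma mpoly_mult:
  assumes "e \<in> carrier_vec n"
  shows "(p \<otimes>\<^bsub>MP n\<^esub> q) e = (finsum R (\<lambda>(d, d'). p d \<otimes> q d') (splits n e))"
  using assms by (simp add: mpoly_ring_def splits_def)

lemma mpoly_mult_outside: "e \<notin> carrier_vec n \<Longrightarrow> (p \<otimes>\<^bsub>MP n\<^esub> q) e = \<zero>"
  by (simp add: mpoly_ring_def)

lemma mpoly_add:
  "p \<in> carrier (MP n) \<Longrightarrow> q \<in> carrier (MP n) \<Longrightarrow> (p \<oplus>\<^bsub>MP n\<^esub> q) e = p e \<oplus> q e"
  by (cases "e \<in> carrier_vec n") (auto simp: mpoly_ring_def)

lemma mpoly_zero: "\<zero>\<^bsub>MP n\<^esub> = (\<lambda>e. \<zero>)" by (simp add: mpoly_ring_def)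

lemma mpoly_one: "\<one>\<^bsub>MP n\<^esub> = (\<lambda>e. if e = 0\<^sub>v n then \<one> else \<zero>)" by (simp add: mpoly_ring_def)

definition mpoly_const :: "nat \<Rightarrow> 'a \<Rightarrow> nat vec \<Rightarrow> 'a" where
  "mpoly_const n a = (\<lambda>e. if e = 0\<^sub>v n then a else \<zero>)"

lemma mpoly_const_closed: "a \<in> carrier R \<Longrightarrow> mpoly_const n a \<in> carrier (MP n)"
  by (rule mpoly_carrierI) (auto simp: mpoly_const_def)

lemma carrier_vec_0: "carrier_vec 0 = {0\<^sub>v 0 :: nat vec}"
  by auto

lemma mpoly_const_iso: "mpoly_const 0 \<in> ring_iso R (MP 0)"
proof (rule ring_iso_memI)
  show "mpoly_const 0 x \<in> carrier (MP 0)" if "x \<in> carrier R" for x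
    by (rule mpoly_const_closed[OF that])
  have sp: "splits 0 (0\<^sub>v 0) = {(0\<^sub>v 0, 0\<^sub>v 0)}"
    by (auto simp: splits_def)
  show "mpoly_const 0 (x \<otimes> y) = mpoly_const 0 x \<otimes>\<^bsub>MP 0\<^esub> mpoly_const 0 y"
    if "x \<in> carrier R" "y \<in> carrier R" for x y
  proof
    fix e
    show "mpoly_const 0 (x \<otimes> y) e = (mpoly_const 0 x \<otimes>\<^bsub>MP 0\<^esub> mpoly_const 0 y) e"
    proof (cases "e \<in> carrier_vec 0")
      case True
      then have "e = 0\<^sub>v 0" by auto
      then show ?thesis using that sp by (simp add: mpoly_mult mpoly_const_def)
    next
      case False
      then show ?thesis by (auto simp: mpoly_mult_outside mpoly_const_def)
    qed
  qed
  show "mpoly_const 0 (x \<oplus> y) = mpoly_const 0 x \<oplus>\<^bsub>MP 0\<^esub> mpoly_const 0 y"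
    if "x \<in> carrier R" "y \<in> carrier R" for x y
    by (rule ext) (use that in \<open>simp add: mpoly_add mpoly_const_closed, simp add: mpoly_const_def\<close>)
  show "mpoly_const 0 \<one> = \<one>\<^bsub>MP 0\<^esub>"
    by (auto simp: mpoly_const_def mpoly_one)
  show "bij_betw (mpoly_const 0) (carrier R) (carrier (MP 0))"
  proof (rule bij_betw_imageI)
    show "inj_on (mpoly_const 0) (carrier R)"
      by (rule inj_onI) (auto simp: mpoly_const_def dest: fun_cong[of _ _ "0\<^sub>v 0"])
    show "mpoly_const 0 ` carrier R = carrier (MP 0)"
    proof safe
      fix p assume p: "p \<in> carrier (MP 0)"
      have "p = mpoly_const 0 (p (0\<^sub>v 0))"
      proof
        fix e show "p e = mpoly_const 0 (p (0\<^sub>v 0)) e"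
          using mpoly_outside[OF p, of e] carrier_vec_0 by (auto simp: mpoly_const_def)
      qed
      then show "p \<in> mpoly_const 0 ` carrier R" by (rule image_eqI) (rule mpoly_coeff[OF p])
    qed (rule mpoly_const_closed)
  qed
qed

text \<open>The univariate variable becomes the first one. This is the entry that the lexicographic
  order compares first, so iterated leading coefficients are lexicographic ones.\<close>

definition mpoly_of_UP :: "nat \<Rightarrow> (nat \<Rightarrow> nat vec \<Rightarrow> 'a) \<Rightarrow> nat vec \<Rightarrow> 'a" where
  "mpoly_of_UP n F = (\<lambda>e. if e \<in> carrier_vec (Suc n) then F (e $ 0) (vtail e) else \<zero>)"

lemma mpoly_of_UP_vCons [simp]: "d \<in> carrier_vec n \<Longrightarrow> mpoly_of_UP n F (vCons k d) = F k d"
  by (simp add: mpoly_of_UP_def)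

lemma mpoly_of_UP_outside [simp]: "e \<notin> carrier_vec (Suc n) \<Longrightarrow> mpoly_of_UP n F e = \<zero>"
  by (simp add: mpoly_of_UP_def)

lemma mpoly_eqI:
  assumes "\<And>k d. d \<in> carrier_vec n \<Longrightarrow> p (vCons k d) = q (vCons k d)"
    and "\<And>e. e \<notin> carrier_vec (Suc n) \<Longrightarrow> p e = q e"
  shows "p = q"
proof
  fix e show "p e = q e"
    by (cases "e \<in> carrier_vec (Suc n)") (use assms in \<open>auto elim: carrier_vec_SucE\<close>)
qed

lemma finsum_mpoly:
  assumes "cring (MP n)" "finite A" "\<And>i. i \<in> A \<Longrightarrow> f i \<in> carrier (MP n)"
  shows "finsum (MP n) f A d = (\<Oplus>i\<in>A. f i d)"
proof -
  interpret M: cring "MP n" by (rule assms(1))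
  show ?thesis
    using assms(2,3)
  proof (induction A)
    case empty
    then show ?case by (simp add: mpoly_zero)
  next
    case (insert i A)
    have 1: "finsum (MP n) f A \<in> carrier (MP n)" "f i \<in> carrier (MP n)"
      using insert.prems by (auto intro: M.finsum_closed)
    have 2: "(\<lambda>i. f i d) \<in> A \<rightarrow> carrier R" "f i d \<in> carrier R"
      using insert.prems by (auto intro: mpoly_coeff)
    have "finsum (MP n) f (insert i A) d = (f i \<oplus>\<^bsub>MP n\<^esub> finsum (MP n) f A) d"
      by (subst M.finsum_insert) (use insert in auto)
    also have "\<dots> = f i d \<oplus> (\<Oplus>i\<in>A. f i d)"
      using insert by (simp add: mpoly_add[OF 1(2,1)])
    also have "\<dots> = (\<Oplus>i\<in>insert i A. f i d)"
      by (subst finsum_insert) (use insert 2 in auto)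
    finally show ?case .
  qed
qed

lemma mpoly_of_UP_closed:
  assumes F: "F \<in> carrier (UP (MP n))"
  shows "mpoly_of_UP n F \<in> carrier (MP (Suc n))"
proof (rule mpoly_carrierI)
  have Fk: "F k \<in> carrier (MP n)" for k using F by (auto simp: UP_def)
  show "mpoly_of_UP n F e \<in> carrier R" if "e \<in> carrier_vec (Suc n)" for e
    using mpoly_coeff[OF Fk] that by (auto elim!: carrier_vec_SucE)
  show "mpoly_of_UP n F e = \<zero>" if "e \<notin> carrier_vec (Suc n)" for e using that by simp
  obtain N where N: "\<And>k. N < k \<Longrightarrow> F k = \<zero>\<^bsub>MP n\<^esub>" using F by (auto simp: UP_def up_def bound_def)
  have "{e. mpoly_of_UP n F e \<noteq> \<zero>} \<subseteq> (\<Union>k\<in>{..N}. vCons k ` {d. F k d \<noteq> \<zero>})"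
  proof
    fix e assume e: "e \<in> {e. mpoly_of_UP n F e \<noteq> \<zero>}"
    then have "e \<in> carrier_vec (Suc n)" by (auto simp: mpoly_of_UP_def split: if_splits)
    then obtain k d where kd: "d \<in> carrier_vec n" "e = vCons k d" by (elim carrier_vec_SucE)
    then have "F k d \<noteq> \<zero>" using e by simp
    moreover then have "k \<le> N" using N[of k] by (force simp: mpoly_zero)
    ultimately show "e \<in> (\<Union>k\<in>{..N}. vCons k ` {d. F k d \<noteq> \<zero>})" using kd by auto
  qed
  then show "finite {e. mpoly_of_UP n F e \<noteq> \<zero>}"
    by (rule finite_subset) (use mpoly_finite[OF Fk] in auto)
qed

lemma mpoly_of_UP_iso:
  assumes "cring (MP n)"
  shows "mpoly_of_UP n \<in> ring_iso (UP (MP n)) (MP (Suc n))"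
proof (rule ring_iso_memI)
  interpret M: cring "MP n" by (rule assms)
  interpret U: UP_cring "MP n" "UP (MP n)" by unfold_locales auto
  show "mpoly_of_UP n F \<in> carrier (MP (Suc n))" if "F \<in> carrier (UP (MP n))" for F
    by (rule mpoly_of_UP_closed[OF that])
  have cf: "F k \<in> carrier (MP n)" if "F \<in> carrier (UP (MP n))" for F k
    using that by (auto simp: UP_def)
  show "mpoly_of_UP n (F \<otimes>\<^bsub>UP (MP n)\<^esub> G) = mpoly_of_UP n F \<otimes>\<^bsub>MP (Suc n)\<^esub> mpoly_of_UP n G"
    if FG: "F \<in> carrier (UP (MP n))" "G \<in> carrier (UP (MP n))" for F G
  proof (rule mpoly_eqI)
    fix k :: nat and d :: "nat vec" assume d: "d \<in> carrier_vec n"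
    have "(F \<otimes>\<^bsub>UP (MP n)\<^esub> G) k = finsum (MP n) (\<lambda>i. F i \<otimes>\<^bsub>MP n\<^esub> G (k - i)) {..k}"
      using FG by (simp add: UP_def)
    then have "mpoly_of_UP n (F \<otimes>\<^bsub>UP (MP n)\<^esub> G) (vCons k d)
        = (\<Oplus>i\<in>{..k}. (F i \<otimes>\<^bsub>MP n\<^esub> G (k - i)) d)"
      using d cf[OF FG(1)] cf[OF FG(2)] by (simp add: finsum_mpoly[OF assms])
    also have "\<dots> = (\<Oplus>i\<in>{..k}. (finsum R (\<lambda>(x, y). F i x \<otimes> G (k - i) y) (splits n d)))"
      using d by (simp add: mpoly_mult)
    also have "\<dots> = (\<Oplus>i\<in>{..k}. (finsum R (\<lambda>(a, b). mpoly_of_UP n F a \<otimes> mpoly_of_UP n G b) ((\<lambda>(x, y). (vCons i x, vCons (k - i) y)) ` splits n d)))"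
    proof (rule finsum_cong')
      show "(\<lambda>i. (finsum R (\<lambda>(a, b). mpoly_of_UP n F a \<otimes> mpoly_of_UP n G b) ((\<lambda>(x, y). (vCons i x, vCons (k - i) y)) ` splits n d))) \<in> {..k} \<rightarrow> carrier R"
        using mpoly_coeff[OF mpoly_of_UP_closed] FG
        by (auto intro!: finsum_closed simp: split_beta)
      fix i
      show "(finsum R (\<lambda>(x, y). F i x \<otimes> G (k - i) y) (splits n d)) =
        (finsum R (\<lambda>(a, b). mpoly_of_UP n F a \<otimes> mpoly_of_UP n G b) ((\<lambda>(x, y). (vCons i x, vCons (k - i) y)) ` splits n d))"
      proof (subst finsum_reindex)
        show "inj_on (\<lambda>(x, y). (vCons i x, vCons (k - i) y)) (splits n d)"
          by (auto simp: inj_on_def)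
        show "(\<lambda>(a, b). mpoly_of_UP n F a \<otimes> mpoly_of_UP n G b)
            \<in> (\<lambda>(x, y). (vCons i x, vCons (k - i) y)) ` splits n d \<rightarrow> carrier R"
          using mpoly_coeff[OF mpoly_of_UP_closed] FG by (auto simp: split_beta)
        show "(finsum R (\<lambda>(x, y). F i x \<otimes> G (k - i) y) (splits n d)) =
          (\<Oplus>x\<in>splits n d. case (case x of (x, y) \<Rightarrow> (vCons i x, vCons (k - i) y)) of
             (a, b) \<Rightarrow> mpoly_of_UP n F a \<otimes> mpoly_of_UP n G b)"
          by (rule finsum_cong')
            (auto simp: splits_def mpoly_coeff[OF cf[OF FG(1)]] mpoly_coeff[OF cf[OF FG(2)]])
      qed
    qed simp
    also have "\<dots> = (finsum R (\<lambda>(a, b). mpoly_of_UP n F a \<otimes> mpoly_of_UP n G b) (splits (Suc n) (vCons k d)))"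
      unfolding splits_vCons[OF d]
      by (rule add.finprod_UN_disjoint[symmetric])
        (use mpoly_coeff[OF mpoly_of_UP_closed] FG in \<open>auto simp: pairwise_def disjnt_def split_beta\<close>)
    also have "\<dots> = (mpoly_of_UP n F \<otimes>\<^bsub>MP (Suc n)\<^esub> mpoly_of_UP n G) (vCons k d)"
      using d by (simp add: mpoly_mult)
    finally show "mpoly_of_UP n (F \<otimes>\<^bsub>UP (MP n)\<^esub> G) (vCons k d)
        = (mpoly_of_UP n F \<otimes>\<^bsub>MP (Suc n)\<^esub> mpoly_of_UP n G) (vCons k d)" .
  qed (simp add: mpoly_mult_outside)
  show "mpoly_of_UP n (F \<oplus>\<^bsub>UP (MP n)\<^esub> G) = mpoly_of_UP n F \<oplus>\<^bsub>MP (Suc n)\<^esub> mpoly_of_UP n G"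
    if FG: "F \<in> carrier (UP (MP n))" "G \<in> carrier (UP (MP n))" for F G
  proof (rule mpoly_eqI)
    fix k :: nat and d :: "nat vec" assume d: "d \<in> carrier_vec n"
    have "(F \<oplus>\<^bsub>UP (MP n)\<^esub> G) k = F k \<oplus>\<^bsub>MP n\<^esub> G k" using FG by (simp add: UP_def)
    then show "mpoly_of_UP n (F \<oplus>\<^bsub>UP (MP n)\<^esub> G) (vCons k d)
        = (mpoly_of_UP n F \<oplus>\<^bsub>MP (Suc n)\<^esub> mpoly_of_UP n G) (vCons k d)"
      using d FG cf by (simp add: mpoly_add mpoly_of_UP_closed)
  qed (use FG in \<open>simp add: mpoly_add mpoly_of_UP_closed\<close>)
  show "mpoly_of_UP n \<one>\<^bsub>UP (MP n)\<^esub> = \<one>\<^bsub>MP (Suc n)\<^esub>"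
  proof (rule mpoly_eqI)
    fix k :: nat and d :: "nat vec" assume "d \<in> carrier_vec n"
    then show "mpoly_of_UP n \<one>\<^bsub>UP (MP n)\<^esub> (vCons k d) = \<one>\<^bsub>MP (Suc n)\<^esub> (vCons k d)"
      by (simp add: UP_def mpoly_one mpoly_zero zero_vec_Suc)
  next
    fix e :: "nat vec" assume "e \<notin> carrier_vec (Suc n)"
    then show "mpoly_of_UP n \<one>\<^bsub>UP (MP n)\<^esub> e = \<one>\<^bsub>MP (Suc n)\<^esub> e"
      by (auto simp: mpoly_one)
  qed
  show "bij_betw (mpoly_of_UP n) (carrier (UP (MP n))) (carrier (MP (Suc n)))"
  proof (rule bij_betw_imageI)
    show "inj_on (mpoly_of_UP n) (carrier (UP (MP n)))"
    proof (rule inj_onI)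
      fix F G assume FG: "F \<in> carrier (UP (MP n))" "G \<in> carrier (UP (MP n))"
        and eq: "mpoly_of_UP n F = mpoly_of_UP n G"
      show "F = G"
      proof (rule ext, rule ext)
        fix k d
        show "F k d = G k d"
        proof (cases "d \<in> carrier_vec n")
          case True
          then show ?thesis using fun_cong[OF eq, of "vCons k d"] by simp
        next
          case False
          then show ?thesis using mpoly_outside[OF cf] FG by metis
        qed
      qed
    qed
    show "mpoly_of_UP n ` carrier (UP (MP n)) = carrier (MP (Suc n))"
    proof safe
      fix p assume p: "p \<in> carrier (MP (Suc n))"
      define F where "F = (\<lambda>k d. if d \<in> carrier_vec n then p (vCons k d) else \<zero>)"
      have Fk: "F k \<in> carrier (MP n)" for k
      proof (rule mpoly_carrierI)
        have "{d. F k d \<noteq> \<zero>} \<subseteq> vtail ` {e. p e \<noteq> \<zero>}"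
          by (force simp: F_def split: if_splits)
        then show "finite {d. F k d \<noteq> \<zero>}"
          by (rule finite_subset) (use mpoly_finite[OF p] in simp)
      qed (auto simp: F_def mpoly_coeff[OF p])
      \<comment> \<open>The largest first exponent in the support bounds the degree in the outer
        variable; inserting 0 covers the empty support.\<close>
      define N where "N = Max (insert 0 ((\<lambda>e. e $ 0) ` {e. p e \<noteq> \<zero>}))"
      have "F k = \<zero>\<^bsub>MP n\<^esub>" if "N < k" for k
      proof (rule ext)
        fix d
        have "p (vCons k d) = \<zero>"
        proof (rule ccontr)
          assume "p (vCons k d) \<noteq> \<zero>"
          then have "vCons k d $ 0 \<in> (\<lambda>e. e $ 0) ` {e. p e \<noteq> \<zero>}" by blast
          then have "k \<le> N" unfolding N_def using mpoly_finite[OF p] by (intro Max_ge) auto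
          then show False using that by simp
        qed
        then show "F k d = \<zero>\<^bsub>MP n\<^esub> d" by (simp add: F_def mpoly_zero)
      qed
      then have "F \<in> carrier (UP (MP n))"
        using Fk by (auto simp: UP_def up_def bound_def)
      moreover have "mpoly_of_UP n F = p"
        by (rule mpoly_eqI[of n]) (use mpoly_outside[OF p] in \<open>auto simp: F_def\<close>)
      ultimately show "p \<in> mpoly_of_UP n ` carrier (UP (MP n))" by blast
    qed (rule mpoly_of_UP_closed)
  qed
qed

text \<open>Proved before \<open>MP n\<close> is known to be a ring, hence without negatives there:
  the image of zero is idempotent under addition, and this is resolved coefficientwise in
  \<open>R\<close>. It identifies the zero that transport of structure installs with that of
  \<open>MP n\<close>.\<close>

lemma ring_iso_zero:
  assumes "cring A" "h \<in> ring_iso A (MP n)"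
  shows "h \<zero>\<^bsub>A\<^esub> = \<zero>\<^bsub>MP n\<^esub>"
proof -
  interpret A: cring A by (rule assms)
  note h = ring_iso_memE[OF assms(2)]
  define z where "z = h \<zero>\<^bsub>A\<^esub>"
  have z: "z \<in> carrier (MP n)" using h(1) by (simp add: z_def)
  have "z = z \<oplus>\<^bsub>MP n\<^esub> z" unfolding z_def using h(3)[of "\<zero>\<^bsub>A\<^esub>" "\<zero>\<^bsub>A\<^esub>"] by simp
  then have "z e = z e \<oplus> z e" for e using mpoly_add[OF z z, of e] by simp
  then have "z e = \<zero>" for e using z by (metis add.l_cancel_one' mpoly_coeff)
  then show ?thesis by (auto simp: mpoly_zero z_def)
qed

text \<open>The ring axioms are carried over from iterated univariate polynomials, which avoids
  reordering convolution sums.\<close>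

lemma cring_mpoly: "cring (MP n)"
proof (induction n)
  case 0
  have "MP 0 \<lparr> zero := mpoly_const 0 \<zero> \<rparr> = MP 0"
    using ring_iso_zero[OF is_cring mpoly_const_iso] by simp
  then show ?case using ring_iso_imp_img_cring[OF mpoly_const_iso] by simp
next
  case (Suc n)
  interpret M: cring "MP n" by (rule Suc)
  interpret U: UP_cring "MP n" "UP (MP n)" by unfold_locales auto
  note iso = mpoly_of_UP_iso[OF Suc]
  have "MP (Suc n) \<lparr> zero := mpoly_of_UP n \<zero>\<^bsub>UP (MP n)\<^esub> \<rparr> = MP (Suc n)"
    using ring_iso_zero[OF U.UP_cring iso] by simp
  then show ?case using cring.ring_iso_imp_img_cring[OF U.UP_cring iso] by simp
qed

end

lemma (in "domain") domain_mpoly: "domain (MP n)"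
proof (induction n)
  case 0
  have "MP 0 \<lparr> zero := mpoly_const 0 \<zero> \<rparr> = MP 0"
    using ring_iso_zero[OF is_cring mpoly_const_iso] by simp
  then show ?case using ring_iso_imp_img_domain[OF mpoly_const_iso] by simp
next
  case (Suc n)
  interpret M: "domain" "MP n" by (rule Suc)
  interpret U: UP_domain "MP n" "UP (MP n)" by unfold_locales auto
  note iso = mpoly_of_UP_iso[OF M.is_cring]
  have "MP (Suc n) \<lparr> zero := mpoly_of_UP n \<zero>\<^bsub>UP (MP n)\<^esub> \<rparr> = MP (Suc n)"
    using ring_iso_zero[OF U.UP_cring iso] by simp
  then show ?case using domain.ring_iso_imp_img_domain[OF U.UP_domain iso] by simp
qed

section \<open>Leading coefficients\<close>

locale monomial_order =
  fixes n :: nat and prec :: "nat vec \<Rightarrow> nat vec \<Rightarrow> bool"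
  assumes irrefl: "e \<in> carrier_vec n \<Longrightarrow> \<not> prec e e"
    and trans: "a \<in> carrier_vec n \<Longrightarrow> b \<in> carrier_vec n \<Longrightarrow> c \<in> carrier_vec n \<Longrightarrow>
      prec a b \<Longrightarrow> prec b c \<Longrightarrow> prec a c"
    and total: "a \<in> carrier_vec n \<Longrightarrow> b \<in> carrier_vec n \<Longrightarrow> a \<noteq> b \<Longrightarrow> prec a b \<or> prec b a"
    and add: "a \<in> carrier_vec n \<Longrightarrow> b \<in> carrier_vec n \<Longrightarrow> c \<in> carrier_vec n \<Longrightarrow>
      prec a b \<Longrightarrow> prec (a + c) (b + c)"
begin

lemma exists_max:
  assumes "finite E" "E \<noteq> {}" "E \<subseteq> carrier_vec n"
  shows "\<exists>m\<in>E. \<forall>d\<in>E. d \<noteq> m \<longrightarrow> prec d m"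
  using assms
proof (induction E rule: finite_ne_induct)
  case (singleton e)
  then show ?case by simp
next
  case (insert e E)
  then obtain m where m: "m \<in> E" "\<forall>d\<in>E. d \<noteq> m \<longrightarrow> prec d m" by auto
  have c: "e \<in> carrier_vec n" "m \<in> carrier_vec n" using insert m by auto
  have "e \<noteq> m" using m insert by auto
  then consider "prec e m" | "prec m e" using total[OF c] by blast
  then show ?case
  proof cases
    case 1
    then show ?thesis using m by blast
  next
    case 2
    have "prec d e" if "d \<in> E" for d
      using 2 m that c insert trans[of d m e] by (cases "d = m") auto
    then show ?thesis by blast
  qed
qed

lemma add_left:
  assumes "a \<in> carrier_vec n" "b \<in> carrier_vec n" "c \<in> carrier_vec n" "prec a b"
  shows "prec (c + a) (c + b)"
  using add[OF assms] assms comm_add_vec[of c n] by simp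

text \<open>If neither summand exceeds its counterpart, compatibility with addition gives
  \<open>d + d' \<preceq> a + b\<close>, with equality only for \<open>d = a\<close> and
  \<open>d' = b\<close>.\<close>

lemma split_cases:
  assumes "(d, d') \<in> splits n e" "a \<in> carrier_vec n" "b \<in> carrier_vec n" "e = a + b \<or> prec (a + b) e"
  shows "prec a d \<or> prec b d' \<or> d = a \<and> d' = b \<and> e = a + b"
proof (rule ccontr)
  assume no: "\<not> ?thesis"
  have c: "d \<in> carrier_vec n" "d' \<in> carrier_vec n" and e: "e = d + d'"
    using assms(1) by (auto simp: splits_def)
  have da: "d = a \<or> prec d a" and db: "d' = b \<or> prec d' b"
    using no total c assms(2,3) by blast+
  have ne: "\<not> (d = a \<and> d' = b)"
  proof
    assume "d = a \<and> d' = b"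
    then have "e = a + b" using e by simp
    then show False using no \<open>d = a \<and> d' = b\<close> by blast
  qed
  have "prec e (a + b)"
  proof (cases "d = a")
    case True
    then have "prec d' b" using db ne by blast
    then show ?thesis unfolding e True by (rule add_left[OF c(2) assms(3,2)])
  next
    case False
    then have p: "prec (d + d') (a + d')" using add da c assms(2) by blast
    show ?thesis
    proof (cases "d' = b")
      case True
      then show ?thesis using p e by simp
    next
      case False
      then have "prec (a + d') (a + b)" using add_left db c assms(2,3) by blast
      then show ?thesis unfolding e using trans[OF _ _ _ p] c assms(2,3) by simp
    qed
  qed
  then have "prec (a + b) (a + b) \<or> prec e e"
    using assms(4) trans[of "a + b" e "a + b"] c e assms(2,3) by auto
  then show False using irrefl c e assms(2,3) by auto
qed

end

text \<open>An upper bound for the support in place of the leading exponent: it makes sense for the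
  zero polynomial, and the rule for products then holds over any commutative ring, zero divisors
  included.\<close>

definition vanishes_above ::
    "('a, 'm) ring_scheme \<Rightarrow> nat \<Rightarrow> (nat vec \<Rightarrow> nat vec \<Rightarrow> bool) \<Rightarrow> (nat vec \<Rightarrow> 'a) \<Rightarrow> nat vec \<Rightarrow> bool"
  where "vanishes_above R n prec p m \<longleftrightarrow> (\<forall>d \<in> carrier_vec n. prec m d \<longrightarrow> p d = \<zero>\<^bsub>R\<^esub>)"

locale cring_monomial_order = cring R + monomial_order n prec
  for R (structure) and n prec
begin

abbreviation mons where "mons \<equiv> carrier_vec n :: nat vec set"
abbreviation vabove where "vabove \<equiv> vanishes_above R n prec"
abbreviation Q where "Q \<equiv> mpoly_ring R n"

sublocale Q: cring "mpoly_ring R n" by (rule cring_mpoly)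

text \<open>By \<open>split_cases\<close> a product of coefficients at or above \<open>a + b\<close>
  vanishes except the one at \<open>a\<close> and \<open>b\<close>.\<close>

lemma mult_top:
  assumes p: "p \<in> carrier Q" "a \<in> mons" "vabove p a"
    and q: "q \<in> carrier Q" "b \<in> mons" "vabove q b"
  shows "(p \<otimes>\<^bsub>Q\<^esub> q) (a + b) = p a \<otimes> q b" "vabove (p \<otimes>\<^bsub>Q\<^esub> q) (a + b)"
proof -
  have z: "p d \<otimes> q d' = \<zero>"
    if "(d, d') \<in> splits n e" "e = a + b \<or> prec (a + b) e" "\<not> (d = a \<and> d' = b \<and> e = a + b)" for d d' e
  proof -
    have c: "d \<in> mons" "d' \<in> mons" using that by (auto simp: splits_def)
    have "prec a d \<or> prec b d'" using split_cases[OF that(1) p(2) q(2) that(2)] that(3) by blast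
    then have "p d = \<zero> \<or> q d' = \<zero>"
      using p(3) q(3) c unfolding vanishes_above_def by blast
    then show ?thesis using mpoly_coeff[OF p(1)] mpoly_coeff[OF q(1)] by auto
  qed
  have ab: "a + b \<in> mons" using p q by simp
  have m: "(a, b) \<in> splits n (a + b)" using p q by (simp add: splits_def)
  have "(p \<otimes>\<^bsub>Q\<^esub> q) (a + b) = finsum R (\<lambda>(d, d'). p d \<otimes> q d') (splits n (a + b))"
    by (rule mpoly_mult[OF ab])
  also have "\<dots> = finsum R (\<lambda>(d, d'). p d \<otimes> q d') {(a, b)}"
    by (rule add.finprod_mono_neutral_cong_right)
      (use m z[of _ _ "a + b"] mpoly_coeff[OF p(1)] mpoly_coeff[OF q(1)] in auto)
  also have "\<dots> = p a \<otimes> q b" using mpoly_coeff[OF p(1)] mpoly_coeff[OF q(1)] by simp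
  finally show "(p \<otimes>\<^bsub>Q\<^esub> q) (a + b) = p a \<otimes> q b" .
  show "vabove (p \<otimes>\<^bsub>Q\<^esub> q) (a + b)"
    unfolding vanishes_above_def
  proof (intro ballI impI)
    fix e assume e: "e \<in> mons" "prec (a + b) e"
    have "e \<noteq> a + b" using e irrefl by blast
    then have "(\<lambda>(d, d'). p d \<otimes> q d') x = \<zero>" if "x \<in> splits n e" for x
      using z[of "fst x" "snd x" e] that e by (simp add: split_beta)
    then show "(p \<otimes>\<^bsub>Q\<^esub> q) e = \<zero>"
      unfolding mpoly_mult[OF e(1)] by (intro add.finprod_one_eqI) auto
  qed
qed

lemma exists_top:
  assumes p: "p \<in> carrier Q" "p \<noteq> \<zero>\<^bsub>Q\<^esub>"
  shows "\<exists>m\<in>mons. p m \<noteq> \<zero> \<and> vabove p m"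
proof -
  let ?E = "{e. p e \<noteq> \<zero>}"
  have "?E \<subseteq> mons" using mpoly_outside[OF p(1)] by blast
  moreover have "?E \<noteq> {}" using p(2) by (auto simp: mpoly_zero)
  ultimately obtain m where m: "m \<in> ?E" "\<forall>d\<in>?E. d \<noteq> m \<longrightarrow> prec d m" "m \<in> mons"
    using exists_max[OF mpoly_finite[OF p(1)]] by blast
  have "vabove p m"
    unfolding vanishes_above_def
  proof (intro ballI impI, rule ccontr)
    fix d assume d: "d \<in> mons" "prec m d" "p d \<noteq> \<zero>"
    have "d \<noteq> m" using d irrefl by blast
    then have "prec d m" using m(2) d(3) by simp
    then show False using trans[OF m(3) d(1) m(3) d(2)] irrefl[OF m(3)] by simp
  qed
  then show ?thesis using m by blast
qed

lemma lead_coef_eq: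
  assumes p: "p \<in> carrier Q" and m: "m \<in> mons" "p m \<noteq> \<zero>" "vabove p m"
  shows "lead_coef R prec p = p m"
proof -
  have lt: "prec d m" if "p d \<noteq> \<zero>" "d \<noteq> m" for d
  proof -
    have d: "d \<in> mons" using mpoly_outside[OF p] that(1) by blast
    then have "\<not> prec m d" using m(3) that(1) unfolding vanishes_above_def by blast
    then show ?thesis using total[OF d m(1) that(2)] by simp
  qed
  have "lead_monom R prec p = m"
    unfolding lead_monom_def
  proof (rule the_equality)
    show "p m \<noteq> \<zero> \<and> (\<forall>d. p d \<noteq> \<zero> \<and> d \<noteq> m \<longrightarrow> prec d m)" using m lt by blast
    fix e assume e: "p e \<noteq> \<zero> \<and> (\<forall>d. p d \<noteq> \<zero> \<and> d \<noteq> e \<longrightarrow> prec d e)"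
    show "e = m"
    proof (rule ccontr)
      assume "e \<noteq> m"
      then have "prec e m" "prec m e" using e lt m by auto
      moreover have c: "e \<in> mons" using mpoly_outside[OF p] e by blast
      ultimately show False using trans[OF c m(1) c] irrefl[OF c] by simp
    qed
  qed
  moreover have "p \<noteq> (\<lambda>e. \<zero>)" using m by auto
  ultimately show ?thesis by (simp add: lead_coef_def)
qed

abbreviation monics where "monics \<equiv> monic_mpolys R n prec"

text \<open>Over the trivial ring the zero polynomial counts as monic and the right-hand side holds
  for it too, so the monics form a submonoid over every commutative ring.\<close>

lemma monics_iff: "s \<in> monics \<longleftrightarrow> s \<in> carrier Q \<and> (\<exists>m\<in>mons. s m = \<one> \<and> vabove s m)"
proof (cases "\<one> = \<zero>")
  case True
  then have triv: "carrier R = {\<zero>}" using carrier_one_zero by blast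
  have z: "s = (\<lambda>e. \<zero>)" if "s \<in> carrier Q" for s
    using mpoly_coeff[OF that] triv by auto
  have "s \<in> monics \<longleftrightarrow> s \<in> carrier Q"
    using z True by (auto simp: monic_mpolys_def lead_coef_def)
  moreover have "\<exists>m\<in>mons. s m = \<one> \<and> vabove s m" if "s \<in> carrier Q"
    using z[OF that] True by (intro bexI[of _ "0\<^sub>v n"]) (auto simp: vanishes_above_def)
  ultimately show ?thesis by blast
next
  case False
  show ?thesis
  proof
    assume s: "s \<in> monics"
    then have sc: "s \<in> carrier Q" and l: "lead_coef R prec s = \<one>" by (auto simp: monic_mpolys_def)
    have "s \<noteq> \<zero>\<^bsub>Q\<^esub>" using l False by (auto simp: lead_coef_def mpoly_zero)
    then obtain m where m: "m \<in> mons" "s m \<noteq> \<zero>" "vabove s m" using exists_top[OF sc] by blast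
    then have "s m = \<one>" using lead_coef_eq[OF sc m] l by simp
    then show "s \<in> carrier Q \<and> (\<exists>m\<in>mons. s m = \<one> \<and> vabove s m)" using sc m by blast
  next
    assume "s \<in> carrier Q \<and> (\<exists>m\<in>mons. s m = \<one> \<and> vabove s m)"
    then obtain m where m: "s \<in> carrier Q" "m \<in> mons" "s m = \<one>" "vabove s m" by blast
    then have "lead_coef R prec s = s m" using False by (intro lead_coef_eq) auto
    then show "s \<in> monics" using m by (simp add: monic_mpolys_def)
  qed
qed

lemma monicsI:
  "s \<in> carrier Q \<Longrightarrow> m \<in> mons \<Longrightarrow> s m = \<one> \<Longrightarrow> vabove s m \<Longrightarrow> s \<in> monics"
  using monics_iff by blast

lemma submonoid_monics: "submonoid monics Q"
proof (rule submonoid.intro)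
  show "monics \<subseteq> carrier Q" by (auto simp: monic_mpolys_def)
  have "d \<noteq> 0\<^sub>v n" if "d \<in> mons" "prec (0\<^sub>v n) d" for d using that irrefl by blast
  then have "vabove \<one>\<^bsub>Q\<^esub> (0\<^sub>v n)" by (simp add: vanishes_above_def mpoly_one)
  then show "\<one>\<^bsub>Q\<^esub> \<in> monics"
    by (intro monicsI[OF Q.one_closed, of "0\<^sub>v n"]) (simp_all add: mpoly_one)
  fix s t assume "s \<in> monics" "t \<in> monics"
  then obtain a b where *: "s \<in> carrier Q" "a \<in> mons" "s a = \<one>" "vabove s a"
    "t \<in> carrier Q" "b \<in> mons" "t b = \<one>" "vabove t b"
    using monics_iff by auto
  show "s \<otimes>\<^bsub>Q\<^esub> t \<in> monics"
    using mult_top[OF *(1,2,4) *(5,6,8)] * by (intro monicsI[of _ "a + b"]) auto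
qed

lemma zero_notin_monics: "\<one> \<noteq> \<zero> \<Longrightarrow> \<zero>\<^bsub>Q\<^esub> \<notin> monics"
  by (auto simp: monics_iff mpoly_zero)

end

section \<open>The lexicographic order\<close>

lemma lex_total:
  assumes "dim_vec a = dim_vec b" "a \<noteq> b"
  shows "vec_lex_less a b \<or> vec_lex_less b a"
proof -
  define k where "k = (LEAST k. k < dim_vec a \<and> a $ k \<noteq> b $ k)"
  have "\<exists>k. k < dim_vec a \<and> a $ k \<noteq> b $ k" using assms by (metis eq_vecI)
  then have k: "k < dim_vec a" "a $ k \<noteq> b $ k" unfolding k_def by (metis (mono_tags, lifting) LeastI)+
  have "a $ i = b $ i" if "i < k" for i
    using not_less_Least[of i "\<lambda>k. k < dim_vec a \<and> a $ k \<noteq> b $ k"] that k(1) unfolding k_def by auto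
  then show ?thesis using k assms(1) unfolding vec_lex_less_def
    by (metis linorder_neqE_nat)
qed

lemma lex_trans:
  assumes "vec_lex_less a b" "vec_lex_less b c"
  shows "vec_lex_less a c"
proof -
  obtain k l where k: "dim_vec a = dim_vec b" "k < dim_vec a" "\<forall>i<k. a $ i = b $ i" "a $ k < b $ k"
    and l: "dim_vec b = dim_vec c" "l < dim_vec b" "\<forall>i<l. b $ i = c $ i" "b $ l < c $ l"
    using assms unfolding vec_lex_less_def by blast
  show ?thesis
    unfolding vec_lex_less_def
  proof (intro conjI exI[of _ "min k l"])
    show "a $ min k l < c $ min k l"
      by (cases k l rule: linorder_cases) (use k l in \<open>auto simp: min_def\<close>)
  qed (use k l in auto)
qed

lemma monomial_order_lex: "monomial_order n vec_lex_less"
proof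
  show "\<not> vec_lex_less e e" for e by (auto simp: vec_lex_less_def)
  show "vec_lex_less a b \<or> vec_lex_less b a"
    if "a \<in> carrier_vec n" "b \<in> carrier_vec n" "a \<noteq> b" for a b
    using that by (intro lex_total) auto
  show "vec_lex_less a c" if "vec_lex_less a b" "vec_lex_less b c" for a b c
    using lex_trans that by blast
  show "vec_lex_less (a + c) (b + c)"
    if "a \<in> carrier_vec n" "b \<in> carrier_vec n" "c \<in> carrier_vec n" "vec_lex_less a b" for a b c
    using that by (auto simp: vec_lex_less_def)
qed

lemma vec_lex_less_vCons:
  assumes "vec_lex_less (vCons k m) (vCons j d)"
  shows "k < j \<or> k = j \<and> vec_lex_less m d"
proof -
  obtain l where l: "dim_vec m = dim_vec d" "l < Suc (dim_vec m)"
    "\<forall>i<l. vCons k m $ i = vCons j d $ i" "vCons k m $ l < vCons j d $ l"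
    using assms by (auto simp: vec_lex_less_def)
  show ?thesis
  proof (cases l)
    case 0
    then show ?thesis using l by simp
  next
    case (Suc i)
    have "k = j" using l(3)[rule_format, of 0] Suc by simp
    moreover have "m $ i' = d $ i'" if "i' < i" for i'
      using l(3)[rule_format, of "Suc i'"] Suc that l(1,2) by (simp add: vec_index_vCons)
    ultimately show ?thesis
      using l Suc by (auto simp: vec_lex_less_def vec_index_vCons)
  qed
qed

section \<open>Transport along surjective homomorphisms\<close>

lemma ring_hom_nat_pow:
  assumes "cring A" "cring B" "h \<in> Ring.ring_hom A B" "a \<in> carrier A"
  shows "h (a [^]\<^bsub>A\<^esub> (k::nat)) = h a [^]\<^bsub>B\<^esub> k"
proof -
  interpret ring_hom_cring A B h
    by (rule UnivPoly.ring_hom_cringI[OF assms(1-3)])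
  show ?thesis by (rule hom_pow[OF assms(4)])
qed

lemma arithmetical_at_transfer:
  assumes h: "h \<in> Ring.ring_hom A B" "h ` carrier A = carrier B" "h ` S \<subseteq> T"
    and ar: "arithmetical_at A S"
  shows "arithmetical_at B T"
proof (rule arithmetical_atI)
  note hm = ring_hom_memE[OF h(1)]
  fix a b assume "a \<in> carrier B" "b \<in> carrier B"
  then obtain a' b' where ab: "a' \<in> carrier A" "a = h a'" "b' \<in> carrier A" "b = h b'"
    using h(2) by blast
  obtain p q x y where k: "p \<in> carrier A" "q \<in> carrier A" "x \<in> carrier A" "y \<in> carrier A"
    and e: "p \<oplus>\<^bsub>A\<^esub> q \<in> S" "p \<otimes>\<^bsub>A\<^esub> a' = x \<otimes>\<^bsub>A\<^esub> b'" "q \<otimes>\<^bsub>A\<^esub> b' = y \<otimes>\<^bsub>A\<^esub> a'"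
    by (rule arithmetical_atE[OF ar ab(1,3)])
  have "h p \<oplus>\<^bsub>B\<^esub> h q = h (p \<oplus>\<^bsub>A\<^esub> q)" using hm k by simp
  then have "h p \<oplus>\<^bsub>B\<^esub> h q \<in> T" using e(1) h(3) by auto
  moreover have "h p \<otimes>\<^bsub>B\<^esub> a = h x \<otimes>\<^bsub>B\<^esub> b" "h q \<otimes>\<^bsub>B\<^esub> b = h y \<otimes>\<^bsub>B\<^esub> a"
    using hm(2) k ab e by (metis)+
  ultimately show "\<exists>p q x y. p \<in> carrier B \<and> q \<in> carrier B \<and> x \<in> carrier B \<and> y \<in> carrier B \<and>
      p \<oplus>\<^bsub>B\<^esub> q \<in> T \<and> p \<otimes>\<^bsub>B\<^esub> a = x \<otimes>\<^bsub>B\<^esub> b \<and> q \<otimes>\<^bsub>B\<^esub> b = y \<otimes>\<^bsub>B\<^esub> a"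
    using hm(1) k by (intro exI[of _ "h p"] exI[of _ "h q"] exI[of _ "h x"] exI[of _ "h y"]) simp
qed

lemma bezout_at_transfer:
  assumes h: "h \<in> Ring.ring_hom A B" "h ` carrier A = carrier B" "h ` S \<subseteq> T"
    and cr: "cring A" and bz: "bezout_at A S"
  shows "bezout_at B T"
proof (rule bezout_atI)
  interpret A: cring A by (rule cr)
  note hm = ring_hom_memE[OF h(1)]
  fix a b assume "a \<in> carrier B" "b \<in> carrier B"
  then obtain a' b' where ab: "a' \<in> carrier A" "a = h a'" "b' \<in> carrier A" "b = h b'"
    using h(2) by blast
  obtain x y u v where k: "x \<in> carrier A" "y \<in> carrier A" "u \<in> carrier A" "v \<in> carrier A"
    and e: "a' \<otimes>\<^bsub>A\<^esub> y = b' \<otimes>\<^bsub>A\<^esub> x" "u \<otimes>\<^bsub>A\<^esub> x \<oplus>\<^bsub>A\<^esub> v \<otimes>\<^bsub>A\<^esub> y \<in> S"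
    by (rule bezout_atE[OF bz ab(1,3)])
  have "h u \<otimes>\<^bsub>B\<^esub> h x \<oplus>\<^bsub>B\<^esub> h v \<otimes>\<^bsub>B\<^esub> h y = h (u \<otimes>\<^bsub>A\<^esub> x \<oplus>\<^bsub>A\<^esub> v \<otimes>\<^bsub>A\<^esub> y)" using hm k by simp
  then have "h u \<otimes>\<^bsub>B\<^esub> h x \<oplus>\<^bsub>B\<^esub> h v \<otimes>\<^bsub>B\<^esub> h y \<in> T" using e(2) h(3) by auto
  moreover have "a \<otimes>\<^bsub>B\<^esub> h y = b \<otimes>\<^bsub>B\<^esub> h x" using hm(2) k ab e(1) by metis
  ultimately show "\<exists>x y u v. x \<in> carrier B \<and> y \<in> carrier B \<and> u \<in> carrier B \<and> v \<in> carrier B \<and>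
      a \<otimes>\<^bsub>B\<^esub> y = b \<otimes>\<^bsub>B\<^esub> x \<and> u \<otimes>\<^bsub>B\<^esub> x \<oplus>\<^bsub>B\<^esub> v \<otimes>\<^bsub>B\<^esub> y \<in> T"
    using hm(1) k by (intro exI[of _ "h x"] exI[of _ "h y"] exI[of _ "h u"] exI[of _ "h v"]) simp
qed

lemma dim_le_one_at_transfer:
  assumes h: "h \<in> Ring.ring_hom A B" "h ` carrier A = carrier B" "h ` S \<subseteq> T"
    and cr: "cring A" "cring B" and S: "S \<subseteq> carrier A" and D: "dim_le_one_at A S"
  shows "dim_le_one_at B T"
proof (rule dim_le_one_atI)
  interpret A: cring A by (rule cr)
  interpret B: cring B by (rule cr)
  note hm = ring_hom_memE[OF h(1)]
  fix a b assume "a \<in> carrier B" and a0: "a \<noteq> \<zero>\<^bsub>B\<^esub>" and "b \<in> carrier B"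
  then obtain a' b' where ab: "a' \<in> carrier A" "a = h a'" "b' \<in> carrier A" "b = h b'"
    using h(2) by blast
  have nz: "a' \<noteq> \<zero>\<^bsub>A\<^esub>"
    using a0 ab(2) ring_hom_zero[OF h(1) A.ring_axioms B.ring_axioms] by auto
  obtain k s u v where k: "s \<in> S" "u \<in> carrier A" "v \<in> carrier A"
    and e: "b' [^]\<^bsub>A\<^esub> (k::nat) \<otimes>\<^bsub>A\<^esub> s = a' \<otimes>\<^bsub>A\<^esub> u \<oplus>\<^bsub>A\<^esub> b' [^]\<^bsub>A\<^esub> Suc k \<otimes>\<^bsub>A\<^esub> v"
    by (rule dim_le_one_atE[OF D ab(1) nz ab(3)])
  have sc: "s \<in> carrier A" using k S by blast
  note pow = ring_hom_nat_pow[OF cr h(1) ab(3)]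
  have "b [^]\<^bsub>B\<^esub> k \<otimes>\<^bsub>B\<^esub> h s = h (b' [^]\<^bsub>A\<^esub> k \<otimes>\<^bsub>A\<^esub> s)"
    using hm(2) ab sc pow[of k] by simp
  also have "\<dots> = a \<otimes>\<^bsub>B\<^esub> h u \<oplus>\<^bsub>B\<^esub> b [^]\<^bsub>B\<^esub> Suc k \<otimes>\<^bsub>B\<^esub> h v"
    unfolding e using hm ab k pow[of "Suc k"] A.nat_pow_closed[of b' "Suc k"]
    by (simp del: A.nat_pow_Suc B.nat_pow_Suc nat_pow_Suc)
  finally show "\<exists>(k::nat) s u v. s \<in> T \<and> u \<in> carrier B \<and> v \<in> carrier B \<and>
      b [^]\<^bsub>B\<^esub> k \<otimes>\<^bsub>B\<^esub> s = a \<otimes>\<^bsub>B\<^esub> u \<oplus>\<^bsub>B\<^esub> b [^]\<^bsub>B\<^esub> Suc k \<otimes>\<^bsub>B\<^esub> v"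
    using hm(1) k h(3) by (intro exI[of _ k] exI[of _ "h s"] exI[of _ "h u"] exI[of _ "h v"]) auto
qed

section \<open>The three properties for the lexicographic order\<close>

context "domain"
begin

text \<open>An exponent above \<open>vCons k m\<close> either has a larger first entry, where the
  coefficient polynomial is zero, or the same one, where the coefficient polynomial vanishes above
  \<open>m\<close>.\<close>

lemma mpoly_of_UP_lead:
  assumes F: "F \<in> carrier (UP (MP n))"
    and l: "coeff (UP (MP n)) F (deg (MP n) F) \<in> monic_mpolys R n vec_lex_less"
  shows "mpoly_of_UP n F \<in> monic_mpolys R (Suc n) vec_lex_less"
proof -
  interpret M: cring_monomial_order R n vec_lex_less
    by (intro cring_monomial_order.intro is_cring monomial_order_lex)
  interpret M': cring_monomial_order R "Suc n" vec_lex_less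
    by (intro cring_monomial_order.intro is_cring monomial_order_lex)
  interpret U: UP_cring "MP n" "UP (MP n)" by unfold_locales auto
  define k where "k = deg (MP n) F"
  have "F k \<in> monic_mpolys R n vec_lex_less" using l F by (simp add: UP_def k_def)
  then obtain m where m: "m \<in> carrier_vec n" "F k m = \<one>" "vanishes_above R n vec_lex_less (F k) m"
    unfolding M.monics_iff by blast
  have Fj: "F j = \<zero>\<^bsub>MP n\<^esub>" if "k < j" for j
    using U.deg_aboveD[OF _ F, of j] that F by (simp add: UP_def k_def)
  show ?thesis
  proof (rule M'.monicsI[of _ "vCons k m"])
    show "mpoly_of_UP n F \<in> carrier (MP (Suc n))" by (rule mpoly_of_UP_closed[OF F])
    show "vanishes_above R (Suc n) vec_lex_less (mpoly_of_UP n F) (vCons k m)"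
      unfolding vanishes_above_def
    proof (intro ballI impI)
      fix e assume e: "e \<in> carrier_vec (Suc n)" "vec_lex_less (vCons k m) e"
      then obtain j d where d: "d \<in> carrier_vec n" "e = vCons j d" by (elim carrier_vec_SucE)
      have "k < j \<or> k = j \<and> vec_lex_less m d" using vec_lex_less_vCons e(2) d(2) by blast
      then have "F j d = \<zero>"
        using Fj[of j] m(3) d(1) by (auto simp: mpoly_zero vanishes_above_def)
      then show "mpoly_of_UP n F e = \<zero>" using d by simp
    qed
  qed (use m in auto)
qed

lemma domain_at_monics:
  assumes "monomial_order n prec"
  shows "domain_at (MP n) (monic_mpolys R n prec)"
proof -
  interpret M: cring_monomial_order R n prec
    by (intro cring_monomial_order.intro is_cring assms)
  show ?thesis
    by (intro domain_at.intro domain_at_axioms.intro domain_mpoly M.submonoid_monics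
        M.zero_notin_monics one_not_zero)
qed

text \<open>The two properties share one induction because each passage to a further variable uses
  both of them at the previous stage. In no variables the ring is \<open>R\<close> itself.\<close>

lemma lex_arithmetical_dim:
  assumes ar: "arithmetical_at R {\<one>}" and D: "dim_le_one_at R {\<one>}"
  shows "arithmetical_at (MP n) (monic_mpolys R n vec_lex_less) \<and>
    dim_le_one_at (MP n) (monic_mpolys R n vec_lex_less)"
proof (induction n)
  case 0
  interpret M: cring_monomial_order R 0 vec_lex_less
    by (intro cring_monomial_order.intro is_cring monomial_order_lex)
  have "mpoly_const 0 \<one> = \<one>\<^bsub>MP 0\<^esub>" by (rule ring_iso_memE(4)[OF mpoly_const_iso])
  then have T: "mpoly_const 0 ` {\<one>} \<subseteq> monic_mpolys R 0 vec_lex_less"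
    using submonoid.one_closed[OF M.submonoid_monics] by simp
  have h: "mpoly_const 0 \<in> Ring.ring_hom R (MP 0)" "mpoly_const 0 ` carrier R = carrier (MP 0)"
    using mpoly_const_iso by (auto simp: ring_iso_def bij_betw_def)
  show ?case
    using arithmetical_at_transfer[OF h T ar]
      dim_le_one_at_transfer[OF h T is_cring cring_mpoly _ D] by simp
next
  case (Suc n)
  interpret L: domain_at "MP n" "monic_mpolys R n vec_lex_less"
    by (rule domain_at_monics[OF monomial_order_lex])
  note iso = mpoly_of_UP_iso[OF cring_mpoly, of n]
  have h: "mpoly_of_UP n \<in> Ring.ring_hom L.P (MP (Suc n))" "mpoly_of_UP n ` carrier L.P = carrier (MP (Suc n))"
    using iso by (auto simp: ring_iso_def bij_betw_def)
  have T: "mpoly_of_UP n ` L.lead_in_S \<subseteq> monic_mpolys R (Suc n) vec_lex_less"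
    using mpoly_of_UP_lead by (auto simp: L.lead_in_S_def)
  have S: "L.lead_in_S \<subseteq> carrier L.P" by (auto simp: L.lead_in_S_def)
  show ?case
    using arithmetical_at_transfer[OF h T L.arithmetical_at_lead]
      dim_le_one_at_transfer[OF h T L.U.UP_cring cring_mpoly S L.dim_le_one_at_lead] Suc by simp
qed

text \<open>The dimension bound at each stage comes from the preceding lemma, a Bezout condition
  being in particular an arithmetical one.\<close>

lemma lex_bezout:
  assumes bz: "bezout_at R {\<one>}" and D: "dim_le_one_at R {\<one>}"
  shows "bezout_at (MP n) (monic_mpolys R n vec_lex_less)"
proof (induction n)
  case 0
  interpret M: cring_monomial_order R 0 vec_lex_less
    by (intro cring_monomial_order.intro is_cring monomial_order_lex)
  have "mpoly_const 0 \<one> = \<one>\<^bsub>MP 0\<^esub>" by (rule ring_iso_memE(4)[OF mpoly_const_iso])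
  then have T: "mpoly_const 0 ` {\<one>} \<subseteq> monic_mpolys R 0 vec_lex_less"
    using submonoid.one_closed[OF M.submonoid_monics] by simp
  have h: "mpoly_const 0 \<in> Ring.ring_hom R (MP 0)" "mpoly_const 0 ` carrier R = carrier (MP 0)"
    using mpoly_const_iso by (auto simp: ring_iso_def bij_betw_def)
  show ?case by (rule bezout_at_transfer[OF h T is_cring bz])
next
  case (Suc n)
  interpret L: domain_at "MP n" "monic_mpolys R n vec_lex_less"
    by (rule domain_at_monics[OF monomial_order_lex])
  note iso = mpoly_of_UP_iso[OF cring_mpoly, of n]
  have h: "mpoly_of_UP n \<in> Ring.ring_hom L.P (MP (Suc n))" "mpoly_of_UP n ` carrier L.P = carrier (MP (Suc n))"
    using iso by (auto simp: ring_iso_def bij_betw_def)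
  have T: "mpoly_of_UP n ` L.lead_in_S \<subseteq> monic_mpolys R (Suc n) vec_lex_less"
    using mpoly_of_UP_lead by (auto simp: L.lead_in_S_def)
  have "dim_le_one_at (MP n) (monic_mpolys R n vec_lex_less)"
    using lex_arithmetical_dim[OF bezout_at_imp_arithmetical_at[OF bz] D] by blast
  then show ?case by (intro bezout_at_transfer[OF h T L.U.UP_cring] L.bezout_at_lead Suc)
qed

end

section \<open>From the lexicographic order to a rational order\<close>

lemma vec_add_right_cancel:
  fixes a b c :: "nat vec"
  assumes "a \<in> carrier_vec n" "b \<in> carrier_vec n" "c \<in> carrier_vec n" "a + c = b + c"
  shows "a = b"
proof (rule eq_vecI)
  show "dim_vec a = dim_vec b" using assms by simp
  fix i assume i: "i < dim_vec b"
  have "(a + c) $ i = (b + c) $ i" using assms(4) by simp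
  then show "a $ i = b $ i" using i assms(1-3) by simp
qed

lemma vec_add_minus:
  fixes a c :: "nat vec"
  assumes "a \<in> carrier_vec n" "c \<in> carrier_vec n"
  shows "a + c - c = a"
  by (rule eq_vecI) (use assms in auto)

text \<open>The order is pulled back from the lexicographic one along \<open>\<mu>\<close>, which for a rational
  order is \<open>e \<mapsto> M e\<close>. The last assumption says that the group generated by the image of \<open>\<mu>\<close>
  has finite index: every monomial divides one whose exponent lies in that group.\<close>

locale lex_pullback =
  fixes n :: nat and prec :: "nat vec \<Rightarrow> nat vec \<Rightarrow> bool" and \<mu> :: "nat vec \<Rightarrow> nat vec"
  assumes mu_closed: "d \<in> carrier_vec n \<Longrightarrow> \<mu> d \<in> carrier_vec n"
    and mu_add: "a \<in> carrier_vec n \<Longrightarrow> b \<in> carrier_vec n \<Longrightarrow> \<mu> (a + b) = \<mu> a + \<mu> b"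
    and mu_inj: "a \<in> carrier_vec n \<Longrightarrow> b \<in> carrier_vec n \<Longrightarrow> \<mu> a = \<mu> b \<Longrightarrow> a = b"
    and prec_mu: "a \<in> carrier_vec n \<Longrightarrow> b \<in> carrier_vec n \<Longrightarrow>
      prec a b \<longleftrightarrow> vec_lex_less (\<mu> a) (\<mu> b)"
    and mu_finite_index: "m \<in> carrier_vec n \<Longrightarrow>
      \<exists>c\<in>carrier_vec n. \<exists>a\<in>carrier_vec n. \<exists>b\<in>carrier_vec n. m + c + \<mu> a = \<mu> b"
begin

lemma monomial_order_prec: "monomial_order n prec"
proof -
  interpret L: monomial_order n vec_lex_less by (rule monomial_order_lex)
  show ?thesis
  proof
    show "\<not> prec e e" if "e \<in> carrier_vec n" for e
      using that L.irrefl mu_closed prec_mu by blast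
    show "prec a c" if "a \<in> carrier_vec n" "b \<in> carrier_vec n" "c \<in> carrier_vec n"
      "prec a b" "prec b c" for a b c
      using that L.trans[of "\<mu> a" "\<mu> b" "\<mu> c"] by (simp add: mu_closed prec_mu)
    show "prec a b \<or> prec b a" if "a \<in> carrier_vec n" "b \<in> carrier_vec n" "a \<noteq> b" for a b
      using that L.total[OF mu_closed mu_closed, of a b] mu_inj[OF that(1,2)] prec_mu by metis
    show "prec (a + c) (b + c)" if "a \<in> carrier_vec n" "b \<in> carrier_vec n" "c \<in> carrier_vec n"
      "prec a b" for a b c
      using that L.add[of "\<mu> a" "\<mu> b" "\<mu> c"] by (simp add: mu_closed prec_mu mu_add)
  qed
qed

lemma mu_zero: "\<mu> (0\<^sub>v n) = 0\<^sub>v n"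
proof (rule vec_add_right_cancel[of _ n _ "\<mu> (0\<^sub>v n)"])
  show "\<mu> (0\<^sub>v n) + \<mu> (0\<^sub>v n) = 0\<^sub>v n + \<mu> (0\<^sub>v n)"
    using mu_add[of "0\<^sub>v n" "0\<^sub>v n"] mu_closed[of "0\<^sub>v n"] by simp
qed (auto simp: mu_closed)

text \<open>Entries of \<open>\<mu> e\<close> are natural numbers, so nothing is lexicographically
  below zero.\<close>

lemma prec_zero:
  assumes "e \<in> carrier_vec n" "e \<noteq> 0\<^sub>v n"
  shows "prec (0\<^sub>v n) e"
proof -
  interpret W: monomial_order n prec by (rule monomial_order_prec)
  have "\<not> vec_lex_less (\<mu> e) (0\<^sub>v n)" using mu_closed[OF assms(1)] by (auto simp: vec_lex_less_def)
  then have "\<not> prec e (0\<^sub>v n)" using prec_mu[OF assms(1), of "0\<^sub>v n"] mu_zero by simp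
  then show ?thesis using W.total[OF assms(1), of "0\<^sub>v n"] assms by auto
qed

end

locale matrix_order = "domain" R + lex_pullback n prec \<mu>
  for R (structure) and n prec \<mu>
begin

sublocale W: cring_monomial_order R n prec
  by (intro cring_monomial_order.intro is_cring monomial_order_prec)

sublocale L: cring_monomial_order R n vec_lex_less
  by (intro cring_monomial_order.intro is_cring monomial_order_lex)

abbreviation mons where "mons \<equiv> carrier_vec n :: nat vec set"
abbreviation Q where "Q \<equiv> mpoly_ring R n"

lemma domain_Q: "domain Q" by (rule domain_mpoly)

lemma mu_inj_on: "inj_on \<mu> mons" using mu_inj by (auto intro: inj_onI)

section \<open>The substitution induced by \<open>\<mu>\<close>\<close>

definition phi :: "(nat vec \<Rightarrow> 'a) \<Rightarrow> nat vec \<Rightarrow> 'a" where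
  "phi f = (\<lambda>e. if e \<in> \<mu> ` mons then f (inv_into mons \<mu> e) else \<zero>)"

lemma phi_mu: "d \<in> mons \<Longrightarrow> phi f (\<mu> d) = f d"
  by (simp add: phi_def inv_into_f_f[OF mu_inj_on])

lemma phi_outside: "e \<notin> \<mu> ` mons \<Longrightarrow> phi f e = \<zero>" by (simp add: phi_def)

lemma phi_closed:
  assumes f: "f \<in> carrier Q"
  shows "phi f \<in> carrier Q"
proof (rule mpoly_carrierI)
  show "phi f e \<in> carrier R" for e
    using mpoly_coeff[OF f] by (auto simp: phi_def)
  show "phi f e = \<zero>" if "e \<notin> mons" for e
    using that mu_closed by (auto simp: phi_def)
  have "{e. phi f e \<noteq> \<zero>} \<subseteq> \<mu> ` {d. f d \<noteq> \<zero>}"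
  proof
    fix e assume "e \<in> {e. phi f e \<noteq> \<zero>}"
    then have e: "phi f e \<noteq> \<zero>" by simp
    then obtain d where "d \<in> mons" "e = \<mu> d" using phi_outside by blast
    then show "e \<in> \<mu> ` {d. f d \<noteq> \<zero>}" using e phi_mu by auto
  qed
  then show "finite {e. phi f e \<noteq> \<zero>}"
    by (rule finite_subset) (use mpoly_finite[OF f] in simp)
qed

lemma phi_mult:
  assumes f: "f \<in> carrier Q" and g: "g \<in> carrier Q"
  shows "phi (f \<otimes>\<^bsub>Q\<^esub> g) = phi f \<otimes>\<^bsub>Q\<^esub> phi g"
proof
  note cf = mpoly_coeff[OF f] mpoly_coeff[OF g]
    mpoly_coeff[OF phi_closed[OF f]] mpoly_coeff[OF phi_closed[OF g]]
  fix e
  show "phi (f \<otimes>\<^bsub>Q\<^esub> g) e = (phi f \<otimes>\<^bsub>Q\<^esub> phi g) e"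
  proof (cases "e \<in> \<mu> ` mons")
    case True
    then obtain d where d: "d \<in> mons" "e = \<mu> d" by blast
    let ?j = "\<lambda>(a, b). (\<mu> a, \<mu> b)"
    have "(phi f \<otimes>\<^bsub>Q\<^esub> phi g) e = finsum R (\<lambda>(x, y). phi f x \<otimes> phi g y) (splits n e)"
      using d mu_closed by (simp add: mpoly_mult)
    also have "\<dots> = finsum R (\<lambda>(x, y). phi f x \<otimes> phi g y) (?j ` splits n d)"
    proof (rule add.finprod_mono_neutral_cong_right)
      show "?j ` splits n d \<subseteq> splits n e"
        using d mu_closed mu_add by (auto simp: splits_def)
      fix z assume z: "z \<in> splits n e - ?j ` splits n d"
      obtain x y where xy: "z = (x, y)" by (cases z)
      have "phi f x = \<zero> \<or> phi g y = \<zero>"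
      proof (rule ccontr)
        assume "\<not> ?thesis"
        then obtain a b where ab: "a \<in> mons" "x = \<mu> a" "b \<in> mons" "y = \<mu> b"
          using phi_outside by blast
        have "\<mu> (a + b) = \<mu> d" using z xy ab d by (auto simp: splits_def mu_add)
        then have "a + b = d" using mu_inj ab d by simp
        then have "(a, b) \<in> splits n d" using ab by (simp add: splits_def)
        then show False using z xy ab by auto
      qed
      then show "(case z of (x, y) \<Rightarrow> phi f x \<otimes> phi g y) = \<zero>" using xy cf by auto
    qed (use cf in \<open>auto simp: split_beta\<close>)
    also have "\<dots> = finsum R (\<lambda>z. (\<lambda>(x, y). phi f x \<otimes> phi g y) (?j z)) (splits n d)"
      by (rule finsum_reindex) (use cf mu_inj in \<open>auto simp: split_beta inj_on_def splits_def\<close>)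
    also have "\<dots> = finsum R (\<lambda>(a, b). f a \<otimes> g b) (splits n d)"
      by (rule finsum_cong') (use cf phi_mu in \<open>auto simp: split_beta splits_def\<close>)
    also have "\<dots> = phi (f \<otimes>\<^bsub>Q\<^esub> g) e" using d by (simp add: phi_mu mpoly_mult)
    finally show ?thesis by simp
  next
    case False
    show ?thesis
    proof (cases "e \<in> mons")
      case True
      have "(\<lambda>(x, y). phi f x \<otimes> phi g y) z = \<zero>" if "z \<in> splits n e" for z
      proof -
        obtain x y where xy: "z = (x, y)" by (cases z)
        have "phi f x = \<zero> \<or> phi g y = \<zero>"
        proof (rule ccontr)
          assume "\<not> ?thesis"
          then obtain a b where ab: "a \<in> mons" "x = \<mu> a" "b \<in> mons" "y = \<mu> b"
            using phi_outside by blast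
          then have "e = \<mu> (a + b)" using that xy by (auto simp: splits_def mu_add)
          then show False using False ab by auto
        qed
        then show ?thesis using xy cf by auto
      qed
      then have "(phi f \<otimes>\<^bsub>Q\<^esub> phi g) e = \<zero>"
        unfolding mpoly_mult[OF True] by (intro add.finprod_one_eqI) auto
      then show ?thesis using phi_outside[OF False] by simp
    next
      case out: False
      then show ?thesis using phi_outside[OF False] by (simp add: mpoly_mult_outside)
    qed
  qed
qed

lemma phi_hom: "phi \<in> Ring.ring_hom Q Q"
proof (rule ring_hom_memI)
  show "phi f \<in> carrier Q" if "f \<in> carrier Q" for f by (rule phi_closed[OF that])
  show "phi (f \<otimes>\<^bsub>Q\<^esub> g) = phi f \<otimes>\<^bsub>Q\<^esub> phi g" if "f \<in> carrier Q" "g \<in> carrier Q" for f g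
    by (rule phi_mult[OF that])
  show "phi (f \<oplus>\<^bsub>Q\<^esub> g) = phi f \<oplus>\<^bsub>Q\<^esub> phi g" if "f \<in> carrier Q" "g \<in> carrier Q" for f g
  proof
    fix e show "phi (f \<oplus>\<^bsub>Q\<^esub> g) e = (phi f \<oplus>\<^bsub>Q\<^esub> phi g) e"
      by (cases "e \<in> \<mu> ` mons") (use that in \<open>auto simp: mpoly_add phi_closed phi_mu phi_outside\<close>)
  qed
  show "phi \<one>\<^bsub>Q\<^esub> = \<one>\<^bsub>Q\<^esub>"
  proof
    fix e show "phi \<one>\<^bsub>Q\<^esub> e = \<one>\<^bsub>Q\<^esub> e"
    proof (cases "e \<in> \<mu> ` mons")
      case True
      then obtain d where d: "d \<in> mons" "e = \<mu> d" by blast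
      have "\<mu> d = 0\<^sub>v n \<longleftrightarrow> d = 0\<^sub>v n" using mu_inj[of d "0\<^sub>v n"] d mu_zero by auto
      then show ?thesis using d by (simp add: phi_mu mpoly_one)
    next
      case False
      then have "e \<noteq> 0\<^sub>v n" using mu_zero by (metis imageI zero_carrier_vec)
      then show ?thesis using phi_outside[OF False] by (simp add: mpoly_one)
    qed
  qed
qed

lemma phi_nonzero:
  assumes "f \<in> carrier Q" "f \<noteq> \<zero>\<^bsub>Q\<^esub>"
  shows "phi f \<noteq> \<zero>\<^bsub>Q\<^esub>"
proof -
  obtain d where d: "d \<in> mons" "f d \<noteq> \<zero>" using W.exists_top[OF assms] by blast
  then have "phi f (\<mu> d) \<noteq> \<zero>" by (simp add: phi_mu)
  then show ?thesis by (auto simp: mpoly_zero)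
qed

section \<open>Shifting supports into the image of \<open>\<mu>\<close>\<close>

text \<open>Each \<open>e + c\<close> in the group generated by the image is moved into the image by
  some \<open>\<mu> x\<close> of its own; the sum of these finitely many \<open>x\<close> serves
  all, because the image is closed under addition.\<close>

lemma exists_absorbing:
  assumes "finite E" "E \<subseteq> mons" and c: "c \<in> mons"
  shows "\<exists>w\<in>mons. \<forall>e\<in>E. (\<exists>x\<in>mons. \<exists>d\<in>mons. e + c + \<mu> x = \<mu> d) \<longrightarrow> e + c + \<mu> w \<in> \<mu> ` mons"
  using assms(1,2)
proof (induction E)
  case empty
  show ?case by (intro bexI[of _ "0\<^sub>v n"]) auto
next
  case (insert e E)
  then obtain w where w: "w \<in> mons" and wE: "\<And>e x d. e \<in> E \<Longrightarrow> x \<in> mons \<Longrightarrow> d \<in> mons \<Longrightarrow>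
      e + c + \<mu> x = \<mu> d \<Longrightarrow> e + c + \<mu> w \<in> \<mu> ` mons" by blast
  show ?case
  proof (cases "\<exists>x\<in>mons. \<exists>d\<in>mons. e + c + \<mu> x = \<mu> d")
    case False
    then show ?thesis using w wE by (intro bexI[of _ w]) blast+
  next
    case True
    then obtain x d where x: "x \<in> mons" "d \<in> mons" "e + c + \<mu> x = \<mu> d" by blast
    have m: "\<mu> w \<in> mons" "\<mu> x \<in> mons" using w x mu_closed by auto
    have "e' + c + \<mu> (w + x) \<in> \<mu> ` mons"
      if "e' \<in> insert e E" "\<exists>x\<in>mons. \<exists>d\<in>mons. e' + c + \<mu> x = \<mu> d" for e'
    proof (cases "e' = e")
      case True
      have ec: "e \<in> mons" using insert by simp
      have "e + c + \<mu> (w + x) = (e + c + \<mu> x) + \<mu> w"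
        unfolding mu_add[OF w x(1)] by (rule eq_vecI) (use m ec c in auto)
      also have "\<dots> = \<mu> (d + w)" using x w by (simp add: mu_add)
      finally show ?thesis using True x w by auto
    next
      case False
      then have "e' + c + \<mu> w \<in> \<mu> ` mons" using that wE by blast
      then obtain y where y: "y \<in> mons" "e' + c + \<mu> w = \<mu> y" by blast
      have ec: "e' \<in> mons" using insert that by auto
      have "e' + c + \<mu> (w + x) = (e' + c + \<mu> w) + \<mu> x"
        unfolding mu_add[OF w x(1)] by (rule eq_vecI) (use m ec c in auto)
      also have "\<dots> = \<mu> (y + x)" using x y by (simp add: mu_add)
      finally show ?thesis using y x by auto
    qed
    then show ?thesis using w x by (intro bexI[of _ "w + x"]) auto
  qed
qed

text \<open>For exponents in \<open>E\<close>, a good shift moves the group generated by the image of \<open>\<mu>\<close> into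
  that image. This makes \<open>shift t\<close> below, which undoes \<open>phi\<close> on the part of \<open>X\<^sup>t p\<close> supported in
  the image of \<open>\<mu>\<close>, linear over \<open>phi\<close>.\<close>

definition good_shift :: "nat vec set \<Rightarrow> nat vec \<Rightarrow> bool" where
  "good_shift E t \<longleftrightarrow> t \<in> mons \<and>
     (\<forall>e\<in>E. \<forall>x\<in>mons. \<forall>d\<in>mons. e + t + \<mu> x = \<mu> d \<longrightarrow> e + t \<in> \<mu> ` mons)"

text \<open>Take \<open>t = c + \<mu> w\<close> with \<open>c\<close> bringing \<open>m\<close> into
  the group generated by the image. Adding \<open>\<mu> w\<close> does not change the class modulo
  that group, so the exponents that \<open>t\<close> brings into the group are those already
  absorbed by \<open>w\<close>.\<close>

lemma exists_good_shift:
  assumes "finite E" "E \<subseteq> mons" and m: "m \<in> mons"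
  shows "\<exists>t. good_shift E t \<and> m + t \<in> \<mu> ` mons"
proof -
  obtain c a b where c: "c \<in> mons" "a \<in> mons" "b \<in> mons" "m + c + \<mu> a = \<mu> b"
    using mu_finite_index[OF m] by blast
  \<comment> \<open>\<open>m\<close> joins the exponents to be absorbed so that \<open>m + t\<close>
    ends up in the image and not merely in the group.\<close>
  have "finite (insert m E)" "insert m E \<subseteq> mons" using assms by auto
  from exists_absorbing[OF this c(1)] obtain w where w: "w \<in> mons"
    and wE: "\<forall>e\<in>insert m E. (\<exists>x\<in>mons. \<exists>d\<in>mons. e + c + \<mu> x = \<mu> d) \<longrightarrow> e + c + \<mu> w \<in> \<mu> ` mons"
    by blast
  define t where "t = c + \<mu> w"
  have mw: "\<mu> w \<in> mons" using w mu_closed by simp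
  have t: "t \<in> mons" using c mw by (simp add: t_def)
  have et: "e + t = e + c + \<mu> w" if "e \<in> mons" for e
    unfolding t_def using that c mw by (simp add: assoc_add_vec[of e n])
  have "e + t \<in> \<mu> ` mons" if e: "e \<in> E" and x: "x \<in> mons" "d \<in> mons" "e + t + \<mu> x = \<mu> d" for e x d
  proof -
    have ec: "e \<in> mons" using e assms by blast
    have "e + c + \<mu> (w + x) = e + t + \<mu> x"
      unfolding mu_add[OF w x(1)] t_def
      by (rule eq_vecI) (use ec c mw mu_closed[OF x(1)] in auto)
    then have "e + c + \<mu> (w + x) = \<mu> d" using x by simp
    moreover have "w + x \<in> mons" using w x by simp
    ultimately have "e + c + \<mu> w \<in> \<mu> ` mons" using wE e x(2) by blast
    then show ?thesis using et[OF ec] by simp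
  qed
  moreover have "m + t \<in> \<mu> ` mons" using wE c et[OF m] by auto
  ultimately show ?thesis using t unfolding good_shift_def by blast
qed

text \<open>Subtraction of natural vectors truncates, so the guard asks for a true difference
  \<open>e\<close> before \<open>\<mu> d - t\<close> is used.\<close>

definition shift :: "nat vec \<Rightarrow> (nat vec \<Rightarrow> 'a) \<Rightarrow> nat vec \<Rightarrow> 'a" where
  "shift t p = (\<lambda>d. if d \<in> mons \<and> (\<exists>e\<in>mons. e + t = \<mu> d) then p (\<mu> d - t) else \<zero>)"

lemma shift_eq:
  assumes "t \<in> mons" "d \<in> mons" "e \<in> mons" "e + t = \<mu> d"
  shows "shift t p d = p e"
proof -
  have "\<mu> d - t = e" using vec_add_minus[OF assms(3,1)] assms(4) by simp
  then show ?thesis using assms by (auto simp: shift_def)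
qed

lemma shift_cases:
  obtains "shift t p d = \<zero>" | e where "d \<in> mons" "e \<in> mons" "e + t = \<mu> d"
  by (cases "d \<in> mons \<and> (\<exists>e\<in>mons. e + t = \<mu> d)") (auto simp: shift_def)

lemma shift_closed:
  assumes p: "p \<in> carrier Q" and t: "t \<in> mons"
  shows "shift t p \<in> carrier Q"
proof (rule mpoly_carrierI)
  show "shift t p d \<in> carrier R" for d
    using mpoly_coeff[OF p] by (auto simp: shift_def)
  show "shift t p d = \<zero>" if "d \<notin> mons" for d using that by (simp add: shift_def)
  have "\<mu> ` {d. shift t p d \<noteq> \<zero>} \<subseteq> (\<lambda>e. e + t) ` {e. p e \<noteq> \<zero>}"
  proof
    fix x assume "x \<in> \<mu> ` {d. shift t p d \<noteq> \<zero>}"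
    then obtain d where d: "shift t p d \<noteq> \<zero>" "x = \<mu> d" by blast
    then obtain e where e: "d \<in> mons" "e \<in> mons" "e + t = \<mu> d" using shift_cases by metis
    then have "p e \<noteq> \<zero>" using d shift_eq[OF t e] by simp
    moreover have "x = e + t" using d e by simp
    ultimately show "x \<in> (\<lambda>e. e + t) ` {e. p e \<noteq> \<zero>}" by blast
  qed
  then have "finite (\<mu> ` {d. shift t p d \<noteq> \<zero>})"
    by (rule finite_subset) (use mpoly_finite[OF p] in simp)
  moreover have "inj_on \<mu> {d. shift t p d \<noteq> \<zero>}"
    by (rule inj_on_subset[OF mu_inj_on]) (auto simp: shift_def split: if_splits)
  ultimately show "finite {d. shift t p d \<noteq> \<zero>}" by (rule finite_imageD)
qed

lemma shift_add:
  assumes "p \<in> carrier Q" "q \<in> carrier Q" "t \<in> mons"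
  shows "shift t (p \<oplus>\<^bsub>Q\<^esub> q) = shift t p \<oplus>\<^bsub>Q\<^esub> shift t q"
proof
  fix d
  define c where "c \<longleftrightarrow> d \<in> mons \<and> (\<exists>e\<in>mons. e + t = \<mu> d)"
  have e: "shift t r d = (if c then r (\<mu> d - t) else \<zero>)" for r by (simp add: shift_def c_def)
  show "shift t (p \<oplus>\<^bsub>Q\<^esub> q) d = (shift t p \<oplus>\<^bsub>Q\<^esub> shift t q) d"
    unfolding mpoly_add[OF shift_closed[OF assms(1,3)] shift_closed[OF assms(2,3)]]
    by (simp add: e mpoly_add[OF assms(1,2)])
qed

text \<open>The coefficient at \<open>\<mu> d\<close> of \<open>X^t p phi f\<close> collects the
  pairs \<open>x\<close>, \<open>\<mu> b\<close> with \<open>x + t + \<mu> b = \<mu> d\<close>. For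
  a good shift \<open>x + t\<close> is then some \<open>\<mu> a\<close>, and the pair comes from the
  splitting \<open>a + b = d\<close>.\<close>

lemma shift_mult_phi:
  assumes p: "p \<in> carrier Q" and f: "f \<in> carrier Q" and E: "{e. p e \<noteq> \<zero>} \<subseteq> E"
    and good: "good_shift E t"
  shows "shift t (p \<otimes>\<^bsub>Q\<^esub> phi f) = shift t p \<otimes>\<^bsub>Q\<^esub> f"
proof
  have t: "t \<in> mons" using good by (simp add: good_shift_def)
  have gd: "e + t \<in> \<mu> ` mons" if "p e \<noteq> \<zero>" "x \<in> mons" "d \<in> mons" "e + t + \<mu> x = \<mu> d" for e x d
    using good E that unfolding good_shift_def by blast
  note cf = mpoly_coeff[OF p] mpoly_coeff[OF f] mpoly_coeff[OF shift_closed[OF p t]]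
    mpoly_coeff[OF phi_closed[OF f]]
  fix d
  show "shift t (p \<otimes>\<^bsub>Q\<^esub> phi f) d = (shift t p \<otimes>\<^bsub>Q\<^esub> f) d"
  proof (cases "d \<in> mons")
    case False
    then show ?thesis by (simp add: shift_def mpoly_mult_outside)
  next
    case d: True
    define T where "T = {(a, b). (a, b) \<in> splits n d \<and> (\<exists>x\<in>mons. x + t = \<mu> a)}"
    have T_sub: "T \<subseteq> splits n d" by (auto simp: T_def)
    have rhs: "(shift t p \<otimes>\<^bsub>Q\<^esub> f) d = finsum R (\<lambda>(a, b). shift t p a \<otimes> f b) T"
      unfolding mpoly_mult[OF d]
    proof (rule add.finprod_mono_neutral_cong_right)
      fix z assume z: "z \<in> splits n d - T"
      then have "shift t p (fst z) = \<zero>" by (auto simp: T_def shift_def)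
      then show "(case z of (a, b) \<Rightarrow> shift t p a \<otimes> f b) = \<zero>" using cf by (simp add: split_beta)
    qed (use T_sub cf in \<open>auto simp: split_beta\<close>)
    show ?thesis
    proof (cases "\<exists>e\<in>mons. e + t = \<mu> d")
      case False
      \<comment> \<open>If \<open>\<mu> d\<close> is out of reach of \<open>t\<close>, so is
        \<open>\<mu> a\<close> for every splitting: from \<open>x + t = \<mu> a\<close> would follow
        \<open>(x + \<mu> b) + t = \<mu> d\<close>.\<close>
      have "T = {}"
      proof (rule equals0I)
        fix z assume "z \<in> T"
        then obtain a b x where *: "a \<in> mons" "b \<in> mons" "a + b = d" "x \<in> mons" "x + t = \<mu> a"
          by (auto simp: T_def splits_def)
        have "x + \<mu> b + t = (x + t) + \<mu> b"
          by (rule eq_vecI) (use *(1,2,4) t mu_closed[OF *(2)] in auto)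
        also have "\<dots> = \<mu> d" using * by (auto simp: mu_add)
        finally show False using False * mu_closed by auto
      qed
      then show ?thesis using rhs False by (simp add: shift_def)
    next
      case True
      then obtain e where e: "e \<in> mons" "e + t = \<mu> d" by blast
      let ?j = "\<lambda>(a, b). (\<mu> a - t, \<mu> b)"
      have jT: "\<exists>x. x \<in> mons \<and> x + t = \<mu> a \<and> \<mu> a - t = x \<and> (x, \<mu> b) \<in> splits n e \<and> a \<in> mons \<and> b \<in> mons"
        if "(a, b) \<in> T" for a b
      proof -
        obtain x where *: "a \<in> mons" "b \<in> mons" "a + b = d" "x \<in> mons" "x + t = \<mu> a"
          using \<open>(a, b) \<in> T\<close> by (auto simp: T_def splits_def)
        have "x + \<mu> b + t = (x + t) + \<mu> b"
          by (rule eq_vecI) (use *(1,2,4) t mu_closed[OF *(2)] in auto)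
        also have "\<dots> = e + t" using * e by (auto simp: mu_add)
        finally have "x + \<mu> b = e"
          by (intro vec_add_right_cancel[of "x + \<mu> b" n e t]) (use * e t mu_closed in auto)
        moreover have "\<mu> a - t = x" using vec_add_minus[OF *(4) t] *(5) by simp
        ultimately show ?thesis using * mu_closed by (auto simp: splits_def)
      qed
      have "shift t (p \<otimes>\<^bsub>Q\<^esub> phi f) d = (p \<otimes>\<^bsub>Q\<^esub> phi f) e" by (rule shift_eq[OF t d e])
      also have "\<dots> = finsum R (\<lambda>(x, y). p x \<otimes> phi f y) (splits n e)" by (rule mpoly_mult[OF e(1)])
      also have "\<dots> = finsum R (\<lambda>(x, y). p x \<otimes> phi f y) (?j ` T)"
      proof (rule add.finprod_mono_neutral_cong_right)
        show "?j ` T \<subseteq> splits n e" using jT by fastforce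
        fix z assume z: "z \<in> splits n e - ?j ` T"
        obtain x y where xy: "z = (x, y)" by (cases z)
        have c: "x \<in> mons" "y \<in> mons" "x + y = e" using z xy by (auto simp: splits_def)
        have "p x = \<zero> \<or> phi f y = \<zero>"
        proof (rule ccontr)
          assume no: "\<not> ?thesis"
          then obtain b where b: "b \<in> mons" "y = \<mu> b" using phi_outside by blast
          have xt: "x + t + \<mu> b = \<mu> d"
          proof -
            have "x + t + \<mu> b = (x + y) + t"
              unfolding b(2)[symmetric] by (rule eq_vecI) (use c t in auto)
            then show ?thesis using c(3) e(2) by simp
          qed
          then obtain a where a: "a \<in> mons" "x + t = \<mu> a" using gd no b d by blast
          have "\<mu> (a + b) = \<mu> d" using a b xt by (simp add: mu_add)
          then have "a + b = d" using mu_inj a b d by simp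
          then have "(a, b) \<in> T" using a b c by (auto simp: T_def splits_def)
          moreover have "\<mu> a - t = x" using vec_add_minus[OF c(1) t] a by simp
          ultimately show False using z xy b by force
        qed
        then show "(case z of (x, y) \<Rightarrow> p x \<otimes> phi f y) = \<zero>" using xy cf by auto
      qed (use cf in \<open>auto simp: split_beta\<close>)
      also have "\<dots> = finsum R (\<lambda>z. (\<lambda>(x, y). p x \<otimes> phi f y) (?j z)) T"
      proof (rule finsum_reindex)
        show "inj_on ?j T"
        proof (rule inj_onI, clarify)
          fix a b a' b' assume T: "(a, b) \<in> T" "(a', b') \<in> T" and eq: "\<mu> a - t = \<mu> a' - t" "\<mu> b = \<mu> b'"
          have "\<mu> a = \<mu> a'" using jT[OF T(1)] jT[OF T(2)] eq(1) by metis
          then show "a = a' \<and> b = b'" using jT[OF T(1)] jT[OF T(2)] eq(2) mu_inj by blast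
        qed
      qed (use cf in \<open>auto simp: split_beta\<close>)
      also have "\<dots> = finsum R (\<lambda>(a, b). shift t p a \<otimes> f b) T"
      proof (rule finsum_cong')
        fix z assume z: "z \<in> T"
        obtain a b where ab: "z = (a, b)" by (cases z)
        obtain x where x: "x \<in> mons" "x + t = \<mu> a" "\<mu> a - t = x" "a \<in> mons" "b \<in> mons"
          using jT z ab by blast
        then show "(\<lambda>(x, y). p x \<otimes> phi f y) (?j z) = (case z of (a, b) \<Rightarrow> shift t p a \<otimes> f b)"
          using ab shift_eq[OF t x(4,1,2)] by (simp add: phi_mu)
      qed (use cf in \<open>auto simp: split_beta\<close>)
      finally show ?thesis using rhs by simp
    qed
  qed
qed

text \<open>Adding \<open>t\<close> preserves and reflects the lexicographic order and
  \<open>\<mu>\<close> translates it into \<open>prec\<close>, so the top term at \<open>m\<close>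
  becomes the top term at \<open>d\<close>.\<close>

lemma shift_top:
  assumes s: "s \<in> carrier Q" "m \<in> mons" "L.vabove s m" and t: "t \<in> mons"
    and d: "d \<in> mons" "m + t = \<mu> d"
  shows "shift t s d = s m" "W.vabove (shift t s) d"
proof -
  show "shift t s d = s m" by (rule shift_eq[OF t d(1) s(2) d(2)])
  show "W.vabove (shift t s) d"
    unfolding vanishes_above_def
  proof (intro ballI impI)
    fix d' assume d': "d' \<in> mons" "prec d d'"
    show "shift t s d' = \<zero>"
    proof (cases rule: shift_cases[of t s d'])
      case (2 e)
      have lt: "vec_lex_less (m + t) (e + t)" using d' d prec_mu[of d d'] 2 by simp
      have "vec_lex_less m e"
      proof (rule ccontr)
        assume "\<not> vec_lex_less m e"
        then have "m = e \<or> vec_lex_less e m" using L.total s(2) 2 by blast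
        then have "m + t = e + t \<or> vec_lex_less (e + t) (m + t)"
          using L.add[OF 2(2) s(2) t] by blast
        moreover have c: "m + t \<in> mons" "e + t \<in> mons"
          by (rule add_carrier_vec[OF s(2) t] add_carrier_vec[OF 2(2) t])+
        ultimately show False
          using lt L.irrefl[OF c(1)] L.trans[OF c(1,2,1) lt] by auto
      qed
      then have "s e = \<zero>" using s(3) 2 unfolding vanishes_above_def by blast
      then show ?thesis using shift_eq[OF t 2] by simp
    qed
  qed
qed

text \<open>The exponent \<open>m\<close> is fixed before \<open>t\<close>, because \<open>t\<close>
  is chosen for it afterwards.\<close>

lemma shift_monic:
  assumes "s \<in> L.monics"
  shows "\<exists>m\<in>mons. \<forall>t\<in>mons. m + t \<in> \<mu> ` mons \<longrightarrow> shift t s \<in> W.monics"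
proof -
  obtain m where m: "s \<in> carrier Q" "m \<in> mons" "s m = \<one>" "L.vabove s m"
    using assms L.monics_iff by blast
  have "shift t s \<in> W.monics" if t: "t \<in> mons" "m + t \<in> \<mu> ` mons" for t
  proof -
    obtain d where d: "d \<in> mons" "m + t = \<mu> d" using t by blast
    show ?thesis
      using shift_top[OF m(1,2,4) t(1) d] d m(3)
      by (intro W.monicsI[OF shift_closed[OF m(1) t(1)] d(1)]) simp_all
  qed
  then show ?thesis using m(2) by blast
qed

definition supp :: "(nat vec \<Rightarrow> 'a) \<Rightarrow> nat vec set" where
  "supp p = {e. p e \<noteq> \<zero>}"

lemma supp: "p \<in> carrier Q \<Longrightarrow> finite (supp p)" "p \<in> carrier Q \<Longrightarrow> supp p \<subseteq> mons"
  using mpoly_finite[of p n] mpoly_outside[of p n] by (auto simp: supp_def)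

lemma good_shift_mult:
  "p \<in> carrier Q \<Longrightarrow> f \<in> carrier Q \<Longrightarrow> supp p \<subseteq> E \<Longrightarrow> good_shift E t \<Longrightarrow>
     shift t (p \<otimes>\<^bsub>Q\<^esub> phi f) = shift t p \<otimes>\<^bsub>Q\<^esub> f"
  by (rule shift_mult_phi) (auto simp: supp_def)

lemma good_shiftD: "good_shift E t \<Longrightarrow> t \<in> mons" by (simp add: good_shift_def)

section \<open>Descent from the lexicographic to the given order\<close>

text \<open>The equations are linear in \<open>p\<close>, \<open>q\<close>, \<open>x\<close>,
  \<open>y\<close> with coefficients from the image of \<open>phi\<close>. A shift that is good for
  the union of the four supports maps them to equations over \<open>f\<close> and
  \<open>g\<close>.\<close>

theorem arithmetical_at_descent:
  assumes ar: "arithmetical_at Q L.monics"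
  shows "arithmetical_at Q W.monics"
proof (rule arithmetical_atI)
  fix f g assume f: "f \<in> carrier Q" and g: "g \<in> carrier Q"
  obtain p q x y where k: "p \<in> carrier Q" "q \<in> carrier Q" "x \<in> carrier Q" "y \<in> carrier Q"
    and e: "p \<oplus>\<^bsub>Q\<^esub> q \<in> L.monics" "p \<otimes>\<^bsub>Q\<^esub> phi f = x \<otimes>\<^bsub>Q\<^esub> phi g" "q \<otimes>\<^bsub>Q\<^esub> phi g = y \<otimes>\<^bsub>Q\<^esub> phi f"
    by (rule arithmetical_atE[OF ar phi_closed[OF f] phi_closed[OF g]])
  obtain m where m: "m \<in> mons"
    and mt: "\<And>t. t \<in> mons \<Longrightarrow> m + t \<in> \<mu> ` mons \<Longrightarrow> shift t (p \<oplus>\<^bsub>Q\<^esub> q) \<in> W.monics"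
    using shift_monic[OF e(1)] by blast
  let ?E = "supp p \<union> supp q \<union> supp x \<union> supp y"
  have fin: "finite ?E" "?E \<subseteq> mons" using supp k by auto
  from exists_good_shift[OF fin m] obtain t where t: "good_shift ?E t" "m + t \<in> \<mu> ` mons"
      by (elim exE conjE) (rule that)
  have sub: "supp p \<subseteq> ?E" "supp q \<subseteq> ?E" "supp x \<subseteq> ?E" "supp y \<subseteq> ?E" by auto
  note tc = good_shiftD[OF t(1)]
  have "shift t p \<oplus>\<^bsub>Q\<^esub> shift t q \<in> W.monics" using mt[OF tc t(2)] shift_add[OF k(1,2) tc] by simp
  moreover have "shift t p \<otimes>\<^bsub>Q\<^esub> f = shift t x \<otimes>\<^bsub>Q\<^esub> g"
    using good_shift_mult[OF k(1) f sub(1) t(1)] good_shift_mult[OF k(3) g sub(3) t(1)] e(2) by auto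
  moreover have "shift t q \<otimes>\<^bsub>Q\<^esub> g = shift t y \<otimes>\<^bsub>Q\<^esub> f"
    using good_shift_mult[OF k(2) g sub(2) t(1)] good_shift_mult[OF k(4) f sub(4) t(1)] e(3) by auto
  ultimately show "\<exists>p q x y. p \<in> carrier Q \<and> q \<in> carrier Q \<and> x \<in> carrier Q \<and> y \<in> carrier Q \<and>
      p \<oplus>\<^bsub>Q\<^esub> q \<in> W.monics \<and> p \<otimes>\<^bsub>Q\<^esub> f = x \<otimes>\<^bsub>Q\<^esub> g \<and> q \<otimes>\<^bsub>Q\<^esub> g = y \<otimes>\<^bsub>Q\<^esub> f"
    using shift_closed[OF _ tc] k
    by (intro exI[of _ "shift t p"] exI[of _ "shift t q"] exI[of _ "shift t x"] exI[of _ "shift t y"]) simp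
qed

text \<open>With the powers of \<open>g\<close> kept as coefficients, the equation is linear in
  \<open>s\<close>, \<open>u\<close>, \<open>v\<close>.\<close>

theorem dim_le_one_at_descent:
  assumes D: "dim_le_one_at Q L.monics"
  shows "dim_le_one_at Q W.monics"
proof (rule dim_le_one_atI)
  fix f g assume f: "f \<in> carrier Q" "f \<noteq> \<zero>\<^bsub>Q\<^esub>" and g: "g \<in> carrier Q"
  obtain k s u v where s: "s \<in> L.monics" and k: "u \<in> carrier Q" "v \<in> carrier Q"
    and e: "phi g [^]\<^bsub>Q\<^esub> (k::nat) \<otimes>\<^bsub>Q\<^esub> s = phi f \<otimes>\<^bsub>Q\<^esub> u \<oplus>\<^bsub>Q\<^esub> phi g [^]\<^bsub>Q\<^esub> Suc k \<otimes>\<^bsub>Q\<^esub> v"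
    by (rule dim_le_one_atE[OF D phi_closed[OF f(1)] phi_nonzero[OF f] phi_closed[OF g]])
  have sc: "s \<in> carrier Q" using s L.monics_iff by blast
  note pow = ring_hom_nat_pow[OF cring_mpoly cring_mpoly phi_hom g]
  define G H where "G = g [^]\<^bsub>Q\<^esub> k" and "H = g [^]\<^bsub>Q\<^esub> Suc k"
  have GH: "G \<in> carrier Q" "H \<in> carrier Q" 
    unfolding G_def H_def by (rule W.Q.nat_pow_closed[OF g])+
  have e': "phi G \<otimes>\<^bsub>Q\<^esub> s = phi f \<otimes>\<^bsub>Q\<^esub> u \<oplus>\<^bsub>Q\<^esub> phi H \<otimes>\<^bsub>Q\<^esub> v"
    unfolding G_def H_def pow by (rule e)
  note pc = phi_closed[OF GH(1)] phi_closed[OF GH(2)] phi_closed[OF f(1)]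
  have e'': "s \<otimes>\<^bsub>Q\<^esub> phi G = u \<otimes>\<^bsub>Q\<^esub> phi f \<oplus>\<^bsub>Q\<^esub> v \<otimes>\<^bsub>Q\<^esub> phi H"
    using e' pc sc k by (simp add: W.Q.m_comm)
  obtain m where m: "m \<in> mons"
    and mt: "\<And>t. t \<in> mons \<Longrightarrow> m + t \<in> \<mu> ` mons \<Longrightarrow> shift t s \<in> W.monics"
    using shift_monic[OF s] by blast
  let ?E = "supp s \<union> supp u \<union> supp v"
  have fin: "finite ?E" "?E \<subseteq> mons" using supp k sc by auto
  from exists_good_shift[OF fin m] obtain t where t: "good_shift ?E t" "m + t \<in> \<mu> ` mons"
      by (elim exE conjE) (rule that)
  have sub: "supp s \<subseteq> ?E" "supp u \<subseteq> ?E" "supp v \<subseteq> ?E" by auto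
  note tc = good_shiftD[OF t(1)]
  have "shift t s \<otimes>\<^bsub>Q\<^esub> G = shift t (s \<otimes>\<^bsub>Q\<^esub> phi G)"
    using good_shift_mult[OF sc GH(1) sub(1) t(1)] by auto
  also have "\<dots> = shift t (u \<otimes>\<^bsub>Q\<^esub> phi f) \<oplus>\<^bsub>Q\<^esub> shift t (v \<otimes>\<^bsub>Q\<^esub> phi H)"
    unfolding e'' by (rule shift_add) (use k pc tc in auto)
  also have "\<dots> = shift t u \<otimes>\<^bsub>Q\<^esub> f \<oplus>\<^bsub>Q\<^esub> shift t v \<otimes>\<^bsub>Q\<^esub> H"
    using good_shift_mult[OF k(1) f(1) sub(2) t(1)] good_shift_mult[OF k(2) GH(2) sub(3) t(1)] by auto
  finally have eq: "G \<otimes>\<^bsub>Q\<^esub> shift t s = f \<otimes>\<^bsub>Q\<^esub> shift t u \<oplus>\<^bsub>Q\<^esub> H \<otimes>\<^bsub>Q\<^esub> shift t v"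
    using shift_closed[OF _ tc] k sc GH f by (simp add: W.Q.m_comm)
  note mem = mt[OF tc t(2)] shift_closed[OF k(1) tc] shift_closed[OF k(2) tc]
  show "\<exists>(k::nat) s u v. s \<in> W.monics \<and> u \<in> carrier Q \<and> v \<in> carrier Q \<and>
      g [^]\<^bsub>Q\<^esub> k \<otimes>\<^bsub>Q\<^esub> s = f \<otimes>\<^bsub>Q\<^esub> u \<oplus>\<^bsub>Q\<^esub> g [^]\<^bsub>Q\<^esub> Suc k \<otimes>\<^bsub>Q\<^esub> v"
    by (intro exI[of _ k] exI[of _ "shift t s"] exI[of _ "shift t u"] exI[of _ "shift t v"] conjI)
      (fact mem eq[unfolded G_def H_def])+
qed

text \<open>For the lexicographic order \<open>d = u \<phi>(f) + v \<phi>(g)\<close> generates the ideal of \<open>\<phi>(f), \<phi>(g)\<close>.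
  The element \<open>h\<close> obtained from \<open>d\<close> by shifting has the same leading coefficient as \<open>d\<close>, so
  that \<open>\<phi>(h)\<close> and \<open>d\<close> differ by a unit and \<open>h\<close> generates the ideal of \<open>f, g\<close>.\<close>

theorem bezout_at_descent:
  assumes bz: "bezout_at Q L.monics"
  shows "bezout_at Q W.monics"
proof (rule bezout_atI)
  fix f g assume f: "f \<in> carrier Q" and g: "g \<in> carrier Q"
  let ?goal = "\<exists>x y u v. x \<in> carrier Q \<and> y \<in> carrier Q \<and> u \<in> carrier Q \<and> v \<in> carrier Q \<and>
      f \<otimes>\<^bsub>Q\<^esub> y = g \<otimes>\<^bsub>Q\<^esub> x \<and> u \<otimes>\<^bsub>Q\<^esub> x \<oplus>\<^bsub>Q\<^esub> v \<otimes>\<^bsub>Q\<^esub> y \<in> W.monics"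
  note cancel = domain.m_lcancel[OF domain_Q]
  show ?goal
  proof (cases "f = \<zero>\<^bsub>Q\<^esub> \<and> g = \<zero>\<^bsub>Q\<^esub>")
    case True
    then show ?thesis
      using submonoid.one_closed[OF W.submonoid_monics]
      by (intro exI[of _ "\<one>\<^bsub>Q\<^esub>"] exI[of _ "\<zero>\<^bsub>Q\<^esub>"]) simp
  next
    case nz: False
    define F G where "F = phi f" and "G = phi g"
    have FG: "F \<in> carrier Q" "G \<in> carrier Q" using f g phi_closed by (auto simp: F_def G_def)
    have FGnz: "\<not> (F = \<zero>\<^bsub>Q\<^esub> \<and> G = \<zero>\<^bsub>Q\<^esub>)"
      using nz phi_nonzero f g by (auto simp: F_def G_def)
    obtain x y u v where k: "x \<in> carrier Q" "y \<in> carrier Q" "u \<in> carrier Q" "v \<in> carrier Q"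
      and e: "F \<otimes>\<^bsub>Q\<^esub> y = G \<otimes>\<^bsub>Q\<^esub> x" and s: "u \<otimes>\<^bsub>Q\<^esub> x \<oplus>\<^bsub>Q\<^esub> v \<otimes>\<^bsub>Q\<^esub> y \<in> L.monics"
      by (rule bezout_atE[OF bz FG])
    define S where "S = u \<otimes>\<^bsub>Q\<^esub> x \<oplus>\<^bsub>Q\<^esub> v \<otimes>\<^bsub>Q\<^esub> y"
    have S: "S \<in> carrier Q" "S \<in> L.monics" using k s by (auto simp: S_def)
    have S0: "S \<noteq> \<zero>\<^bsub>Q\<^esub>" using S L.zero_notin_monics by auto
    define D where "D = u \<otimes>\<^bsub>Q\<^esub> F \<oplus>\<^bsub>Q\<^esub> v \<otimes>\<^bsub>Q\<^esub> G"
    have D: "D \<in> carrier Q" using k FG by (simp add: D_def)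
    have "D \<otimes>\<^bsub>Q\<^esub> x = F \<otimes>\<^bsub>Q\<^esub> (u \<otimes>\<^bsub>Q\<^esub> x) \<oplus>\<^bsub>Q\<^esub> v \<otimes>\<^bsub>Q\<^esub> (G \<otimes>\<^bsub>Q\<^esub> x)"
      unfolding D_def using k FG by algebra
    also have "\<dots> = S \<otimes>\<^bsub>Q\<^esub> F" unfolding e[symmetric] S_def using k FG by algebra
    finally have Dx: "S \<otimes>\<^bsub>Q\<^esub> F = D \<otimes>\<^bsub>Q\<^esub> x" ..
    have "D \<otimes>\<^bsub>Q\<^esub> y = u \<otimes>\<^bsub>Q\<^esub> (F \<otimes>\<^bsub>Q\<^esub> y) \<oplus>\<^bsub>Q\<^esub> G \<otimes>\<^bsub>Q\<^esub> (v \<otimes>\<^bsub>Q\<^esub> y)"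
      unfolding D_def using k FG by algebra
    also have "\<dots> = S \<otimes>\<^bsub>Q\<^esub> G" unfolding e S_def using k FG by algebra
    finally have Dy: "S \<otimes>\<^bsub>Q\<^esub> G = D \<otimes>\<^bsub>Q\<^esub> y" ..
    have D0: "D \<noteq> \<zero>\<^bsub>Q\<^esub>"
    proof
      assume "D = \<zero>\<^bsub>Q\<^esub>"
      then have "S \<otimes>\<^bsub>Q\<^esub> F = \<zero>\<^bsub>Q\<^esub>" "S \<otimes>\<^bsub>Q\<^esub> G = \<zero>\<^bsub>Q\<^esub>" using Dx Dy k by auto
      then show False using domain.integral_iff[OF domain_Q S(1)] S0 FG FGnz by blast
    qed
    obtain m where m: "m \<in> mons" "D m \<noteq> \<zero>" "L.vabove D m" using L.exists_top[OF D D0] by blast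
    \<comment> \<open>\<open>D\<close> is a combination of \<open>F\<close> and \<open>G\<close>, so
      a shift good for the supports of \<open>u\<close> and \<open>v\<close> makes \<open>h\<close>
      a combination of \<open>f\<close> and \<open>g\<close>. Since \<open>m\<close> is the leading
      exponent of \<open>D\<close>, having \<open>m + t\<close> in the image preserves the leading
      coefficient.\<close>
    have fin: "finite (supp u \<union> supp v)" "supp u \<union> supp v \<subseteq> mons" using supp k by auto
    from exists_good_shift[OF fin m(1)] obtain t where t: "good_shift (supp u \<union> supp v) t" "m + t \<in> \<mu> ` mons"
      by (elim exE conjE) (rule that)
    have sub: "supp u \<subseteq> supp u \<union> supp v" "supp v \<subseteq> supp u \<union> supp v" by auto
    note tc = good_shiftD[OF t(1)]
    obtain d where d: "d \<in> mons" "m + t = \<mu> d" using t(2) by blast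
    define u' v' h where "u' = shift t u" and "v' = shift t v" and "h = shift t D"
    have k': "u' \<in> carrier Q" "v' \<in> carrier Q" "h \<in> carrier Q"
      using shift_closed[OF _ tc] k D by (auto simp: u'_def v'_def h_def)
    have "h = shift t (u \<otimes>\<^bsub>Q\<^esub> F) \<oplus>\<^bsub>Q\<^esub> shift t (v \<otimes>\<^bsub>Q\<^esub> G)"
      unfolding h_def D_def by (rule shift_add) (use k FG tc in auto)
    then have h: "h = u' \<otimes>\<^bsub>Q\<^esub> f \<oplus>\<^bsub>Q\<^esub> v' \<otimes>\<^bsub>Q\<^esub> g"
      using good_shift_mult[OF k(3) f sub(1) t(1)] good_shift_mult[OF k(4) g sub(2) t(1)]
      by (auto simp: u'_def v'_def F_def G_def)
    have hd: "h d = D m" "W.vabove h d" unfolding h_def by (rule shift_top[OF D m(1,3) tc d])+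
    have h0: "h \<noteq> \<zero>\<^bsub>Q\<^esub>" using hd m(2) by (auto simp: mpoly_zero)
    define H U V where "H = phi h" and "U = phi u'" and "V = phi v'"
    have HUV: "H \<in> carrier Q" "U \<in> carrier Q" "V \<in> carrier Q"
      using phi_closed k' by (auto simp: H_def U_def V_def)
    have HF: "H = U \<otimes>\<^bsub>Q\<^esub> F \<oplus>\<^bsub>Q\<^esub> V \<otimes>\<^bsub>Q\<^esub> G"
      unfolding H_def h U_def V_def F_def G_def
      using ring_hom_memE[OF phi_hom] k' f g by simp
    have Htop: "H (\<mu> d) = D m" "L.vabove H (\<mu> d)"
    proof -
      show "H (\<mu> d) = D m" unfolding H_def using d hd(1) by (simp add: phi_mu)
      show "L.vabove H (\<mu> d)"
        unfolding vanishes_above_def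
      proof (intro ballI impI)
        fix e assume "e \<in> mons" "vec_lex_less (\<mu> d) e"
        then show "H e = \<zero>"
          using hd(2) prec_mu d(1) phi_outside[of e h] unfolding H_def vanishes_above_def
          by (cases "e \<in> \<mu> ` mons") (auto simp: phi_mu)
      qed
    qed
    \<comment> \<open>\<open>\<tau>\<close> is the quotient of \<open>H\<close> by \<open>D\<close>
      up to \<open>S\<close>. In \<open>S H = D \<tau>\<close> the factor \<open>S\<close> is monic
      while \<open>H\<close> and \<open>D\<close> share their leading coefficient, so
      \<open>\<tau>\<close> is monic.\<close>
    define \<tau> where "\<tau> = U \<otimes>\<^bsub>Q\<^esub> x \<oplus>\<^bsub>Q\<^esub> V \<otimes>\<^bsub>Q\<^esub> y"
    have \<tau>c: "\<tau> \<in> carrier Q" using HUV k by (simp add: \<tau>_def)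
    have "S \<otimes>\<^bsub>Q\<^esub> H = U \<otimes>\<^bsub>Q\<^esub> (S \<otimes>\<^bsub>Q\<^esub> F) \<oplus>\<^bsub>Q\<^esub> V \<otimes>\<^bsub>Q\<^esub> (S \<otimes>\<^bsub>Q\<^esub> G)"
      unfolding HF using S FG HUV by algebra
    also have "\<dots> = D \<otimes>\<^bsub>Q\<^esub> \<tau>" unfolding Dx Dy \<tau>_def using D HUV k by algebra
    finally have SH: "S \<otimes>\<^bsub>Q\<^esub> H = D \<otimes>\<^bsub>Q\<^esub> \<tau>" .
    have \<tau>0: "\<tau> \<noteq> \<zero>\<^bsub>Q\<^esub>"
    proof
      assume "\<tau> = \<zero>\<^bsub>Q\<^esub>"
      then have "S \<otimes>\<^bsub>Q\<^esub> H = \<zero>\<^bsub>Q\<^esub>" using SH D by simp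
      then have "H = \<zero>\<^bsub>Q\<^esub>" using domain.integral_iff[OF domain_Q S(1) HUV(1)] S0 by blast
      then show False using phi_nonzero[OF k'(3) h0] by (simp add: H_def)
    qed
    obtain ms where ms: "ms \<in> mons" "S ms = \<one>" "L.vabove S ms" using S L.monics_iff by blast
    obtain mt where mt: "mt \<in> mons" "\<tau> mt \<noteq> \<zero>" "L.vabove \<tau> mt"
      using L.exists_top[OF \<tau>c \<tau>0] by blast
    have mud: "\<mu> d \<in> mons" using mu_closed d by simp
    note t1 = L.mult_top[OF S(1) ms(1,3) HUV(1) mud Htop(2)]
    note t2 = L.mult_top[OF D m(1,3) \<tau>c mt(1,3)]
    have v1: "(S \<otimes>\<^bsub>Q\<^esub> H) (ms + \<mu> d) = D m"
      using t1(1) ms(2) Htop(1) mpoly_coeff[OF D] by simp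
    have v2: "(S \<otimes>\<^bsub>Q\<^esub> H) (m + mt) = D m \<otimes> \<tau> mt" using t2(1) SH by simp
    have v2nz: "D m \<otimes> \<tau> mt \<noteq> \<zero>"
      using m(2) mt(2) integral_iff mpoly_coeff[OF D] mpoly_coeff[OF \<tau>c] by simp
    have "ms + \<mu> d = m + mt"
    proof (rule ccontr)
      assume ne: "ms + \<mu> d \<noteq> m + mt"
      have c: "ms + \<mu> d \<in> mons" "m + mt \<in> mons" using ms mud m mt by auto
      from L.total[OF c ne] show False
      proof
        assume "vec_lex_less (ms + \<mu> d) (m + mt)"
        then have "(S \<otimes>\<^bsub>Q\<^esub> H) (m + mt) = \<zero>" using t1(2) c unfolding vanishes_above_def by blast
        then show False using v2 v2nz by simp
      next
        assume "vec_lex_less (m + mt) (ms + \<mu> d)"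
        then have "(S \<otimes>\<^bsub>Q\<^esub> H) (ms + \<mu> d) = \<zero>"
          using t2(2) c unfolding SH vanishes_above_def by blast
        then show False using v1 m(2) by simp
      qed
    qed
    then have "D m \<otimes> \<tau> mt = D m \<otimes> \<one>" using v1 v2 mpoly_coeff[OF D] by simp
    then have "\<tau> mt = \<one>"
      using m_lcancel[OF m(2) mpoly_coeff[OF D] mpoly_coeff[OF \<tau>c] one_closed] by blast
    then have \<tau>m: "\<tau> \<in> L.monics" using L.monicsI[OF \<tau>c mt(1) _ mt(3)] by simp
    \<comment> \<open>Dividing by \<open>D\<close> up to \<open>S\<close> is thus replaced by
      dividing by \<open>H = phi h\<close> up to \<open>\<tau>\<close>, which puts the divisor into
      the image of \<open>phi\<close>.\<close>
    have quot: "\<tau> \<otimes>\<^bsub>Q\<^esub> A = B \<otimes>\<^bsub>Q\<^esub> H"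
      if A: "A \<in> carrier Q" "B \<in> carrier Q" "S \<otimes>\<^bsub>Q\<^esub> A = D \<otimes>\<^bsub>Q\<^esub> B" for A B
    proof -
      have "S \<otimes>\<^bsub>Q\<^esub> (\<tau> \<otimes>\<^bsub>Q\<^esub> A) = \<tau> \<otimes>\<^bsub>Q\<^esub> (S \<otimes>\<^bsub>Q\<^esub> A)" using S \<tau>c A(1,2) by algebra
      also have "\<dots> = B \<otimes>\<^bsub>Q\<^esub> (D \<otimes>\<^bsub>Q\<^esub> \<tau>)" unfolding A(3) using D \<tau>c A(1,2) by algebra
      also have "\<dots> = S \<otimes>\<^bsub>Q\<^esub> (B \<otimes>\<^bsub>Q\<^esub> H)" unfolding SH[symmetric] using S HUV A(1,2) by algebra
      finally show ?thesis
        using cancel[OF S0 S(1), of "\<tau> \<otimes>\<^bsub>Q\<^esub> A" "B \<otimes>\<^bsub>Q\<^esub> H"] \<tau>c A HUV by simp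
    qed
    \<comment> \<open>A second shift, chosen separately from the first: the relations
      \<open>\<tau> F = x H\<close> and \<open>\<tau> G = y H\<close> are linear in
      \<open>\<tau>\<close>, \<open>x\<close>, \<open>y\<close>.\<close>
    obtain m2 where m2: "m2 \<in> mons"
      and m2t: "\<And>t. t \<in> mons \<Longrightarrow> m2 + t \<in> \<mu> ` mons \<Longrightarrow> shift t \<tau> \<in> W.monics"
      using shift_monic[OF \<tau>m] by blast
    let ?E = "supp \<tau> \<union> supp x \<union> supp y"
    have fin: "finite ?E" "?E \<subseteq> mons" using supp k \<tau>c by auto
    from exists_good_shift[OF fin m2] obtain r where r: "good_shift ?E r" "m2 + r \<in> \<mu> ` mons"
      by (elim exE conjE) (rule that)
    have sub2: "supp \<tau> \<subseteq> ?E" "supp x \<subseteq> ?E" "supp y \<subseteq> ?E" by auto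
    note rc = good_shiftD[OF r(1)]
    define \<sigma> X Y where "\<sigma> = shift r \<tau>" and "X = shift r x" and "Y = shift r y"
    have c: "\<sigma> \<in> carrier Q" "X \<in> carrier Q" "Y \<in> carrier Q"
      using shift_closed[OF _ rc] k \<tau>c by (auto simp: \<sigma>_def X_def Y_def)
    have \<sigma>m: "\<sigma> \<in> W.monics" unfolding \<sigma>_def by (rule m2t[OF rc r(2)])
    have "\<sigma> \<otimes>\<^bsub>Q\<^esub> f = shift r (\<tau> \<otimes>\<^bsub>Q\<^esub> F)" "\<sigma> \<otimes>\<^bsub>Q\<^esub> g = shift r (\<tau> \<otimes>\<^bsub>Q\<^esub> G)"
      "X \<otimes>\<^bsub>Q\<^esub> h = shift r (x \<otimes>\<^bsub>Q\<^esub> H)" "Y \<otimes>\<^bsub>Q\<^esub> h = shift r (y \<otimes>\<^bsub>Q\<^esub> H)"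
      unfolding \<sigma>_def X_def Y_def F_def G_def H_def
      using good_shift_mult[OF \<tau>c f sub2(1) r(1)] good_shift_mult[OF \<tau>c g sub2(1) r(1)]
        good_shift_mult[OF k(1) k'(3) sub2(2) r(1)] good_shift_mult[OF k(2) k'(3) sub2(3) r(1)] by auto
    then have sf: "\<sigma> \<otimes>\<^bsub>Q\<^esub> f = X \<otimes>\<^bsub>Q\<^esub> h" and sg: "\<sigma> \<otimes>\<^bsub>Q\<^esub> g = Y \<otimes>\<^bsub>Q\<^esub> h"
      using quot[OF FG(1) k(1) Dx] quot[OF FG(2) k(2) Dy] by auto
    have "h \<otimes>\<^bsub>Q\<^esub> (f \<otimes>\<^bsub>Q\<^esub> Y) = f \<otimes>\<^bsub>Q\<^esub> (Y \<otimes>\<^bsub>Q\<^esub> h)" using k' c f g by algebra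
    also have "\<dots> = g \<otimes>\<^bsub>Q\<^esub> (\<sigma> \<otimes>\<^bsub>Q\<^esub> f)" unfolding sg[symmetric] using c f g by algebra
    also have "\<dots> = h \<otimes>\<^bsub>Q\<^esub> (g \<otimes>\<^bsub>Q\<^esub> X)" unfolding sf using k' c f g by algebra
    finally have 1: "f \<otimes>\<^bsub>Q\<^esub> Y = g \<otimes>\<^bsub>Q\<^esub> X"
      using cancel[OF h0 k'(3), of "f \<otimes>\<^bsub>Q\<^esub> Y" "g \<otimes>\<^bsub>Q\<^esub> X"] c f g by simp
    have "h \<otimes>\<^bsub>Q\<^esub> (u' \<otimes>\<^bsub>Q\<^esub> X \<oplus>\<^bsub>Q\<^esub> v' \<otimes>\<^bsub>Q\<^esub> Y) = u' \<otimes>\<^bsub>Q\<^esub> (X \<otimes>\<^bsub>Q\<^esub> h) \<oplus>\<^bsub>Q\<^esub> v' \<otimes>\<^bsub>Q\<^esub> (Y \<otimes>\<^bsub>Q\<^esub> h)"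
      using k' c by algebra
    also have "\<dots> = \<sigma> \<otimes>\<^bsub>Q\<^esub> (u' \<otimes>\<^bsub>Q\<^esub> f \<oplus>\<^bsub>Q\<^esub> v' \<otimes>\<^bsub>Q\<^esub> g)"
      unfolding sf[symmetric] sg[symmetric] using k' c f g by algebra
    also have "\<dots> = h \<otimes>\<^bsub>Q\<^esub> \<sigma>" unfolding h[symmetric] using k' c by (simp add: W.Q.m_comm)
    finally have "u' \<otimes>\<^bsub>Q\<^esub> X \<oplus>\<^bsub>Q\<^esub> v' \<otimes>\<^bsub>Q\<^esub> Y = \<sigma>"
      using cancel[OF h0 k'(3), of "u' \<otimes>\<^bsub>Q\<^esub> X \<oplus>\<^bsub>Q\<^esub> v' \<otimes>\<^bsub>Q\<^esub> Y" \<sigma>] c k' by simp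
    then show ?thesis
      using 1 c k' \<sigma>m by (intro exI[of _ X] exI[of _ Y] exI[of _ u'] exI[of _ v']) simp
  qed
qed

end

section \<open>Matrices of full rank\<close>

lemma int_matrix_det_nonzero:
  fixes M :: "nat mat"
  assumes M: "M \<in> carrier_mat n n" and r: "vec_space.rank n (map_mat rat_of_nat M) = n"
  shows "det (map_mat int M) \<noteq> 0"
proof -
  interpret V: vec_space "TYPE(rat)" n .
  have "map_mat rat_of_nat M = map_mat rat_of_int (map_mat int M)" by auto
  then have "det (map_mat rat_of_nat M) = rat_of_int (det (map_mat int M))"
    using of_int_hom.hom_det[of "map_mat int M"] by simp
  moreover have "det (map_mat rat_of_nat M) \<noteq> 0" using V.det_rank_iff[of "map_mat rat_of_nat M"] M r by simp
  ultimately show ?thesis by auto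
qed

lemma int_mult_mat_vec:
  fixes M :: "nat mat"
  assumes "M \<in> carrier_mat n n" "v \<in> carrier_vec n"
  shows "map_vec int (M *\<^sub>v v) = map_mat int M *\<^sub>v map_vec int v"
proof -
  interpret h: semiring_hom "int" by unfold_locales auto
  show ?thesis by (rule h.mult_mat_vec_hom[OF assms])
qed

lemma mat_vec_smult:
  fixes A :: "int mat"
  assumes "A \<in> carrier_mat n n" "v \<in> carrier_vec n"
  shows "A *\<^sub>v (k \<cdot>\<^sub>v v) = k \<cdot>\<^sub>v (A *\<^sub>v v)"
  by (rule eq_vecI) (use assms in auto)

lemma smult_mat_vec:
  fixes v :: "int vec"
  assumes "v \<in> carrier_vec n"
  shows "(k \<cdot>\<^sub>m 1\<^sub>m n) *\<^sub>v v = k \<cdot>\<^sub>v v"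
proof (rule eq_vecI)
  fix i assume "i < dim_vec (k \<cdot>\<^sub>v v)"
  then have i: "i < n" using assms by simp
  have "row (k \<cdot>\<^sub>m 1\<^sub>m n) i = k \<cdot>\<^sub>v row (1\<^sub>m n) i" using i by (intro eq_vecI) auto
  then have "((k \<cdot>\<^sub>m 1\<^sub>m n) *\<^sub>v v) $ i = k * (row (1\<^sub>m n) i \<bullet> v)" using i assms by simp
  also have "row (1\<^sub>m n) i \<bullet> v = (1\<^sub>m n *\<^sub>v v) $ i" using i by simp
  finally show "((k \<cdot>\<^sub>m 1\<^sub>m n) *\<^sub>v v) $ i = (k \<cdot>\<^sub>v v) $ i" using i assms by simp
qed (use assms in auto)

text \<open>The adjugate and the determinant \<open>D\<close> of the integer matrix play the part of
  an inverse: \<open>D \<noteq> 0\<close> gives injectivity, and \<open>|D| m\<close> is an integer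
  combination of the columns, that is, a difference of two vectors in the image.\<close>

lemma rational_lex_pullback:
  assumes "rational_monomial_order n prec"
  shows "\<exists>\<mu>. lex_pullback n prec \<mu>"
proof -
  obtain M :: "nat mat" where M: "M \<in> carrier_mat n n"
    and r: "vec_space.rank n (map_mat rat_of_nat M) = n"
    and prec: "\<forall>e \<in> carrier_vec n. \<forall>f \<in> carrier_vec n.
       prec e f \<longleftrightarrow> vec_lex_less (M *\<^sub>v e) (M *\<^sub>v f)"
    using assms unfolding rational_monomial_order_def by blast
  define A where "A = map_mat int M"
  define B where "B = adj_mat A"
  define D where "D = det A"
  have A: "A \<in> carrier_mat n n" using M by (simp add: A_def)
  have B: "B \<in> carrier_mat n n" and AB: "A * B = D \<cdot>\<^sub>m 1\<^sub>m n" and BA: "B * A = D \<cdot>\<^sub>m 1\<^sub>m n"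
    unfolding B_def D_def by (rule adj_mat[OF A])+
  have D: "D \<noteq> 0" unfolding D_def A_def by (rule int_matrix_det_nonzero[OF M r])
  have iM: "map_vec int (M *\<^sub>v v) = A *\<^sub>v map_vec int v" if "v \<in> carrier_vec n" for v
    unfolding A_def by (rule int_mult_mat_vec[OF M that])
  have inj: "a = b" if ab: "a \<in> carrier_vec n" "b \<in> carrier_vec n" "M *\<^sub>v a = M *\<^sub>v b" for a b
  proof -
    have c: "map_vec int a \<in> carrier_vec n" "map_vec int b \<in> carrier_vec n" using ab by auto
    have "A *\<^sub>v map_vec int a = A *\<^sub>v map_vec int b" using iM[OF ab(1)] iM[OF ab(2)] ab(3) by simp
    then have "(B * A) *\<^sub>v map_vec int a = (B * A) *\<^sub>v map_vec int b"
      using assoc_mult_mat_vec[OF B A c(1)] assoc_mult_mat_vec[OF B A c(2)] by simp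
    then have e: "D \<cdot>\<^sub>v map_vec int a = D \<cdot>\<^sub>v map_vec int b"
      unfolding BA smult_mat_vec[OF c(1)] smult_mat_vec[OF c(2)] .
    show "a = b"
    proof (rule eq_vecI)
      fix i assume i: "i < dim_vec b"
      then have "D * int (a $ i) = D * int (b $ i)"
        using arg_cong[OF e, of "\<lambda>v. v $ i"] ab by simp
      then show "a $ i = b $ i" using D by simp
    qed (use ab in simp)
  qed
  have fin: "\<exists>c\<in>carrier_vec n. \<exists>a\<in>carrier_vec n. \<exists>b\<in>carrier_vec n. m + c + M *\<^sub>v a = M *\<^sub>v b"
    if m: "m \<in> carrier_vec n" for m
  proof -
    \<comment> \<open>Chosen so that \<open>A z = |D| m\<close>; the sign makes the multiple of
      \<open>m\<close> nonnegative.\<close>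
    define z where "z = sgn D \<cdot>\<^sub>v (B *\<^sub>v map_vec int m)"
    have mi: "map_vec int m \<in> carrier_vec n" using m by simp
    have Bm: "B *\<^sub>v map_vec int m \<in> carrier_vec n" using B mi by simp
    have z: "z \<in> carrier_vec n" using Bm by (simp add: z_def)
    have "A *\<^sub>v z = sgn D \<cdot>\<^sub>v (A *\<^sub>v (B *\<^sub>v map_vec int m))"
      unfolding z_def by (rule mat_vec_smult[OF A Bm])
    also have "A *\<^sub>v (B *\<^sub>v map_vec int m) = D \<cdot>\<^sub>v map_vec int m"
      using assoc_mult_mat_vec[OF A B mi] smult_mat_vec[OF mi] AB by simp
    finally have Az: "A *\<^sub>v z = sgn D \<cdot>\<^sub>v (D \<cdot>\<^sub>v map_vec int m)" .
    \<comment> \<open>Of the multiple \<open>|D| m\<close>, one copy is \<open>m\<close> itself and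
      the remaining \<open>K\<close> copies form \<open>c\<close>.\<close>
    define K where "K = nat \<bar>D\<bar> - 1"
    have K: "\<bar>D\<bar> = int K + 1" using D by (simp add: K_def of_nat_diff)
    \<comment> \<open>\<open>b\<close> and \<open>a\<close> are the positive and negative parts of
      \<open>z\<close>, as \<open>nat\<close> cuts off at zero.\<close>
    define a b c where "a = vec n (\<lambda>i. nat (- (z $ i)))" and "b = vec n (\<lambda>i. nat (z $ i))"
      and "c = vec n (\<lambda>i. K * m $ i)"
    have abc: "a \<in> carrier_vec n" "b \<in> carrier_vec n" "c \<in> carrier_vec n"
      by (auto simp: a_def b_def c_def)
    have "map_vec int b = z + map_vec int a"
      by (rule eq_vecI) (use z in \<open>auto simp: a_def b_def\<close>)
    then have "map_vec int (M *\<^sub>v b) = A *\<^sub>v z + A *\<^sub>v map_vec int a"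
      unfolding iM[OF abc(2)] using mult_add_distrib_mat_vec[OF A z, of "map_vec int a"] abc by simp
    also have "\<dots> = A *\<^sub>v z + map_vec int (M *\<^sub>v a)" using iM[OF abc(1)] by simp
    finally have e: "map_vec int (M *\<^sub>v b) = A *\<^sub>v z + map_vec int (M *\<^sub>v a)" .
    have "m + c + M *\<^sub>v a = M *\<^sub>v b"
    proof (rule eq_vecI)
      show "dim_vec (m + c + M *\<^sub>v a) = dim_vec (M *\<^sub>v b)" using M by simp
      fix i assume "i < dim_vec (M *\<^sub>v b)"
      then have i: "i < n" using M by simp
      have Mi: "M *\<^sub>v a \<in> carrier_vec n" "M *\<^sub>v b \<in> carrier_vec n" "A *\<^sub>v z \<in> carrier_vec n"
        using M abc A z by auto
      have "int ((M *\<^sub>v b) $ i) = map_vec int (M *\<^sub>v b) $ i"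
        by (rule index_map_vec(1)[symmetric]) (use Mi i M in simp)
      also have "\<dots> = (A *\<^sub>v z) $ i + map_vec int (M *\<^sub>v a) $ i"
        unfolding e by (rule index_add_vec(1)) (use Mi i M in simp)
      also have "map_vec int (M *\<^sub>v a) $ i = int ((M *\<^sub>v a) $ i)"
        by (rule index_map_vec(1)) (use Mi i M in simp)
      also have "(A *\<^sub>v z) $ i = \<bar>D\<bar> * int (m $ i)"
        unfolding Az using i m by (simp add: abs_sgn)
      also have "\<bar>D\<bar> * int (m $ i) = int (m $ i) + int (c $ i)"
        unfolding K using i by (simp add: c_def algebra_simps)
      finally have "int ((M *\<^sub>v b) $ i) = int (m $ i + c $ i + (M *\<^sub>v a) $ i)" by simp
      then have "(M *\<^sub>v b) $ i = m $ i + c $ i + (M *\<^sub>v a) $ i" by linarith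
      also have "m $ i + c $ i = (m + c) $ i"
        by (rule index_add_vec(1)[symmetric]) (use abc i in simp)
      also have "(m + c) $ i + (M *\<^sub>v a) $ i = (m + c + M *\<^sub>v a) $ i"
        by (rule index_add_vec(1)[symmetric]) (use Mi i M in simp)
      finally show "(m + c + M *\<^sub>v a) $ i = (M *\<^sub>v b) $ i" by simp
    qed
    then show ?thesis using abc by blast
  qed
  have "lex_pullback n prec (\<lambda>e. M *\<^sub>v e)"
  proof
    show "M *\<^sub>v d \<in> carrier_vec n" if "d \<in> carrier_vec n" for d using M that by simp
    show "M *\<^sub>v (a + b) = M *\<^sub>v a + M *\<^sub>v b" if "a \<in> carrier_vec n" "b \<in> carrier_vec n" for a b
      by (rule mult_add_distrib_mat_vec[OF M that])
  qed (use inj prec fin in blast)+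
  then show ?thesis by blast
qed

section \<open>Back to the coefficient ring\<close>

lemma (in cring) mpoly_const_mult:
  assumes a: "a \<in> carrier R" and p: "p \<in> carrier (MP n)"
  shows "(mpoly_const n a \<otimes>\<^bsub>MP n\<^esub> p) e = a \<otimes> p e"
proof (cases "e \<in> carrier_vec n")
  case True
  note cf = mpoly_coeff[OF p] mpoly_coeff[OF mpoly_const_closed[OF a]]
  have "(mpoly_const n a \<otimes>\<^bsub>MP n\<^esub> p) e
      = finsum R (\<lambda>(d, d'). mpoly_const n a d \<otimes> p d') (splits n e)"
    by (rule mpoly_mult[OF True])
  also have "\<dots> = finsum R (\<lambda>(d, d'). mpoly_const n a d \<otimes> p d') {(0\<^sub>v n, e)}"
  proof (rule add.finprod_mono_neutral_cong_right)
    show "{(0\<^sub>v n, e)} \<subseteq> splits n e" using True by (auto simp: splits_def)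
    fix z assume z: "z \<in> splits n e - {(0\<^sub>v n, e)}"
    obtain d d' where zd: "z = (d, d')" by (cases z)
    then have *: "d' \<in> carrier_vec n" "d + d' = e" "(d, d') \<noteq> (0\<^sub>v n, e)"
      using z by (auto simp: splits_def)
    have "d \<noteq> 0\<^sub>v n"
    proof
      assume "d = 0\<^sub>v n"
      then show False using * left_zero_vec[OF *(1)] by auto
    qed
    then show "(case z of (d, d') \<Rightarrow> mpoly_const n a d \<otimes> p d') = \<zero>"
      using cf zd by (simp add: mpoly_const_def)
  qed (use cf in \<open>auto simp: split_beta\<close>)
  also have "\<dots> = a \<otimes> p e" using cf a by (simp add: mpoly_const_def)
  finally show ?thesis .
next
  case False
  then show ?thesis using a mpoly_outside[OF p] by (simp add: mpoly_mult_outside)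
qed

section \<open>Restriction to constant polynomials\<close>

context cring_monomial_order
begin

abbreviation cnst where "cnst \<equiv> mpoly_const n"

lemma cnst_closed: "a \<in> carrier R \<Longrightarrow> cnst a \<in> carrier Q" by (rule mpoly_const_closed)

lemma mult_cnst: "a \<in> carrier R \<Longrightarrow> p \<in> carrier Q \<Longrightarrow> (p \<otimes>\<^bsub>Q\<^esub> cnst a) e = p e \<otimes> a"
  using mpoly_const_mult[of a p n e] Q.m_comm[of p "cnst a"] mpoly_coeff[of p n e]
  by (simp add: cnst_closed m_comm)

text \<open>Constants embed into the localization: if a monic \<open>u\<close> annihilates the
  constant \<open>d\<close>, the coefficient of the product at the leading exponent of
  \<open>u\<close> is \<open>d\<close> itself.\<close>

lemma domain_if_localization_domain:
  assumes "domain (monic_localization R n prec)"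
  shows "domain R"
proof -
  interpret Z: cring_localization Q monics
    by (intro cring_localization.intro cring_localization_axioms.intro Q.is_cring submonoid_monics)
  have DL: "domain Z.L" using assms by (simp add: monic_localization_def)
  show ?thesis
  proof (rule domainI[OF is_cring])
    show "\<one> \<noteq> \<zero>"
    proof
      assume "\<one> = \<zero>"
      then have "\<one>\<^bsub>Q\<^esub> = \<zero>\<^bsub>Q\<^esub>" by (auto simp: mpoly_one mpoly_zero)
      then have "\<one>\<^bsub>Z.L\<^esub> = \<zero>\<^bsub>Z.L\<^esub>" by (simp add: Z.L_one Z.L_zero)
      then show False using domain.one_not_zero[OF DL] by simp
    qed
    fix a b assume ab: "a \<otimes> b = \<zero>" "a \<in> carrier R" "b \<in> carrier R"
    have c: "cnst a \<in> carrier Q" "cnst b \<in> carrier Q" using ab cnst_closed by auto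
    have one: "\<one>\<^bsub>Q\<^esub> \<in> monics" by (rule submonoid.one_closed[OF submonoid_monics])
    have "cnst a \<otimes>\<^bsub>Q\<^esub> cnst b = \<zero>\<^bsub>Q\<^esub>"
      by (rule ext) (use ab c in \<open>simp add: mult_cnst mpoly_zero, simp add: mpoly_const_def\<close>)
    then have "Z.frac (cnst a) \<one>\<^bsub>Q\<^esub> \<otimes>\<^bsub>Z.L\<^esub> Z.frac (cnst b) \<one>\<^bsub>Q\<^esub> = \<zero>\<^bsub>Z.L\<^esub>"
      using c one by (simp add: Z.L_zero)
    then have "Z.frac (cnst a) \<one>\<^bsub>Q\<^esub> = \<zero>\<^bsub>Z.L\<^esub> \<or> Z.frac (cnst b) \<one>\<^bsub>Q\<^esub> = \<zero>\<^bsub>Z.L\<^esub>"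
      by (rule domain.integral[OF DL]) (use c one in \<open>simp_all add: Z.frac_carrier\<close>)
    moreover have "d = \<zero>" if d: "d \<in> carrier R" "Z.frac (cnst d) \<one>\<^bsub>Q\<^esub> = \<zero>\<^bsub>Z.L\<^esub>" for d
    proof -
      have dc: "cnst d \<in> carrier Q" using d cnst_closed by simp
      obtain u where u: "u \<in> monics" "u \<otimes>\<^bsub>Q\<^esub> (cnst d \<otimes>\<^bsub>Q\<^esub> \<one>\<^bsub>Q\<^esub>) = u \<otimes>\<^bsub>Q\<^esub> (\<zero>\<^bsub>Q\<^esub> \<otimes>\<^bsub>Q\<^esub> \<one>\<^bsub>Q\<^esub>)"
        using d(2) Z.frac_eq_iff[OF dc one Q.zero_closed one] unfolding Z.L_zero by blast
      obtain m where m: "u \<in> carrier Q" "u m = \<one>" using u(1) monics_iff by blast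
      have "u \<otimes>\<^bsub>Q\<^esub> cnst d = \<zero>\<^bsub>Q\<^esub>" using u(2) m(1) dc by simp
      then have "(u \<otimes>\<^bsub>Q\<^esub> cnst d) m = \<zero>" by (simp add: mpoly_zero)
      then show "d = \<zero>" using mult_cnst[OF d(1) m(1), of m] m(2) d(1) by simp
    qed
    ultimately show "a = \<zero> \<or> b = \<zero>" using ab by blast
  qed
qed

text \<open>Multiplication by a constant acts coefficientwise, so all three relations can be read
  off at the leading exponent of the monic sum.\<close>

lemma arithmetical_at_coefficients:
  assumes ar: "arithmetical_at Q monics"
  shows "arithmetical_at R {\<one>}"
proof (rule arithmetical_atI)
  fix a b assume ab: "a \<in> carrier R" "b \<in> carrier R"
  obtain p q x y where k: "p \<in> carrier Q" "q \<in> carrier Q" "x \<in> carrier Q" "y \<in> carrier Q"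
    and e: "p \<oplus>\<^bsub>Q\<^esub> q \<in> monics" "p \<otimes>\<^bsub>Q\<^esub> cnst a = x \<otimes>\<^bsub>Q\<^esub> cnst b" "q \<otimes>\<^bsub>Q\<^esub> cnst b = y \<otimes>\<^bsub>Q\<^esub> cnst a"
    by (rule arithmetical_atE[OF ar cnst_closed[OF ab(1)] cnst_closed[OF ab(2)]])
  obtain m where m: "(p \<oplus>\<^bsub>Q\<^esub> q) m = \<one>" using e(1) monics_iff by blast
  have "p m \<oplus> q m = \<one>" using m mpoly_add[OF k(1,2)] by simp
  moreover have "p m \<otimes> a = x m \<otimes> b" "q m \<otimes> b = y m \<otimes> a"
    using fun_cong[OF e(2), of m] fun_cong[OF e(3), of m] ab k by (simp_all add: mult_cnst)
  ultimately show "\<exists>p q x y. p \<in> carrier R \<and> q \<in> carrier R \<and> x \<in> carrier R \<and> y \<in> carrier R \<and>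
      p \<oplus> q \<in> {\<one>} \<and> p \<otimes> a = x \<otimes> b \<and> q \<otimes> b = y \<otimes> a"
    by (intro exI[of _ "p m"] exI[of _ "q m"] exI[of _ "x m"] exI[of _ "y m"])
      (simp add: mpoly_coeff[OF k(1)] mpoly_coeff[OF k(2)] mpoly_coeff[OF k(3)] mpoly_coeff[OF k(4)])
qed

end

context matrix_order
begin

abbreviation cnst where "cnst \<equiv> mpoly_const n"

text \<open>Over a domain top terms multiply: for nonzero \<open>a\<close> the top coefficient of
  the left side is \<open>a\<close>, that of the right side is \<open>D m\<close> times the top
  coefficient of \<open>x\<close>.\<close>

lemma lead_coef_divides:
  assumes S: "S \<in> W.monics" and D: "D \<in> carrier Q" "m \<in> mons" "D m \<noteq> \<zero>" "W.vabove D m"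
    and x: "x \<in> carrier Q" and a: "a \<in> carrier R" and e: "S \<otimes>\<^bsub>Q\<^esub> cnst a = D \<otimes>\<^bsub>Q\<^esub> x"
  shows "\<exists>x'\<in>carrier R. a = D m \<otimes> x'"
proof (cases "a = \<zero>")
  case True
  then show ?thesis using mpoly_coeff[OF D(1)] by (intro bexI[of _ \<zero>]) auto
next
  case False
  obtain ms where ms: "S \<in> carrier Q" "ms \<in> mons" "S ms = \<one>" "W.vabove S ms" using S W.monics_iff by blast
  have Sa: "(S \<otimes>\<^bsub>Q\<^esub> cnst a) d = S d \<otimes> a" for d by (rule W.mult_cnst[OF a ms(1)])
  have S1: "(S \<otimes>\<^bsub>Q\<^esub> cnst a) ms = a" using Sa ms(3) a by simp
  have S2: "(S \<otimes>\<^bsub>Q\<^esub> cnst a) d = \<zero>" if "d \<in> mons" "prec ms d" for d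
    using Sa ms(4) that a unfolding vanishes_above_def by simp
  have "x \<noteq> \<zero>\<^bsub>Q\<^esub>"
  proof
    assume "x = \<zero>\<^bsub>Q\<^esub>"
    then have "(D \<otimes>\<^bsub>Q\<^esub> x) ms = \<zero>" using D(1) by (simp add: mpoly_zero[symmetric]) (simp add: mpoly_zero)
    then show False using e S1 False by simp
  qed
  then obtain mx where mx: "mx \<in> mons" "x mx \<noteq> \<zero>" "W.vabove x mx" using W.exists_top[OF x] by blast
  note t = W.mult_top[OF D(1,2,4) x mx(1,3)]
  have nz: "D m \<otimes> x mx \<noteq> \<zero>" using D(3) mx(2) integral_iff mpoly_coeff[OF D(1)] mpoly_coeff[OF x] by simp
  have "ms = m + mx"
  proof (rule ccontr)
    assume ne: "ms \<noteq> m + mx"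
    have c: "m + mx \<in> mons" using D mx by simp
    from W.total[OF ms(2) c ne] show False
    proof
      assume "prec ms (m + mx)"
      then show False using S2[OF c] t(1) nz e by simp
    next
      assume "prec (m + mx) ms"
      then have "(D \<otimes>\<^bsub>Q\<^esub> x) ms = \<zero>" using t(2) ms(2) unfolding vanishes_above_def by blast
      then show False using e S1 False by simp
    qed
  qed
  then have "a = D m \<otimes> x mx" using S1 t(1) e by simp
  then show ?thesis using mpoly_coeff[OF x] by blast
qed

text \<open>A coefficient of \<open>u x + v y\<close> mixes products of unknowns, so the combination
  \<open>D\<close> of the two constants is inspected instead: its coefficients are combinations of
  \<open>a\<close> and \<open>b\<close>, and its leading one divides both.\<close>

lemma bezout_at_coefficients:
  assumes bz: "bezout_at Q W.monics"
  shows "bezout_at R {\<one>}"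
proof (rule bezout_atI)
  fix a b assume ab: "a \<in> carrier R" "b \<in> carrier R"
  show "\<exists>x y u v. x \<in> carrier R \<and> y \<in> carrier R \<and> u \<in> carrier R \<and> v \<in> carrier R \<and>
      a \<otimes> y = b \<otimes> x \<and> u \<otimes> x \<oplus> v \<otimes> y \<in> {\<one>}"
  proof (cases "a = \<zero> \<and> b = \<zero>")
    case True
    then show ?thesis by (intro exI[of _ \<one>] exI[of _ \<zero>]) simp
  next
    case nz: False
    define F G where "F = cnst a" and "G = cnst b"
    have FG: "F \<in> carrier Q" "G \<in> carrier Q" using ab W.cnst_closed by (auto simp: F_def G_def)
    obtain x y u v where k: "x \<in> carrier Q" "y \<in> carrier Q" "u \<in> carrier Q" "v \<in> carrier Q"
      and e: "F \<otimes>\<^bsub>Q\<^esub> y = G \<otimes>\<^bsub>Q\<^esub> x" and s: "u \<otimes>\<^bsub>Q\<^esub> x \<oplus>\<^bsub>Q\<^esub> v \<otimes>\<^bsub>Q\<^esub> y \<in> W.monics"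
      by (rule bezout_atE[OF bz FG])
    define S D where "S = u \<otimes>\<^bsub>Q\<^esub> x \<oplus>\<^bsub>Q\<^esub> v \<otimes>\<^bsub>Q\<^esub> y" and "D = u \<otimes>\<^bsub>Q\<^esub> F \<oplus>\<^bsub>Q\<^esub> v \<otimes>\<^bsub>Q\<^esub> G"
    have S: "S \<in> W.monics" and D: "D \<in> carrier Q" using s k FG by (auto simp: S_def D_def)
    have "D \<otimes>\<^bsub>Q\<^esub> x = F \<otimes>\<^bsub>Q\<^esub> (u \<otimes>\<^bsub>Q\<^esub> x) \<oplus>\<^bsub>Q\<^esub> v \<otimes>\<^bsub>Q\<^esub> (G \<otimes>\<^bsub>Q\<^esub> x)"
      unfolding D_def using k FG by algebra
    also have "\<dots> = S \<otimes>\<^bsub>Q\<^esub> F" unfolding e[symmetric] S_def using k FG by algebra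
    finally have Dx: "S \<otimes>\<^bsub>Q\<^esub> F = D \<otimes>\<^bsub>Q\<^esub> x" ..
    have "D \<otimes>\<^bsub>Q\<^esub> y = u \<otimes>\<^bsub>Q\<^esub> (F \<otimes>\<^bsub>Q\<^esub> y) \<oplus>\<^bsub>Q\<^esub> G \<otimes>\<^bsub>Q\<^esub> (v \<otimes>\<^bsub>Q\<^esub> y)"
      unfolding D_def using k FG by algebra
    also have "\<dots> = S \<otimes>\<^bsub>Q\<^esub> G" unfolding e S_def using k FG by algebra
    finally have Dy: "S \<otimes>\<^bsub>Q\<^esub> G = D \<otimes>\<^bsub>Q\<^esub> y" ..
    obtain ms where ms: "S \<in> carrier Q" "S ms = \<one>" using S W.monics_iff by blast
    have D0: "D \<noteq> \<zero>\<^bsub>Q\<^esub>"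
    proof
      assume "D = \<zero>\<^bsub>Q\<^esub>"
      then have "S \<otimes>\<^bsub>Q\<^esub> F = \<zero>\<^bsub>Q\<^esub>" "S \<otimes>\<^bsub>Q\<^esub> G = \<zero>\<^bsub>Q\<^esub>" using Dx Dy k by auto
      then have "(S \<otimes>\<^bsub>Q\<^esub> F) ms = \<zero>" "(S \<otimes>\<^bsub>Q\<^esub> G) ms = \<zero>" by (auto simp: mpoly_zero)
      then show False
        using nz ab ms(2) W.mult_cnst[OF ab(1) ms(1), of ms] W.mult_cnst[OF ab(2) ms(1), of ms]
        by (auto simp: F_def G_def)
    qed
    obtain m where m: "m \<in> mons" "D m \<noteq> \<zero>" "W.vabove D m" using W.exists_top[OF D D0] by blast
    obtain x' where x': "x' \<in> carrier R" "a = D m \<otimes> x'"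
      using lead_coef_divides[OF S D m k(1) ab(1)] Dx unfolding F_def by blast
    obtain y' where y': "y' \<in> carrier R" "b = D m \<otimes> y'"
      using lead_coef_divides[OF S D m k(2) ab(2)] Dy unfolding G_def by blast
    define c U V where "c = D m" and "U = u m" and "V = v m"
    have cUV: "c \<in> carrier R" "U \<in> carrier R" "V \<in> carrier R" and c0: "c \<noteq> \<zero>"
      using mpoly_coeff[OF D] mpoly_coeff[OF k(3)] mpoly_coeff[OF k(4)] m(2)
      by (auto simp: c_def U_def V_def)
    note x'' = x'[folded c_def] and y'' = y'[folded c_def]
    have "c = U \<otimes> a \<oplus> V \<otimes> b"
      unfolding c_def D_def F_def G_def U_def V_def
      using ab k by (simp add: mpoly_add W.mult_cnst W.cnst_closed)
    also have "\<dots> = c \<otimes> (U \<otimes> x' \<oplus> V \<otimes> y')" unfolding x''(2) y''(2) using cUV x'(1) y'(1) by algebra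
    finally have "c \<otimes> \<one> = c \<otimes> (U \<otimes> x' \<oplus> V \<otimes> y')" using cUV by simp
    then have "\<one> = U \<otimes> x' \<oplus> V \<otimes> y'"
      using m_lcancel[OF c0 cUV(1) one_closed, of "U \<otimes> x' \<oplus> V \<otimes> y'"] cUV x'(1) y'(1) by simp
    moreover have "a \<otimes> y' = b \<otimes> x'" unfolding x''(2) y''(2) using cUV x'(1) y'(1) by algebra
    ultimately show ?thesis
      using x'(1) y'(1) cUV by (intro exI[of _ x'] exI[of _ y'] exI[of _ U] exI[of _ V]) simp
  qed
qed

section \<open>Krull dimension of the coefficient ring\<close>

definition xmon :: "'a \<Rightarrow> nat vec \<Rightarrow> 'a" where
  "xmon b = (\<lambda>e. if e = unit_vec n 0 then b else \<zero>)"

lemma xmon_closed: "b \<in> carrier R \<Longrightarrow> xmon b \<in> carrier Q"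
  by (rule mpoly_carrierI) (auto simp: xmon_def)

lemma mult_xmon:
  assumes p: "p \<in> carrier Q" and b: "b \<in> carrier R" and e: "e \<in> mons"
  shows "(p \<otimes>\<^bsub>Q\<^esub> xmon b) (e + unit_vec n 0) = p e \<otimes> b"
proof -
  let ?u = "unit_vec n 0 :: nat vec"
  note cf = mpoly_coeff[OF p] mpoly_coeff[OF xmon_closed[OF b]]
  have eu: "e + ?u \<in> mons" using e by simp
  have "(p \<otimes>\<^bsub>Q\<^esub> xmon b) (e + ?u) = finsum R (\<lambda>(d, d'). p d \<otimes> xmon b d') (splits n (e + ?u))"
    by (rule mpoly_mult[OF eu])
  also have "\<dots> = finsum R (\<lambda>(d, d'). p d \<otimes> xmon b d') {(e, ?u)}"
  proof (rule add.finprod_mono_neutral_cong_right)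
    show "{(e, ?u)} \<subseteq> splits n (e + ?u)" using e by (auto simp: splits_def)
    fix z assume z: "z \<in> splits n (e + ?u) - {(e, ?u)}"
    obtain d d' where zd: "z = (d, d')" by (cases z)
    then have *: "d \<in> mons" "d + d' = e + ?u" "(d, d') \<noteq> (e, ?u)"
      using z by (auto simp: splits_def)
    have "d' \<noteq> ?u"
    proof
      assume "d' = ?u"
      then show False using * vec_add_right_cancel[of d n e ?u] e by auto
    qed
    then show "(case z of (d, d') \<Rightarrow> p d \<otimes> xmon b d') = \<zero>" using zd cf by (simp add: xmon_def)
  qed (use cf in \<open>auto simp: split_beta\<close>)
  also have "\<dots> = p e \<otimes> b" using cf b by (simp add: xmon_def)
  finally show ?thesis .
qed

lemma mult_xmon_zero:
  assumes p: "p \<in> carrier Q" and b: "b \<in> carrier R" and e: "e \<in> mons" "e $ 0 = 0" and n: "n \<ge> 1"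
  shows "(p \<otimes>\<^bsub>Q\<^esub> xmon b) e = \<zero>"
  unfolding mpoly_mult[OF e(1)]
proof (rule add.finprod_one_eqI)
  fix z assume z: "z \<in> splits n e"
  obtain d d' where zd: "z = (d, d')" by (cases z)
  have "d' \<noteq> unit_vec n 0" using z zd e(2) n by (auto simp: splits_def)
  then show "(case z of (d, d') \<Rightarrow> p d \<otimes> xmon b d') = \<zero>"
    using zd mpoly_coeff[OF p] by (simp add: xmon_def)
qed

lemma mons_cases:
  assumes "e \<in> mons" "n \<ge> 1"
  obtains "e $ 0 = 0" | e' where "e' \<in> mons" "e = e' + unit_vec n 0" "e $ 0 = Suc (e' $ 0)"
proof (cases "e $ 0")
  case (Suc k)
  define e' where "e' = e - unit_vec n 0"
  have c: "e' \<in> mons" using assms by (simp add: e'_def)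
  have "e = e' + unit_vec n 0"
  proof (rule eq_vecI)
    fix i assume "i < dim_vec (e' + unit_vec n 0)"
    then show "e $ i = (e' + unit_vec n 0) $ i" using assms Suc by (cases "i = 0") (auto simp: e'_def)
  qed (use assms c in simp)
  moreover have "e $ 0 = Suc (e' $ 0)" using assms Suc by (simp add: e'_def)
  ultimately show ?thesis using that(2) c by blast
qed (use that(1) in blast)

text \<open>The factor \<open>1 + b X\<close> is invertible as a power series in the first variable:
  the coefficients of \<open>r\<close> are recovered from those of the product by increasing
  exponent of that variable.\<close>

lemma coeffs_divisible:
  assumes r: "r \<in> carrier Q" and b: "b \<in> carrier R" and a: "a \<in> carrier R" and n: "n \<ge> 1"
    and dv: "\<And>e. e \<in> mons \<Longrightarrow> \<exists>t\<in>carrier R. r e \<oplus> (r \<otimes>\<^bsub>Q\<^esub> xmon b) e = t \<otimes> a"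
    and e: "e \<in> mons"
  shows "\<exists>t\<in>carrier R. r e = t \<otimes> a"
  using e
proof (induction "e $ 0" arbitrary: e)
  case 0
  then have "(r \<otimes>\<^bsub>Q\<^esub> xmon b) e = \<zero>" using mult_xmon_zero[OF r b _ _ n] by simp
  then show ?case using dv[OF 0(2)] mpoly_coeff[OF r] by simp
next
  case (Suc k)
  obtain e' where e': "e' \<in> mons" "e = e' + unit_vec n 0" "e $ 0 = Suc (e' $ 0)"
    using mons_cases[OF Suc(3) n] Suc(2) by (metis nat.distinct(1))
  then obtain t' where t': "t' \<in> carrier R" "r e' = t' \<otimes> a" using Suc(1)[of e'] Suc(2) by auto
  obtain t where t: "t \<in> carrier R" "r e \<oplus> (r \<otimes>\<^bsub>Q\<^esub> xmon b) e = t \<otimes> a" using dv[OF Suc(3)] by blast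
  have "(r \<otimes>\<^bsub>Q\<^esub> xmon b) e = t' \<otimes> a \<otimes> b" unfolding e'(2) mult_xmon[OF r b e'(1)] t'(2) ..
  then have *: "r e \<oplus> t' \<otimes> a \<otimes> b = t \<otimes> a" using t by simp
  have re: "r e \<in> carrier R" by (rule mpoly_coeff[OF r])
  have "r e = (r e \<oplus> t' \<otimes> a \<otimes> b) \<ominus> t' \<otimes> a \<otimes> b" using re t'(1) a b by algebra
  also have "\<dots> = (t \<ominus> t' \<otimes> b) \<otimes> a" unfolding * using t(1) t'(1) a b by algebra
  finally show ?case using t(1) t'(1) b by (intro bexI[of _ "t \<ominus> t' \<otimes> b"]) simp_all
qed

text \<open>For a chain \<open>P\<^sub>0 \<subset> P\<^sub>1 \<subset> P\<^sub>2\<close> take \<open>a \<in> P\<^sub>1 - P\<^sub>0\<close> and \<open>b \<in> P\<^sub>2 - P\<^sub>1\<close>. Comparing \<open>a\<close> with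
  \<open>1 + b X\<close> produces a monic polynomial which modulo \<open>P\<^sub>1\<close> is a multiple of \<open>1 + b X\<close>, so that \<open>b\<close>
  is a unit modulo \<open>P\<^sub>1\<close>.\<close>

lemma krull_dim_coefficients:
  assumes ar: "arithmetical_at Q W.monics" and n: "n \<ge> 1"
  shows "krull_dim R \<le> 1"
  unfolding krull_dim_le_one_iff
proof (rule notI, elim exE conjE)
  fix P0 P1 P2 assume P: "primeideal P0 R" "primeideal P1 R" "primeideal P2 R" "P0 \<subset> P1" "P1 \<subset> P2"
  interpret P0: primeideal P0 R by (rule P)
  interpret P1: primeideal P1 R by (rule P)
  interpret P2: primeideal P2 R by (rule P)
  obtain a where a: "a \<in> P1" "a \<notin> P0" using P(4) by blast
  obtain b where b: "b \<in> P2" "b \<notin> P1" using P(5) by blast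
  have ac: "a \<in> carrier R" and bc: "b \<in> carrier R" using a b P1.Icarr P2.Icarr by auto
  have a0: "a \<noteq> \<zero>" using a P0.zero_closed by blast
  have one: "\<one> \<notin> P1" "\<one> \<notin> P2"
    using P1.one_imp_carrier P1.I_notcarr P2.one_imp_carrier P2.I_notcarr by auto
  let ?u = "unit_vec n 0 :: nat vec"
  define B where "B = \<one>\<^bsub>Q\<^esub> \<oplus>\<^bsub>Q\<^esub> xmon b"
  have Bc: "B \<in> carrier Q" using xmon_closed[OF bc] by (simp add: B_def)
  obtain p q x y where k: "p \<in> carrier Q" "q \<in> carrier Q" "x \<in> carrier Q" "y \<in> carrier Q"
    and s: "p \<oplus>\<^bsub>Q\<^esub> q \<in> W.monics" and e: "p \<otimes>\<^bsub>Q\<^esub> cnst a = x \<otimes>\<^bsub>Q\<^esub> B" "q \<otimes>\<^bsub>Q\<^esub> B = y \<otimes>\<^bsub>Q\<^esub> cnst a"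
    by (rule arithmetical_atE[OF ar W.cnst_closed[OF ac] Bc])
  have mB: "(r \<otimes>\<^bsub>Q\<^esub> B) d = r d \<oplus> (r \<otimes>\<^bsub>Q\<^esub> xmon b) d" if "r \<in> carrier Q" for r d
  proof -
    have "r \<otimes>\<^bsub>Q\<^esub> B = r \<oplus>\<^bsub>Q\<^esub> r \<otimes>\<^bsub>Q\<^esub> xmon b"
      unfolding B_def using that xmon_closed[OF bc] by (simp add: W.Q.r_distr)
    then show ?thesis using that xmon_closed[OF bc] by (simp add: mpoly_add)
  qed
  have qe: "\<exists>t\<in>carrier R. q d = t \<otimes> a" if "d \<in> mons" for d
  proof (rule coeffs_divisible[OF k(2) bc ac n _ that])
    show "\<exists>t\<in>carrier R. q d \<oplus> (q \<otimes>\<^bsub>Q\<^esub> xmon b) d = t \<otimes> a" if "d \<in> mons" for d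
      unfolding mB[OF k(2), symmetric] e(2) W.mult_cnst[OF ac k(4)] using mpoly_coeff[OF k(4)] by blast
  qed
  have xe: "\<exists>t\<in>carrier R. x d = t \<otimes> a" if "d \<in> mons" for d
  proof (rule coeffs_divisible[OF k(3) bc ac n _ that])
    show "\<exists>t\<in>carrier R. x d \<oplus> (x \<otimes>\<^bsub>Q\<^esub> xmon b) d = t \<otimes> a" if "d \<in> mons" for d
      unfolding mB[OF k(3), symmetric] e(1)[symmetric] W.mult_cnst[OF ac k(1)]
      using mpoly_coeff[OF k(1)] by blast
  qed
  \<comment> \<open>\<open>F\<close> is \<open>x\<close> divided by \<open>a\<close>. Cancelling
    \<open>a\<close> in \<open>p a = x (1 + b X)\<close> gives \<open>p = F (1 + b X)\<close>, split
    below by whether the first variable occurs in the exponent.\<close>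
  obtain F where F: "\<forall>d\<in>mons. F d \<in> carrier R \<and> x d = F d \<otimes> a"
    using bchoice[of mons "\<lambda>d t. t \<in> carrier R \<and> x d = t \<otimes> a"] xe by blast
  have Fc: "F d \<in> carrier R" and Fx: "x d = F d \<otimes> a" if "d \<in> mons" for d using F that by auto
  \<comment> \<open>So \<open>q\<close> vanishes modulo \<open>P1\<close>, and \<open>p\<close>
    inherits the leading one of the monic sum modulo \<open>P1\<close>.\<close>
  have qP: "q d \<in> P1" if "d \<in> mons" for d
    using qe[OF that] a(1) P1.I_l_closed by auto
  have pe: "p d \<otimes> a = x d \<oplus> (x \<otimes>\<^bsub>Q\<^esub> xmon b) d" for d
    using fun_cong[OF e(1), of d] unfolding W.mult_cnst[OF ac k(1)] mB[OF k(3)] .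
  have p_low: "p d = F d" if d: "d \<in> mons" "d $ 0 = 0" for d
  proof -
    have "p d \<otimes> a = F d \<otimes> a" using pe[of d] mult_xmon_zero[OF k(3) bc d n] Fx[OF d(1)] Fc[OF d(1)] ac by simp
    then show ?thesis using m_rcancel[OF a0 ac mpoly_coeff[OF k(1)] Fc[OF d(1)]] by simp
  qed
  have p_high: "p (d + ?u) = F (d + ?u) \<oplus> F d \<otimes> b" if d: "d \<in> mons" for d
  proof -
    have du: "d + ?u \<in> mons" using d by simp
    note c = Fc[OF d] Fc[OF du]
    have "p (d + ?u) \<otimes> a = F (d + ?u) \<otimes> a \<oplus> F d \<otimes> a \<otimes> b"
      using pe[of "d + ?u"] mult_xmon[OF k(3) bc d] Fx[OF d] Fx[OF du] by simp
    also have "\<dots> = (F (d + ?u) \<oplus> F d \<otimes> b) \<otimes> a" using c ac bc by algebra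
    finally show ?thesis using m_rcancel[OF a0 ac mpoly_coeff[OF k(1)]] c bc by simp
  qed
  obtain m where m: "m \<in> mons" "(p \<oplus>\<^bsub>Q\<^esub> q) m = \<one>" "W.vabove (p \<oplus>\<^bsub>Q\<^esub> q) m"
    using s W.monics_iff by blast
  have pq: "(p \<oplus>\<^bsub>Q\<^esub> q) d = p d \<oplus> q d" for d by (rule mpoly_add[OF k(1,2)])
  have pm: "p m \<notin> P1"
    using P1.a_closed[OF _ qP[OF m(1)], of "p m"] m(2) one(1) pq[of m] by auto
  \<comment> \<open>The support of \<open>F\<close> modulo \<open>P1\<close>; its largest member
    \<open>d\<close> is the leading exponent of \<open>F\<close> there, and \<open>d + ?u\<close>
    with coefficient \<open>F d \<otimes> b\<close> gives the leading term of
    \<open>p\<close>.\<close>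
  define E where "E = {d \<in> mons. F d \<notin> P1}"
  have "E \<subseteq> {d. x d \<noteq> \<zero>}"
  proof
    fix d assume "d \<in> E"
    then have d: "d \<in> mons" "F d \<notin> P1" by (auto simp: E_def)
    then have "F d \<noteq> \<zero>" using P1.zero_closed by auto
    then show "d \<in> {d. x d \<noteq> \<zero>}" using Fx[OF d(1)] Fc[OF d(1)] ac a0 integral_iff by simp
  qed
  then have finE: "finite E" using mpoly_finite[OF k(3)] finite_subset by blast
  have pP: "p d \<in> P1" if d: "d \<in> mons" "F d \<in> P1" "\<And>d'. d' \<in> mons \<Longrightarrow> d = d' + ?u \<Longrightarrow> F d' \<in> P1" for d
  proof (rule mons_cases[OF d(1) n])
    assume "d $ 0 = 0"
    then show ?thesis using p_low[OF d(1)] d(2) by simp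
  next
    fix d' assume d': "d' \<in> mons" "d = d' + ?u"
    then have "F d' \<otimes> b \<in> P1" using d(3) bc P1.I_r_closed by simp
    then show ?thesis using p_high[OF d'(1)] d(2) d'(2) P1.a_closed by simp
  qed
  have "E \<noteq> {}"
  proof
    assume "E = {}"
    then have "F d \<in> P1" if "d \<in> mons" for d using that by (auto simp: E_def)
    then show False using pP[OF m(1)] m(1) pm by blast
  qed
  then obtain d where dE: "d \<in> E" and dmax: "\<forall>d'\<in>E. d' \<noteq> d \<longrightarrow> prec d' d"
    using W.exists_max[OF finE] by (auto simp: E_def)
  have d: "d \<in> mons" "F d \<notin> P1" using dE by (auto simp: E_def)
  have FP: "F d' \<in> P1" if "d' \<in> mons" "prec d d'" for d'
  proof (rule ccontr)
    assume "F d' \<notin> P1"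
    then have "d' \<in> E" using that by (simp add: E_def)
    moreover have "d' \<noteq> d" using that W.irrefl by blast
    ultimately have "prec d' d" using dmax by blast
    then show False using W.trans[OF d(1) that(1) d(1) that(2)] W.irrefl[OF d(1)] by blast
  qed
  have du: "d + ?u \<in> mons" using d by simp
  \<comment> \<open>For \<open>n \<ge> 1\<close> the first variable is a proper monomial, so
    multiplying by it strictly raises the exponent.\<close>
  have "?u \<noteq> 0\<^sub>v n"
  proof
    assume "?u = 0\<^sub>v n"
    then have "?u $ 0 = (0\<^sub>v n :: nat vec) $ 0" by simp
    then show False using n by simp
  qed
  then have "prec (0\<^sub>v n) ?u" using prec_zero[of ?u] by simp
  then have "prec d (d + ?u)" using W.add_left[of "0\<^sub>v n" ?u d] d(1) by simp
  then have Fdu: "F (d + ?u) \<in> P1" using FP du by blast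
  have Fb: "F d \<otimes> b \<notin> P1" using P1.I_prime[OF Fc[OF d(1)] bc] d(2) b(2) by blast
  have val: "(p \<oplus>\<^bsub>Q\<^esub> q) (d + ?u) = F d \<otimes> b \<oplus> (F (d + ?u) \<oplus> q (d + ?u))"
    unfolding pq p_high[OF d(1)] using Fc[OF d(1)] Fc[OF du] bc mpoly_coeff[OF k(2), of "d + ?u"] by algebra
  have rest: "F (d + ?u) \<oplus> q (d + ?u) \<in> P1" using Fdu qP[OF du] by (rule P1.a_closed)
  have nz: "(p \<oplus>\<^bsub>Q\<^esub> q) (d + ?u) \<noteq> \<zero>"
  proof
    assume z: "(p \<oplus>\<^bsub>Q\<^esub> q) (d + ?u) = \<zero>"
    define w where "w = F (d + ?u) \<oplus> q (d + ?u)"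
    have w: "w \<in> P1" "w \<in> carrier R" using rest P1.Icarr by (auto simp: w_def)
    have Fc': "F d \<otimes> b \<in> carrier R" using Fc[OF d(1)] bc by simp
    have "F d \<otimes> b = (F d \<otimes> b \<oplus> w) \<ominus> w" using Fc' w(2) by algebra
    also have "\<dots> = \<ominus> w" using z val w(2) by (simp add: w_def[symmetric] minus_eq)
    finally show False using Fb P1.a_inv_closed[OF w(1)] by simp
  qed
  then have "\<not> prec m (d + ?u)" using m(3) du unfolding vanishes_above_def by blast
  \<comment> \<open>Equality makes \<open>b\<close> invertible modulo \<open>P1\<close>, so one
    would lie in \<open>P2\<close>. If \<open>m\<close> is larger, \<open>p\<close> vanishes at
    \<open>m\<close> modulo \<open>P1\<close>, contrary to its being monic there.\<close>
  then have "d + ?u = m \<or> prec (d + ?u) m" using W.total[OF du m(1)] by blast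
  then show False
  proof
    assume "d + ?u = m"
    then have "\<one> = F d \<otimes> b \<oplus> (F (d + ?u) \<oplus> q (d + ?u))" using m(2) val by simp
    moreover have "F d \<otimes> b \<in> P2" by (rule P2.I_l_closed[OF b(1) Fc[OF d(1)]])
    moreover have "F (d + ?u) \<oplus> q (d + ?u) \<in> P2" using rest P(5) by blast
    ultimately show False using one(2) P2.a_closed by simp
  next
    assume lt: "prec (d + ?u) m"
    have "F m \<in> P1"
      using FP[OF m(1)] W.trans[OF d(1) du m(1) \<open>prec d (d + ?u)\<close> lt] by blast
    moreover have "F d' \<in> P1" if d': "d' \<in> mons" "m = d' + ?u" for d'
    proof -
      have "prec d d'"
      proof (rule ccontr)
        assume no: "\<not> prec d d'"
        have u: "?u \<in> mons" by simp
        have "d = d' \<or> prec d' d" using W.total[OF d(1) d'(1)] no by blast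
        then have "d + ?u = m \<or> prec m (d + ?u)" using W.add[OF d'(1) d(1) u] d'(2) by blast
        then show False
          using lt W.irrefl[OF m(1)] W.irrefl[OF du] W.trans[OF du m(1) du lt] by auto
      qed
      then show ?thesis using FP d'(1) by blast
    qed
    ultimately have "p m \<in> P1" using pP[OF m(1)] by blast
    then show False using pm by blast
  qed
qed

end

theorem theorem19:
  fixes R :: "('a, 'm) ring_scheme"
    and n :: nat
    and prec :: "nat vec \<Rightarrow> nat vec \<Rightarrow> bool"
  assumes "cring R"
    and "n \<ge> 1"
    and "rational_monomial_order n prec"
  shows "((bezout_domain (monic_localization R n prec) \<longleftrightarrow> bezout_domain R \<and> krull_dim R \<le> 1) \<and>
          (bezout_domain (monic_localization R n prec) \<longrightarrow>
             krull_dim (monic_localization R n prec) \<le> 1)) \<and>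
         ((prufer_domain (monic_localization R n prec) \<longleftrightarrow> prufer_domain R \<and> krull_dim R \<le> 1) \<and>
          (prufer_domain (monic_localization R n prec) \<longrightarrow>
             krull_dim (monic_localization R n prec) \<le> 1))"
proof -
  let ?A = "monic_localization R n prec"
  obtain \<mu> where pb: "lex_pullback n prec \<mu>" using rational_lex_pullback[OF assms(3)] by blast
  interpret C: cring_monomial_order R n prec
    by (intro cring_monomial_order.intro assms(1) lex_pullback.monomial_order_prec[OF pb])
  show ?thesis
  \<comment> \<open>If \<open>R\<close> is no domain, neither is the localization, and all four ring
    conditions fail.\<close>
  proof (cases "domain R")
    case False
    then have "\<not> domain ?A" using C.domain_if_localization_domain by blast
    then have "\<not> bezout_domain ?A" "\<not> prufer_domain ?A" "\<not> bezout_domain R" "\<not> prufer_domain R"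
      using False bezout_domain.axioms(1) prufer_domain.axioms(1) by blast+
    then show ?thesis by blast
  next
    case True
    interpret M: matrix_order R n prec \<mu>
      by (intro matrix_order.intro True pb)
    interpret Z: domain_localization M.Q C.monics
      by (intro domain_localization.intro domain_localization_axioms.intro
          cring_localization.intro cring_localization_axioms.intro C.Q.is_cring M.domain_Q
          C.submonoid_monics C.zero_notin_monics M.one_not_zero)
    have A: "?A = Z.L" by (simp add: monic_localization_def)
    have bA: "bezout_domain ?A \<longleftrightarrow> bezout_at M.Q C.monics"
      unfolding A domain.bezout_domain_iff[OF Z.domain_L] by (rule Z.bezout_at_L)
    have pA: "prufer_domain ?A \<longleftrightarrow> arithmetical_at M.Q C.monics"
      unfolding A domain.prufer_domain_iff[OF Z.domain_L] by (rule Z.arithmetical_at_L)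
    have down: "prufer_domain R \<and> krull_dim R \<le> 1" if "arithmetical_at M.Q C.monics"
      using C.arithmetical_at_coefficients[OF that] M.krull_dim_coefficients[OF that assms(2)]
        M.prufer_domain_iff by blast
    have up: "arithmetical_at M.Q C.monics \<and> krull_dim ?A \<le> 1"
      if "prufer_domain R \<and> krull_dim R \<le> 1"
    proof -
      have "arithmetical_at R {\<one>\<^bsub>R\<^esub>}" "dim_le_one_at R {\<one>\<^bsub>R\<^esub>}"
        using that M.prufer_domain_iff M.krull_dim_le_one_iff_dim_le_one_at by auto
      then have "arithmetical_at M.Q C.monics" "dim_le_one_at M.Q C.monics"
        using M.lex_arithmetical_dim M.arithmetical_at_descent M.dim_le_one_at_descent by blast+
      then show ?thesis
        unfolding A domain.krull_dim_le_one_iff_dim_le_one_at[OF Z.domain_L]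
        using Z.dim_le_one_at_L by blast
    qed
    have bdown: "bezout_domain R" if "bezout_at M.Q C.monics"
      using M.bezout_at_coefficients[OF that] M.bezout_domain_iff by blast
    have bup: "bezout_at M.Q C.monics" if "bezout_domain R" "krull_dim R \<le> 1"
    proof -
      have "bezout_at R {\<one>\<^bsub>R\<^esub>}" "dim_le_one_at R {\<one>\<^bsub>R\<^esub>}"
        using that M.bezout_domain_iff M.krull_dim_le_one_iff_dim_le_one_at by auto
      then show ?thesis using M.lex_bezout M.bezout_at_descent by blast
    qed
    \<comment> \<open>The dimension bounds in the Bezout part are those of the Pruefer part: the
      localization is arithmetical, so \<open>down\<close> bounds the dimension of \<open>R\<close>
      and \<open>up\<close> that of the localization.\<close>
    have "arithmetical_at M.Q C.monics" if "bezout_at M.Q C.monics"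
      by (rule C.Q.bezout_at_imp_arithmetical_at[OF that])
    then show ?thesis
      using bA pA down up bdown bup by blast
  qed
qed

end
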